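(* Let $R$ be a commutative $\mathbb{Q}$-algebra, let $n\ge 1$, let $B\mathrm{GL}_n$ be the stack over $R$ parametrising rank $n$ vector bundles, and let $B\in DG^+\mathrm{CAlg}(R)$. Then $(D_*B\mathrm{GL}_n)(B)$ is equivalent to the groupoid of pairs $(M,\nabla)$, where $M$ is a projective $B^0$-module (equivalently, a vector bundle) of rank $n$ and $\nabla\colon M\to B^1\otimes_{B^0}M$ is a flat $\partial_B$-connection, i.e. a degree $1$ operator $\nabla$ on $B^{\#}\otimes_{B^0}M$ satisfying $\nabla\circ\nabla=0$ and \[ \nabla(bm)=\partial(b)m+(-1)^{\deg b}\,b\,\nabla(m)\qquad\text{for } b\in B^{\#},\ m\in M . \]
   Context: $DG^+\mathrm{CAlg}(R)$ is the category of graded-commutative differential graded $R$-algebras $A=(A^0\xrightarrow{\partial}A^1\xrightarrow{\partial}A^2\to\cdots)$ concentrated in non-negative cochain degrees; $A^{\#}$ denotes the underlying graded algebra. Morphisms $(M,\nabla)\to(M',\nabla')$ in the groupoid of pairs are $B^0$-linear isomorphisms $M\to M'$ intertwining $\nabla$ and $\nabla'$. For $A\in DG^+\mathrm{CAlg}(R)$, $DA$ is the Dold–Kan denormalisation, a cosimplicial commutative $R$-algebra. As a cosimplicial module, $D^nA=\bigoplus_{m+s=n,\ 1\le j_1<\dots<j_s\le n}\partial^{j_s}\cdots\partial^{j_1}A^m$, with cosimplicial operations determined by the cosimplicial identities together with $\sigma^i a=0$ and $\partial^0a=\sum_{i=1}^{n+1}(-1)^i\partial^ia-\partial a$ for $a\in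 A^n$. The product is the Eilenberg–Zilber shuffle product: writing $\partial^I=\partial^{i_s}\cdots\partial^{i_1}$ for $I=\{i_1<\dots<i_s\}$ with $i_1\ge1$, the product of $\partial^Ia$ and $\partial^Jb$ is $(-1)^{(J\setminus I,\,I\setminus J)}\partial^{I\cap J}(ab)$ if $\deg a=|J\setminus I|$ and $\deg b=|I\setminus J|$, and $0$ otherwise, where $(-1)^{(S,T)}$ is the sign of the shuffle permutation of $S\sqcup T$ sending the first $|S|$ elements to $S$ in order and the remaining $|T|$ elements to $T$ in order. For a groupoid-valued functor $F$ on commutative $R$-algebras, $D_*F(B):=\mathrm{holim}_{n\in\Delta}F(D^nB)$. Equivalently, $D_*F(B)$ is the groupoid whose objects are pairs $(x,g)$ with $x\in F(B^0)$ and $g\colon\partial^0x\to\partial^1x$ an isomorphism in $F(D^1B)$ satisfying the cocycle condition $\partial^1g=(\partial^2g)\circ(\partial^0g)$ in $F(D^2B)$, and whose isomorphisms $(x,g)\to(x',g')$ are isomorphisms $h\colon x\to x'$ in $F(B^0)$ with $g'\circ\partial^0h=(\partial^1h)\circ g$.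
   Formalization: In the denormalisation DB used to define D_*, the sign of ∂^0 is corrected to ∂^0 a = ∂a − Σ_{i=1}^{n+1} (−1)^i ∂^i a; the formula with the opposite overall sign gives ∂^0 1 = −∂^1 1, so ∂^0 would not be a ring homomorphism. *)

theory Defs
  imports
    "HOL-Algebra.Free_Abelian_Groups"
    "HOL-Algebra.Generated_Groups"
    "HOL-Algebra.Ideal"
    "HOL-Algebra.Module"
    "HOL-Combinatorics.Permutations"
begin

section \<open>Groupoids and their equivalences\<close>

text \<open>Arrows will be functions in \<open>extensional\<close> form, which do not remember their endpoints.
  Hence \<open>Comp G x g f\<close> receives the source \<open>x\<close> of \<open>f\<close>, and functors act on an arrow together
  with its endpoints.\<close>

record ('o, 'a) gpd =
  Ob :: "'o set"
  Hom :: "'o \<Rightarrow> 'o \<Rightarrow> 'a set"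
  Comp :: "'o \<Rightarrow> 'a \<Rightarrow> 'a \<Rightarrow> 'a"
  Ident :: "'o \<Rightarrow> 'a"

locale groupoid =
  fixes G :: "('o, 'a) gpd"
  assumes Comp_closed:
      "\<lbrakk>x \<in> Ob G; y \<in> Ob G; z \<in> Ob G; f \<in> Hom G x y; g \<in> Hom G y z\<rbrakk> \<Longrightarrow> Comp G x g f \<in> Hom G x z"
    and Comp_assoc:
      "\<lbrakk>x \<in> Ob G; y \<in> Ob G; z \<in> Ob G; w \<in> Ob G;
        f \<in> Hom G x y; g \<in> Hom G y z; h \<in> Hom G z w\<rbrakk>
       \<Longrightarrow> Comp G x h (Comp G x g f) = Comp G x (Comp G y h g) f"
    and Ident_closed: "x \<in> Ob G \<Longrightarrow> Ident G x \<in> Hom G x x"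
    and Ident_left: "\<lbrakk>x \<in> Ob G; y \<in> Ob G; f \<in> Hom G x y\<rbrakk> \<Longrightarrow> Comp G x (Ident G y) f = f"
    and Ident_right: "\<lbrakk>x \<in> Ob G; y \<in> Ob G; f \<in> Hom G x y\<rbrakk> \<Longrightarrow> Comp G x f (Ident G x) = f"
    and inverse_ex:
      "\<lbrakk>x \<in> Ob G; y \<in> Ob G; f \<in> Hom G x y\<rbrakk>
       \<Longrightarrow> \<exists>g \<in> Hom G y x. Comp G x g f = Ident G x \<and> Comp G y f g = Ident G y"

record ('o, 'a, 'p, 'b) gpd_fun =
  fob :: "'o \<Rightarrow> 'p"
  fmor :: "'o \<Rightarrow> 'o \<Rightarrow> 'a \<Rightarrow> 'b"

locale gpd_functor =
  fixes G :: "('o, 'a) gpd" and H :: "('p, 'b) gpd" and F :: "('o, 'a, 'p, 'b) gpd_fun"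
  assumes fob_closed: "x \<in> Ob G \<Longrightarrow> fob F x \<in> Ob H"
    and fmor_closed:
      "\<lbrakk>x \<in> Ob G; y \<in> Ob G; f \<in> Hom G x y\<rbrakk> \<Longrightarrow> fmor F x y f \<in> Hom H (fob F x) (fob F y)"
    and fmor_Ident: "x \<in> Ob G \<Longrightarrow> fmor F x x (Ident G x) = Ident H (fob F x)"
    and fmor_Comp:
      "\<lbrakk>x \<in> Ob G; y \<in> Ob G; z \<in> Ob G; f \<in> Hom G x y; g \<in> Hom G y z\<rbrakk>
       \<Longrightarrow> fmor F x z (Comp G x g f) = Comp H (fob F x) (fmor F y z g) (fmor F x y f)"

definition id_fun :: "('o, 'a, 'o, 'a) gpd_fun" where
  "id_fun = \<lparr>fob = (\<lambda>x. x), fmor = (\<lambda>x y f. f)\<rparr>"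

definition comp_fun ::
  "('p, 'b, 'q, 'c) gpd_fun \<Rightarrow> ('o, 'a, 'p, 'b) gpd_fun \<Rightarrow> ('o, 'a, 'q, 'c) gpd_fun" where
  "comp_fun F' F =
     \<lparr>fob = (\<lambda>x. fob F' (fob F x)), fmor = (\<lambda>x y f. fmor F' (fob F x) (fob F y) (fmor F x y f))\<rparr>"

text \<open>Between functors into a groupoid every natural transformation is an isomorphism.\<close>

definition natural_trans ::
  "('o, 'a) gpd \<Rightarrow> ('p, 'b) gpd \<Rightarrow> ('o, 'a, 'p, 'b) gpd_fun \<Rightarrow> ('o, 'a, 'p, 'b) gpd_fun
    \<Rightarrow> ('o \<Rightarrow> 'b) \<Rightarrow> bool" where
  "natural_trans G H F F' \<eta> \<longleftrightarrow>
     (\<forall>x \<in> Ob G. \<eta> x \<in> Hom H (fob F x) (fob F' x)) \<and>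
     (\<forall>x \<in> Ob G. \<forall>y \<in> Ob G. \<forall>f \<in> Hom G x y.
        Comp H (fob F x) (\<eta> y) (fmor F x y f) = Comp H (fob F x) (fmor F' x y f) (\<eta> x))"

definition equivalent_groupoids :: "('o, 'a) gpd \<Rightarrow> ('p, 'b) gpd \<Rightarrow> bool" where
  "equivalent_groupoids G H \<longleftrightarrow>
     groupoid G \<and> groupoid H \<and>
     (\<exists>F F' \<eta> \<epsilon>. gpd_functor G H F \<and> gpd_functor H G F' \<and>
        natural_trans G G id_fun (comp_fun F' F) \<eta> \<and>
        natural_trans H H (comp_fun F F') id_fun \<epsilon>)"


section \<open>Descent data in a 2-truncated cosimplicial groupoid\<close>

text \<open>The functors \<open>p i\<close> and \<open>q j\<close> are the cofaces \<open>\<partial>\<^sup>i\<close> out of levels 0 and 1. As pullback of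
  modules is only pseudo-functorial, the cosimplicial identities
  \<open>\<partial>\<^sup>j \<partial>\<^sup>i = \<partial>\<^sup>l \<partial>\<^sup>k\<close> hold up to isomorphisms \<open>c (j, i) (l, k) x : q j (p i x) \<rightarrow> q l (p k x)\<close>, which
  are inserted in the cocycle condition \<open>\<partial>\<^sup>1 g = \<partial>\<^sup>2 g \<circ> \<partial>\<^sup>0 g\<close>.\<close>

definition descent_cocycle ::
  "('o2, 'a2) gpd \<Rightarrow> (nat \<Rightarrow> ('o, 'a, 'o1, 'a1) gpd_fun) \<Rightarrow> (nat \<Rightarrow> ('o1, 'a1, 'o2, 'a2) gpd_fun)
    \<Rightarrow> (nat \<times> nat \<Rightarrow> nat \<times> nat \<Rightarrow> 'o \<Rightarrow> 'a2) \<Rightarrow> 'o \<Rightarrow> 'a1 \<Rightarrow> bool" where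
  "descent_cocycle G2 p q c x g \<longleftrightarrow>
     (let x0 = fob (p 0) x; x1 = fob (p 1) x; s = fob (q 1) x0 in
      fmor (q 1) x0 x1 g =
        Comp G2 s (c (2, 1) (1, 1) x)
          (Comp G2 s (fmor (q 2) x0 x1 g)
            (Comp G2 s (c (0, 1) (2, 0) x)
              (Comp G2 s (fmor (q 0) x0 x1 g)
                (c (1, 0) (0, 0) x)))))"

definition descent_groupoid ::
  "('o, 'a) gpd \<Rightarrow> ('o1, 'a1) gpd \<Rightarrow> ('o2, 'a2) gpd
    \<Rightarrow> (nat \<Rightarrow> ('o, 'a, 'o1, 'a1) gpd_fun) \<Rightarrow> (nat \<Rightarrow> ('o1, 'a1, 'o2, 'a2) gpd_fun)
    \<Rightarrow> (nat \<times> nat \<Rightarrow> nat \<times> nat \<Rightarrow> 'o \<Rightarrow> 'a2) \<Rightarrow> ('o \<times> 'a1, 'a) gpd" where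
  "descent_groupoid G0 G1 G2 p q c =
     \<lparr>Ob = {(x, g). x \<in> Ob G0 \<and> g \<in> Hom G1 (fob (p 0) x) (fob (p 1) x) \<and>
               descent_cocycle G2 p q c x g},
      Hom = (\<lambda>(x, g) (x', g').
         {h \<in> Hom G0 x x'.
            Comp G1 (fob (p 0) x) g' (fmor (p 0) x x' h) =
            Comp G1 (fob (p 0) x) (fmor (p 1) x x' h) g}),
      Comp = (\<lambda>(x, g). Comp G0 x),
      Ident = (\<lambda>(x, g). Ident G0 x)\<rparr>"


section \<open>Module homomorphisms and base change\<close>

definition module_hom ::
  "('a, 'p) ring_scheme \<Rightarrow> ('a, 'm, 'q) module_scheme \<Rightarrow> ('a, 'l, 's) module_scheme \<Rightarrow> ('m \<Rightarrow> 'l) set"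
  where
  "module_hom R M N =
     {h \<in> carrier M \<rightarrow> carrier N.
        (\<forall>x \<in> carrier M. \<forall>y \<in> carrier M. h (x \<oplus>\<^bsub>M\<^esub> y) = h x \<oplus>\<^bsub>N\<^esub> h y) \<and>
        (\<forall>a \<in> carrier R. \<forall>x \<in> carrier M. h (a \<odot>\<^bsub>M\<^esub> x) = a \<odot>\<^bsub>N\<^esub> h x)}"

definition module_iso ::
  "('a, 'p) ring_scheme \<Rightarrow> ('a, 'm, 'q) module_scheme \<Rightarrow> ('a, 'l, 's) module_scheme \<Rightarrow> ('m \<Rightarrow> 'l) set"
  where
  "module_iso R M N =
     {h \<in> module_hom R M N. h \<in> extensional (carrier M) \<and> bij_betw h (carrier M) (carrier N)}"

text \<open>\<open>S \<otimes>\<^bsub>\<phi>,R\<^esub> M\<close> as the free abelian group on pairs modulo the usual relations. Here \<open>S\<close> need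
  not be commutative, since it will also be the graded-commutative algebra \<open>B\<close>.\<close>

definition tensor_rels ::
  "('a, 'p) ring_scheme \<Rightarrow> ('s, 'q) ring_scheme \<Rightarrow> ('a \<Rightarrow> 's) \<Rightarrow> ('a, 'm, 't) module_scheme
    \<Rightarrow> ('s \<times> 'm \<Rightarrow>\<^sub>0 int) set" where
  "tensor_rels R S \<phi> M =
     {frag_of (s \<oplus>\<^bsub>S\<^esub> s', m) - frag_of (s, m) - frag_of (s', m) | s s' m.
        s \<in> carrier S \<and> s' \<in> carrier S \<and> m \<in> carrier M} \<union>
     {frag_of (s, m \<oplus>\<^bsub>M\<^esub> m') - frag_of (s, m) - frag_of (s, m') | s m m'.
        s \<in> carrier S \<and> m \<in> carrier M \<and> m' \<in> carrier M} \<union>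
     {frag_of (s \<otimes>\<^bsub>S\<^esub> \<phi> a, m) - frag_of (s, a \<odot>\<^bsub>M\<^esub> m) | s a m.
        s \<in> carrier S \<and> a \<in> carrier R \<and> m \<in> carrier M}"

definition tensor_ker ::
  "('a, 'p) ring_scheme \<Rightarrow> ('s, 'q) ring_scheme \<Rightarrow> ('a \<Rightarrow> 's) \<Rightarrow> ('a, 'm, 't) module_scheme
    \<Rightarrow> ('s \<times> 'm \<Rightarrow>\<^sub>0 int) set" where
  "tensor_ker R S \<phi> M =
     generate (free_Abelian_group (carrier S \<times> carrier M)) (tensor_rels R S \<phi> M)"

definition tensor_group ::
  "('a, 'p) ring_scheme \<Rightarrow> ('s, 'q) ring_scheme \<Rightarrow> ('a \<Rightarrow> 's) \<Rightarrow> ('a, 'm, 't) module_scheme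
    \<Rightarrow> ('s \<times> 'm \<Rightarrow>\<^sub>0 int) set monoid" where
  "tensor_group R S \<phi> M =
     free_Abelian_group (carrier S \<times> carrier M) Mod tensor_ker R S \<phi> M"

definition tens ::
  "('a, 'p) ring_scheme \<Rightarrow> ('s, 'q) ring_scheme \<Rightarrow> ('a \<Rightarrow> 's) \<Rightarrow> ('a, 'm, 't) module_scheme
    \<Rightarrow> 's \<Rightarrow> 'm \<Rightarrow> ('s \<times> 'm \<Rightarrow>\<^sub>0 int) set" where
  "tens R S \<phi> M s m =
     tensor_ker R S \<phi> M #>\<^bsub>free_Abelian_group (carrier S \<times> carrier M)\<^esub> frag_of (s, m)"

text \<open>The additive map out of the tensor product with \<open>s \<otimes> m \<mapsto> f s m\<close>, which exists uniquely
  for biadditive balanced \<open>f\<close>. The target group \<open>K\<close> is written multiplicatively.\<close>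

definition tensor_lift ::
  "('a, 'p) ring_scheme \<Rightarrow> ('s, 'q) ring_scheme \<Rightarrow> ('a \<Rightarrow> 's) \<Rightarrow> ('a, 'm, 't) module_scheme
    \<Rightarrow> ('k, 'u) monoid_scheme \<Rightarrow> ('s \<Rightarrow> 'm \<Rightarrow> 'k) \<Rightarrow> ('s \<times> 'm \<Rightarrow>\<^sub>0 int) set \<Rightarrow> 'k" where
  "tensor_lift R S \<phi> M K f =
     (THE h. h \<in> extensional (carrier (tensor_group R S \<phi> M)) \<and>
             h \<in> hom (tensor_group R S \<phi> M) K \<and>
             (\<forall>s \<in> carrier S. \<forall>m \<in> carrier M. h (tens R S \<phi> M s m) = f s m))"

text \<open>The fields \<open>mult\<close> and \<open>one\<close> of a module record play no role.\<close>

definition base_change ::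
  "('a, 'p) ring_scheme \<Rightarrow> ('s, 'q) ring_scheme \<Rightarrow> ('a \<Rightarrow> 's) \<Rightarrow> ('a, 'm, 't) module_scheme
    \<Rightarrow> ('s, ('s \<times> 'm \<Rightarrow>\<^sub>0 int) set) module" where
  "base_change R S \<phi> M =
     \<lparr>carrier = carrier (tensor_group R S \<phi> M),
      monoid.mult = undefined,
      one = undefined,
      zero = \<one>\<^bsub>tensor_group R S \<phi> M\<^esub>,
      add = monoid.mult (tensor_group R S \<phi> M),
      smult = (\<lambda>s. tensor_lift R S \<phi> M (tensor_group R S \<phi> M) (\<lambda>t m. tens R S \<phi> M (s \<otimes>\<^bsub>S\<^esub> t) m))\<rparr>"

text \<open>The map \<open>id \<otimes> h\<close>.\<close>

definition base_change_map ::
  "('a, 'p) ring_scheme \<Rightarrow> ('s, 'q) ring_scheme \<Rightarrow> ('a \<Rightarrow> 's) \<Rightarrow> ('a, 'm, 't) module_scheme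
    \<Rightarrow> ('a, 'l, 'u) module_scheme \<Rightarrow> ('m \<Rightarrow> 'l)
    \<Rightarrow> ('s \<times> 'm \<Rightarrow>\<^sub>0 int) set \<Rightarrow> ('s \<times> 'l \<Rightarrow>\<^sub>0 int) set" where
  "base_change_map R S \<phi> M M' h =
     tensor_lift R S \<phi> M (tensor_group R S \<phi> M') (\<lambda>s m. tens R S \<phi> M' s (h m))"

text \<open>For ring homomorphisms with \<open>\<phi> \<circ> \<psi> = \<phi>' \<circ> \<psi>'\<close> on \<open>R\<close>, the composite
  \<open>S2 \<otimes>\<^bsub>\<phi>\<^esub> (S1 \<otimes>\<^bsub>\<psi>\<^esub> M) \<cong> S2 \<otimes>\<^bsub>\<phi>\<circ>\<psi>\<^esub> M \<cong> S2 \<otimes>\<^bsub>\<phi>'\<^esub> (S1 \<otimes>\<^bsub>\<psi>'\<^esub> M)\<close> of canonical isomorphisms,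
  \<open>s \<otimes> (t \<otimes> m) \<mapsto> s \<phi>(t) \<otimes> (1 \<otimes> m)\<close>.\<close>

definition base_change_coherence ::
  "('a, 'p) ring_scheme \<Rightarrow> ('s, 'q) ring_scheme \<Rightarrow> ('u, 'v) ring_scheme
    \<Rightarrow> ('a \<Rightarrow> 's) \<Rightarrow> ('s \<Rightarrow> 'u) \<Rightarrow> ('a \<Rightarrow> 's) \<Rightarrow> ('s \<Rightarrow> 'u) \<Rightarrow> ('a, 'm, 't) module_scheme
    \<Rightarrow> ('u \<times> ('s \<times> 'm \<Rightarrow>\<^sub>0 int) set \<Rightarrow>\<^sub>0 int) set
    \<Rightarrow> ('u \<times> ('s \<times> 'm \<Rightarrow>\<^sub>0 int) set \<Rightarrow>\<^sub>0 int) set" where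
  "base_change_coherence R S1 S2 \<psi> \<phi> \<psi>' \<phi>' M =
     (let N = base_change R S1 \<psi> M; N' = base_change R S1 \<psi>' M; K = tensor_group S1 S2 \<phi>' N' in
      tensor_lift S1 S2 \<phi> N K
        (\<lambda>s. tensor_lift R S1 \<psi> M K
           (\<lambda>t m. tens S1 S2 \<phi>' N' (s \<otimes>\<^bsub>S2\<^esub> \<phi> t) (tens R S1 \<psi>' M \<one>\<^bsub>S1\<^esub> m))))"


section \<open>Projective modules of constant rank\<close>

definition free_module :: "('a, 'p) ring_scheme \<Rightarrow> nat \<Rightarrow> ('a, nat \<Rightarrow> 'a) module" where
  "free_module R k =
     \<lparr>carrier = {..<k} \<rightarrow>\<^sub>E carrier R,
      monoid.mult = undefined,
      one = undefined,
      zero = (\<lambda>i \<in> {..<k}. \<zero>\<^bsub>R\<^esub>),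
      add = (\<lambda>x y. \<lambda>i \<in> {..<k}. x i \<oplus>\<^bsub>R\<^esub> y i),
      smult = (\<lambda>a x. \<lambda>i \<in> {..<k}. a \<otimes>\<^bsub>R\<^esub> x i)\<rparr>"

definition fg_projective :: "('a, 'p) ring_scheme \<Rightarrow> ('a, 'm, 'q) module_scheme \<Rightarrow> bool" where
  "fg_projective R M \<longleftrightarrow>
     (\<exists>k. \<exists>i \<in> module_hom R M (free_module R k). \<exists>p \<in> module_hom R (free_module R k) M.
        \<forall>x \<in> carrier M. p (i x) = x)"

definition frac_rel :: "('a, 'p) ring_scheme \<Rightarrow> 'a set \<Rightarrow> (('a \<times> 'a) \<times> ('a \<times> 'a)) set" where
  "frac_rel R U =
     {((a, s), (b, t)) | a s b t. a \<in> carrier R \<and> b \<in> carrier R \<and> s \<in> U \<and> t \<in> U \<and>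
        (\<exists>u \<in> U. u \<otimes>\<^bsub>R\<^esub> (a \<otimes>\<^bsub>R\<^esub> t) = u \<otimes>\<^bsub>R\<^esub> (b \<otimes>\<^bsub>R\<^esub> s))}"

definition loc_frac :: "('a, 'p) ring_scheme \<Rightarrow> 'a set \<Rightarrow> 'a \<Rightarrow> 'a \<Rightarrow> ('a \<times> 'a) set" where
  "loc_frac R U a s = frac_rel R U `` {(a, s)}"

definition localisation :: "('a, 'p) ring_scheme \<Rightarrow> 'a set \<Rightarrow> ('a \<times> 'a) set ring" where
  "localisation R U =
     \<lparr>carrier = (carrier R \<times> U) // frac_rel R U,
      monoid.mult = (\<lambda>X Y. \<Union>(a, s) \<in> X. \<Union>(b, t) \<in> Y. loc_frac R U (a \<otimes>\<^bsub>R\<^esub> b) (s \<otimes>\<^bsub>R\<^esub> t)),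
      one = loc_frac R U \<one>\<^bsub>R\<^esub> \<one>\<^bsub>R\<^esub>,
      zero = loc_frac R U \<zero>\<^bsub>R\<^esub> \<one>\<^bsub>R\<^esub>,
      add = (\<lambda>X Y. \<Union>(a, s) \<in> X. \<Union>(b, t) \<in> Y.
               loc_frac R U (a \<otimes>\<^bsub>R\<^esub> t \<oplus>\<^bsub>R\<^esub> b \<otimes>\<^bsub>R\<^esub> s) (s \<otimes>\<^bsub>R\<^esub> t))\<rparr>"

definition projective_of_rank ::
  "('a, 'p) ring_scheme \<Rightarrow> nat \<Rightarrow> ('a, 'm, 'q) module_scheme \<Rightarrow> bool" where
  "projective_of_rank R n M \<longleftrightarrow>
     module R M \<and> fg_projective R M \<and>
     (\<forall>P. primeideal P R \<longrightarrow>
        (let U = carrier R - P; RP = localisation R U in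
         module_iso RP (base_change R RP (\<lambda>a. loc_frac R U a \<one>\<^bsub>R\<^esub>) M) (free_module RP n) \<noteq> {}))"


section \<open>The stack of rank n vector bundles\<close>

text \<open>The underlying sets of the modules range over a type \<open>'m\<close>, which plays the role of a
  universe.\<close>

definition BGL :: "nat \<Rightarrow> ('a, 'p) ring_scheme \<Rightarrow> (('a, 'm) module, 'm \<Rightarrow> 'm) gpd" where
  "BGL n S =
     \<lparr>Ob = {M. projective_of_rank S n M},
      Hom = (\<lambda>M M'. module_iso S M M'),
      Comp = (\<lambda>M g f. compose (carrier M) g f),
      Ident = (\<lambda>M. \<lambda>x \<in> carrier M. x)\<rparr>"

definition BGL_map ::
  "('a, 'p) ring_scheme \<Rightarrow> ('s, 'q) ring_scheme \<Rightarrow> ('a \<Rightarrow> 's)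
    \<Rightarrow> (('a, 'm) module, 'm \<Rightarrow> 'm,
        ('s, ('s \<times> 'm \<Rightarrow>\<^sub>0 int) set) module, ('s \<times> 'm \<Rightarrow>\<^sub>0 int) set \<Rightarrow> ('s \<times> 'm \<Rightarrow>\<^sub>0 int) set) gpd_fun"
  where
  "BGL_map R S \<phi> = \<lparr>fob = base_change R S \<phi>, fmor = base_change_map R S \<phi>\<rparr>"


section \<open>Differential graded commutative algebras\<close>

definition rat_ring :: "rat ring" where
  "rat_ring = \<lparr>carrier = UNIV, monoid.mult = (*), one = 1, zero = 0, add = (+)\<rparr>"

definition comm_Q_algebra :: "('r, 'x) ring_scheme \<Rightarrow> bool" where
  "comm_Q_algebra R \<longleftrightarrow> cring R \<and> (\<exists>h. h \<in> ring_hom rat_ring R)"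

text \<open>The record is the whole algebra \<open>A\<^sup># = \<Oplus>\<^sub>m A\<^sup>m\<close>, with \<open>gr A m = A\<^sup>m\<close>.\<close>

record ('r, 'a) dg_alg = "('r, 'a) module" +
  gr :: "nat \<Rightarrow> 'a set"
  diff :: "'a \<Rightarrow> 'a"

locale DG_CAlg = cring R + ring A + module R A
  for R :: "('r, 'x) ring_scheme" and A :: "('r, 'a, 'y) dg_alg_scheme" +
  assumes smult_mult_left:
      "\<lbrakk>r \<in> carrier R; a \<in> carrier A; b \<in> carrier A\<rbrakk>
       \<Longrightarrow> (r \<odot>\<^bsub>A\<^esub> a) \<otimes>\<^bsub>A\<^esub> b = r \<odot>\<^bsub>A\<^esub> (a \<otimes>\<^bsub>A\<^esub> b)"
    and smult_mult_right:
      "\<lbrakk>r \<in> carrier R; a \<in> carrier A; b \<in> carrier A\<rbrakk>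
       \<Longrightarrow> a \<otimes>\<^bsub>A\<^esub> (r \<odot>\<^bsub>A\<^esub> b) = r \<odot>\<^bsub>A\<^esub> (a \<otimes>\<^bsub>A\<^esub> b)"
    and gr_submodule: "submodule (gr A m) R A"
    and gr_direct_sum:
      "a \<in> carrier A \<Longrightarrow>
       \<exists>!c. (\<forall>m. c m \<in> gr A m) \<and> finite {m. c m \<noteq> \<zero>\<^bsub>A\<^esub>} \<and>
            a = (\<Oplus>\<^bsub>A\<^esub>m \<in> {m. c m \<noteq> \<zero>\<^bsub>A\<^esub>}. c m)"
    and one_gr: "\<one>\<^bsub>A\<^esub> \<in> gr A 0"
    and mult_gr: "\<lbrakk>a \<in> gr A p; b \<in> gr A q\<rbrakk> \<Longrightarrow> a \<otimes>\<^bsub>A\<^esub> b \<in> gr A (p + q)"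
    and graded_comm:
      "\<lbrakk>a \<in> gr A p; b \<in> gr A q\<rbrakk> \<Longrightarrow> a \<otimes>\<^bsub>A\<^esub> b = [((- 1) ^ (p * q) :: int)] \<cdot>\<^bsub>A\<^esub> (b \<otimes>\<^bsub>A\<^esub> a)"
    and diff_linear: "diff A \<in> module_hom R A A"
    and diff_gr: "a \<in> gr A p \<Longrightarrow> diff A a \<in> gr A (Suc p)"
    and diff_diff: "a \<in> carrier A \<Longrightarrow> diff A (diff A a) = \<zero>\<^bsub>A\<^esub>"
    and diff_Leibniz:
      "\<lbrakk>a \<in> gr A p; b \<in> carrier A\<rbrakk>
       \<Longrightarrow> diff A (a \<otimes>\<^bsub>A\<^esub> b) =
           diff A a \<otimes>\<^bsub>A\<^esub> b \<oplus>\<^bsub>A\<^esub> [((- 1) ^ p :: int)] \<cdot>\<^bsub>A\<^esub> (a \<otimes>\<^bsub>A\<^esub> diff A b)"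

definition deg0 :: "('r, 'a, 'y) dg_alg_scheme \<Rightarrow> 'a ring" where
  "deg0 A =
     \<lparr>carrier = gr A 0, monoid.mult = monoid.mult A, one = one A, zero = zero A, add = add A\<rparr>"


section \<open>Dold--Kan denormalisation\<close>

text \<open>The element \<open>\<Sum>\<^sub>I \<partial>\<^sup>I x\<^sub>I\<close> of \<open>D\<^sup>n A\<close>, with \<open>I \<subseteq> {1..n}\<close> and \<open>x\<^sub>I \<in> A\<^sup>m\<close>, \<open>m + |I| = n\<close>, is encoded as
  the function \<open>I \<mapsto> x\<^sub>I\<close>.\<close>

definition denorm_carrier :: "('r, 'a, 'y) dg_alg_scheme \<Rightarrow> nat \<Rightarrow> (nat set \<Rightarrow> 'a) set" where
  "denorm_carrier A n = (\<Pi>\<^sub>E I \<in> Pow {1..n}. gr A (n - card I))"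

text \<open>\<open>\<partial>\<^sup>I a\<close> in \<open>D\<^sup>n A\<close>.\<close>

definition dpart :: "('r, 'a, 'y) dg_alg_scheme \<Rightarrow> nat \<Rightarrow> nat set \<Rightarrow> 'a \<Rightarrow> nat set \<Rightarrow> 'a" where
  "dpart A n I a = (\<lambda>J \<in> Pow {1..n}. if J = I then a else \<zero>\<^bsub>A\<^esub>)"

text \<open>The permutation of \<open>S \<union> T\<close> (for disjoint \<open>S\<close>, \<open>T\<close>) sending its first \<open>|S|\<close> elements to \<open>S\<close> in
  order and the others to \<open>T\<close> in order.\<close>

definition shuffle_perm :: "nat set \<Rightarrow> nat set \<Rightarrow> nat \<Rightarrow> nat" where
  "shuffle_perm S T x =
     (if x \<in> S \<union> T
      then (sorted_list_of_set S @ sorted_list_of_set T) ! card {y \<in> S \<union> T. y < x}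
      else x)"

definition denorm_mult_part ::
  "('r, 'a, 'y) dg_alg_scheme \<Rightarrow> nat \<Rightarrow> nat set \<Rightarrow> nat set \<Rightarrow> 'a \<Rightarrow> 'a \<Rightarrow> nat set \<Rightarrow> 'a" where
  "denorm_mult_part A n I J a b =
     (if n - card I = card (J - I) \<and> n - card J = card (I - J)
      then dpart A n (I \<inter> J) ([sign (shuffle_perm (J - I) (I - J))] \<cdot>\<^bsub>A\<^esub> (a \<otimes>\<^bsub>A\<^esub> b))
      else dpart A n {} \<zero>\<^bsub>A\<^esub>)"

definition denorm :: "('r, 'a, 'y) dg_alg_scheme \<Rightarrow> nat \<Rightarrow> (nat set \<Rightarrow> 'a) ring" where
  "denorm A n =
     \<lparr>carrier = denorm_carrier A n,
      monoid.mult = (\<lambda>x y. \<lambda>K \<in> Pow {1..n}.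
        \<Oplus>\<^bsub>A\<^esub>I \<in> Pow {1..n}. \<Oplus>\<^bsub>A\<^esub>J \<in> Pow {1..n}. denorm_mult_part A n I J (x I) (y J) K),
      one = dpart A n {1..n} \<one>\<^bsub>A\<^esub>,
      zero = dpart A n {} \<zero>\<^bsub>A\<^esub>,
      add = (\<lambda>x y. \<lambda>K \<in> Pow {1..n}. x K \<oplus>\<^bsub>A\<^esub> y K)\<rparr>"

text \<open>By the identities \<open>\<partial>\<^sup>j \<partial>\<^sup>i = \<partial>\<^sup>i \<partial>\<^sup>j\<^sup>-\<^sup>1\<close> (\<open>i < j\<close>), \<open>\<partial>\<^sup>i \<partial>\<^sup>I = \<partial>\<^sup>K\<close> for \<open>i \<ge> 1\<close>, where \<open>K\<close> consists
  of \<open>i\<close> and the image of \<open>I\<close> under the increasing map that skips \<open>i\<close>.\<close>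

definition coface_ins :: "nat \<Rightarrow> nat set \<Rightarrow> nat set" where
  "coface_ins i I = insert i ((\<lambda>j. if j < i then j else Suc j) ` I)"

text \<open>The coface \<open>\<partial>\<^sup>i : D\<^sup>n A \<rightarrow> D\<^sup>n\<^sup>+\<^sup>1 A\<close> on \<open>\<partial>\<^sup>I a\<close> with \<open>a \<in> A\<^sup>m\<close>, \<open>m = n - |I|\<close>. For \<open>i = 0\<close> the
  identities give \<open>\<partial>\<^sup>0 \<partial>\<^sup>I a = \<partial>\<^sup>I\<^sup>+\<^sup>1 \<partial>\<^sup>0 a\<close>, and \<open>\<partial>\<^sup>0 a = \<partial> a - (\<Sum>k=1..m+1. (-1)\<^sup>k \<partial>\<^sup>k a)\<close>. The overall
  sign of the latter is forced by \<open>\<sigma>\<^sup>0 \<partial>\<^sup>0 = id\<close> on \<open>A\<^sup>0\<close>; it says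
  \<open>\<partial> = (\<Sum>k=0..m+1. (-1)\<^sup>k \<partial>\<^sup>k)\<close> on \<open>A\<^sup>m\<close>.\<close>

definition coface_part ::
  "('r, 'a, 'y) dg_alg_scheme \<Rightarrow> nat \<Rightarrow> nat \<Rightarrow> nat set \<Rightarrow> 'a \<Rightarrow> nat set \<Rightarrow> 'a" where
  "coface_part A n i I a K =
     (if i = 0
      then dpart A (Suc n) (Suc ` I) (diff A a) K \<ominus>\<^bsub>A\<^esub>
           (\<Oplus>\<^bsub>A\<^esub>k \<in> {1..Suc (n - card I)}.
              dpart A (Suc n) (fold coface_ins (sorted_list_of_set (Suc ` I)) {k})
                ([((- 1) ^ k :: int)] \<cdot>\<^bsub>A\<^esub> a) K)
      else dpart A (Suc n) (coface_ins i I) a K)"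

definition coface ::
  "('r, 'a, 'y) dg_alg_scheme \<Rightarrow> nat \<Rightarrow> nat \<Rightarrow> (nat set \<Rightarrow> 'a) \<Rightarrow> nat set \<Rightarrow> 'a" where
  "coface A n i x =
     (\<lambda>K \<in> Pow {1..Suc n}. \<Oplus>\<^bsub>A\<^esub>I \<in> Pow {1..n}. coface_part A n i I (x I) K)"

text \<open>The cofaces \<open>A\<^sup>0 = D\<^sup>0 A \<rightarrow> D\<^sup>1 A\<close>.\<close>

definition coface0 :: "('r, 'a, 'y) dg_alg_scheme \<Rightarrow> nat \<Rightarrow> 'a \<Rightarrow> nat set \<Rightarrow> 'a" where
  "coface0 A i a = coface A 0 i (dpart A 0 {} a)"


section \<open>The two groupoids\<close>

text \<open>\<open>(D\<^sub>*BGL\<^sub>n)(B)\<close>. Level 0 of the descent datum is \<open>B\<^sup>0\<close> itself instead of the encoding of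
  \<open>D\<^sup>0 B\<close>.\<close>

definition Dstar_BGL ::
  "nat \<Rightarrow> ('r, 'b, 'y) dg_alg_scheme
    \<Rightarrow> (('b, 'm) module \<times>
          (((nat set \<Rightarrow> 'b) \<times> 'm \<Rightarrow>\<^sub>0 int) set \<Rightarrow> ((nat set \<Rightarrow> 'b) \<times> 'm \<Rightarrow>\<^sub>0 int) set),
        'm \<Rightarrow> 'm) gpd" where
  "Dstar_BGL n B =
     descent_groupoid (BGL n (deg0 B)) (BGL n (denorm B 1)) (BGL n (denorm B 2))
       (\<lambda>i. BGL_map (deg0 B) (denorm B 1) (coface0 B i))
       (\<lambda>j. BGL_map (denorm B 1) (denorm B 2) (coface B 1 j))
       (\<lambda>(j, i) (l, k). base_change_coherence (deg0 B) (denorm B 1) (denorm B 2)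
          (coface0 B i) (coface B 1 j) (coface0 B k) (coface B 1 l))"

text \<open>\<open>B\<^sup># \<otimes>\<^bsub>B\<^sup>0\<^esub> M\<close>, its elements \<open>bm = b \<otimes> m\<close>, and its graded pieces.\<close>

definition form_module ::
  "('r, 'b, 'y) dg_alg_scheme \<Rightarrow> ('b, 'm) module \<Rightarrow> ('b, ('b \<times> 'm \<Rightarrow>\<^sub>0 int) set) module" where
  "form_module B M = base_change (deg0 B) B (\<lambda>b. b) M"

definition form ::
  "('r, 'b, 'y) dg_alg_scheme \<Rightarrow> ('b, 'm) module \<Rightarrow> 'b \<Rightarrow> 'm \<Rightarrow> ('b \<times> 'm \<Rightarrow>\<^sub>0 int) set" where
  "form B M b m = tens (deg0 B) B (\<lambda>b. b) M b m"

definition form_gr ::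
  "('r, 'b, 'y) dg_alg_scheme \<Rightarrow> ('b, 'm) module \<Rightarrow> nat \<Rightarrow> ('b \<times> 'm \<Rightarrow>\<^sub>0 int) set set" where
  "form_gr B M p =
     generate (add_monoid (form_module B M)) {form B M b m | b m. b \<in> gr B p \<and> m \<in> carrier M}"

definition flat_connection ::
  "('r, 'x) ring_scheme \<Rightarrow> ('r, 'b, 'y) dg_alg_scheme \<Rightarrow> ('b, 'm) module
    \<Rightarrow> (('b \<times> 'm \<Rightarrow>\<^sub>0 int) set \<Rightarrow> ('b \<times> 'm \<Rightarrow>\<^sub>0 int) set) \<Rightarrow> bool" where
  "flat_connection R B M \<D> \<longleftrightarrow>
     (let T = form_module B M in
      \<D> \<in> carrier T \<rightarrow>\<^sub>E carrier T \<and>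
      (\<forall>t \<in> carrier T. \<forall>t' \<in> carrier T. \<D> (t \<oplus>\<^bsub>T\<^esub> t') = \<D> t \<oplus>\<^bsub>T\<^esub> \<D> t') \<and>
      (\<forall>r \<in> carrier R. \<forall>t \<in> carrier T.
         \<D> ((r \<odot>\<^bsub>B\<^esub> \<one>\<^bsub>B\<^esub>) \<odot>\<^bsub>T\<^esub> t) = (r \<odot>\<^bsub>B\<^esub> \<one>\<^bsub>B\<^esub>) \<odot>\<^bsub>T\<^esub> \<D> t) \<and>
      (\<forall>p. \<forall>t \<in> form_gr B M p. \<D> t \<in> form_gr B M (Suc p)) \<and>
      (\<forall>t \<in> carrier T. \<D> (\<D> t) = \<zero>\<^bsub>T\<^esub>) \<and>
      (\<forall>p. \<forall>b \<in> gr B p. \<forall>m \<in> carrier M.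
         \<D> (form B M b m) =
           form B M (diff B b) m \<oplus>\<^bsub>T\<^esub>
           [((- 1) ^ p :: int)] \<cdot>\<^bsub>T\<^esub> (b \<odot>\<^bsub>T\<^esub> \<D> (form B M \<one>\<^bsub>B\<^esub> m))))"

definition flat_bundles ::
  "nat \<Rightarrow> ('r, 'x) ring_scheme \<Rightarrow> ('r, 'b, 'y) dg_alg_scheme
    \<Rightarrow> (('b, 'm) module \<times> (('b \<times> 'm \<Rightarrow>\<^sub>0 int) set \<Rightarrow> ('b \<times> 'm \<Rightarrow>\<^sub>0 int) set), 'm \<Rightarrow> 'm) gpd" where
  "flat_bundles n R B =
     \<lparr>Ob = {(M, \<D>). projective_of_rank (deg0 B) n M \<and> flat_connection R B M \<D>},
      Hom = (\<lambda>(M, \<D>) (M', \<D>').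
         {h \<in> module_iso (deg0 B) M M'.
            \<forall>t \<in> carrier (form_module B M).
              base_change_map (deg0 B) B (\<lambda>b. b) M M' h (\<D> t) =
              \<D>' (base_change_map (deg0 B) B (\<lambda>b. b) M M' h t)}),
      Comp = (\<lambda>(M, \<D>) g f. compose (carrier M) g f),
      Ident = (\<lambda>(M, \<D>). \<lambda>x \<in> carrier M. x)\<rparr>"

end

theory Submission
  imports Defs
begin

text \<open>
  Write \<open>D\<^sup>1 B = B\<^sup>0 \<oplus> \<epsilon>B\<^sup>1\<close> with \<open>\<epsilon>\<^sup>2 = 0\<close>. The two cofaces are \<open>\<partial>\<^sup>1 a = a\<close> and
  \<open>\<partial>\<^sup>0 a = a + \<epsilon> \<partial>a\<close>. Let \<open>X\<^sub>i\<close> be the base change of \<open>M\<close> along \<open>\<partial>\<^sup>i\<close>. A \<open>D\<^sup>1 B\<close>-linear map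
  \<open>g : X\<^sub>0 \<rightarrow> X\<^sub>1\<close> is determined by \<open>g(1 \<otimes> m) = \<gamma>(m) + \<epsilon> \<omega>(m)\<close>, where \<open>\<gamma> : M \<rightarrow> M\<close> and
  \<open>\<omega> : M \<rightarrow> B\<^sup>1 \<otimes> M\<close>. Reducing the cocycle condition modulo the augmentation ideal of \<open>D\<^sup>2 B\<close> gives
  \<open>\<gamma> = \<gamma> \<circ> \<gamma>\<close>, hence \<open>\<gamma> = id\<close> because \<open>g\<close> is invertible; linearity of \<open>g\<close> along \<open>\<partial>\<^sup>0\<close> then says
  \<open>\<omega>(am) = a \<omega>(m) + \<partial>a \<otimes> m\<close>. Conversely every such \<open>\<omega>\<close> gives an invertible \<open>g\<close>, with inverse
  \<open>1 \<otimes> m \<mapsto> 1 \<otimes> m - \<epsilon> \<omega>(m)\<close>. What remains of the cocycle condition lives in the part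
  \<open>B\<^sup>2 \<otimes> M\<close> of \<open>D\<^sup>2 B \<otimes> M\<close>, and it is \<open>\<nabla>(\<omega>(m)) = 0\<close>, where
  \<open>\<nabla>(b \<otimes> m) = \<partial>b \<otimes> m + (-1)\<^bsup>deg b\<^esup> b \<omega>(m)\<close> is the connection with connection form \<open>\<omega>\<close>. So
  descent data on \<open>M\<close> and flat connections on \<open>M\<close> are both the same as forms \<open>\<omega>\<close> with vanishing
  curvature, and on either side an isomorphism \<open>h : M \<rightarrow> M'\<close> is a morphism iff
  \<open>\<omega>'(h m) = (id \<otimes> h)(\<omega> m)\<close>.

  The steps are carried by \<open>descent_cocycle_iff\<close>, which rewrites the cocycle condition between
  iterated tensor products as an equation in the single module \<open>D\<^sup>2 B \<otimes> M\<close>;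
  \<open>cocycle_unipotent\<close> (\<open>\<gamma> = id\<close>); \<open>cocycle_iff_flat\<close> (the curvature); \<open>gauge_iso\<close> and
  \<open>gauge_form_props\<close> (descent data and forms); \<open>cov_flat_connection\<close> and \<open>flat_form_props\<close>
  (flat connections and forms); \<open>gauge_natural_iff\<close> and \<open>cov_natural_iff\<close> (morphisms).
  Both groupoids are thereby instances of \<open>connection_groupoid\<close>, and an equivalence between two
  such groupoids amounts to matching up the forms.
\<close>

section \<open>Additive maps and left modules\<close>

text \<open>Rewriting \<open>1\<close> to \<open>Suc 0\<close> would change the indices of the cofaces and the elements of the index
  sets \<open>I \<subseteq> {1..n}\<close>.\<close>

declare One_nat_def [simp del]

definition additive :: "('x, 'p) ring_scheme \<Rightarrow> ('y, 'q) ring_scheme \<Rightarrow> ('x \<Rightarrow> 'y) set" where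
  "additive X Y = {h \<in> carrier X \<rightarrow> carrier Y.
     \<forall>x \<in> carrier X. \<forall>y \<in> carrier X. h (x \<oplus>\<^bsub>X\<^esub> y) = h x \<oplus>\<^bsub>Y\<^esub> h y}"

lemma additiveI:
  assumes "\<And>x. x \<in> carrier X \<Longrightarrow> h x \<in> carrier Y"
    and "\<And>x y. \<lbrakk>x \<in> carrier X; y \<in> carrier X\<rbrakk> \<Longrightarrow> h (x \<oplus>\<^bsub>X\<^esub> y) = h x \<oplus>\<^bsub>Y\<^esub> h y"
  shows "h \<in> additive X Y"
  using assms by (auto simp: additive_def)

lemma additive_closed: "\<lbrakk>h \<in> additive X Y; x \<in> carrier X\<rbrakk> \<Longrightarrow> h x \<in> carrier Y"
  by (auto simp: additive_def)

lemma additive_add: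
  "\<lbrakk>h \<in> additive X Y; x \<in> carrier X; y \<in> carrier X\<rbrakk> \<Longrightarrow> h (x \<oplus>\<^bsub>X\<^esub> y) = h x \<oplus>\<^bsub>Y\<^esub> h y"
  by (auto simp: additive_def)

lemma additive_zero:
  assumes "h \<in> additive X Y" "abelian_group X" "abelian_group Y"
  shows "h \<zero>\<^bsub>X\<^esub> = \<zero>\<^bsub>Y\<^esub>"
proof -
  interpret X: abelian_group X by fact
  interpret Y: abelian_group Y by fact
  have "h \<zero>\<^bsub>X\<^esub> \<oplus>\<^bsub>Y\<^esub> h \<zero>\<^bsub>X\<^esub> = h \<zero>\<^bsub>X\<^esub>"
    using additive_add[OF assms(1), of "\<zero>\<^bsub>X\<^esub>" "\<zero>\<^bsub>X\<^esub>"] by simp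
  then show ?thesis
    using additive_closed[OF assms(1), of "\<zero>\<^bsub>X\<^esub>"] by (simp add: Y.add.r_cancel_one')
qed

lemma additive_minus:
  assumes "h \<in> additive X Y" "abelian_group X" "abelian_group Y" "x \<in> carrier X"
  shows "h (\<ominus>\<^bsub>X\<^esub> x) = \<ominus>\<^bsub>Y\<^esub> h x"
proof -
  interpret X: abelian_group X by fact
  interpret Y: abelian_group Y by fact
  have "h x \<oplus>\<^bsub>Y\<^esub> h (\<ominus>\<^bsub>X\<^esub> x) = \<zero>\<^bsub>Y\<^esub>"
    using additive_add[OF assms(1), of x "\<ominus>\<^bsub>X\<^esub> x"] assms additive_zero[OF assms(1-3)]
    by (simp add: X.r_neg)
  then show ?thesis
    using additive_closed[OF assms(1)] assms(4)
    by (metis X.a_inv_closed Y.minus_equality Y.minus_minus Y.a_comm)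
qed

lemma additive_comp: "\<lbrakk>h \<in> additive X Y; k \<in> additive Y Z\<rbrakk> \<Longrightarrow> (\<lambda>x. k (h x)) \<in> additive X Z"
  by (auto simp: additive_def Pi_iff)

lemma additive_id: "(\<lambda>x. x) \<in> additive X X"
  by (auto simp: additive_def)

lemma additive_sum:
  assumes "h \<in> additive X Y" "k \<in> additive X Y" "abelian_group Y"
  shows "(\<lambda>x. h x \<oplus>\<^bsub>Y\<^esub> k x) \<in> additive X Y"
proof -
  interpret Y: abelian_group Y by fact
  show ?thesis
    using assms(1,2) by (intro additiveI) (simp_all add: additive_closed additive_add Y.a_ac)
qed

lemma additive_uminus:
  assumes "h \<in> additive X Y" "abelian_group Y"
  shows "(\<lambda>x. \<ominus>\<^bsub>Y\<^esub> h x) \<in> additive X Y"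
proof -
  interpret Y: abelian_group Y by fact
  show ?thesis
    using assms(1) by (intro additiveI) (simp_all add: additive_closed additive_add Y.minus_add)
qed

lemma module_hom_additive: "h \<in> module_hom R M N \<Longrightarrow> h \<in> additive M N"
  by (auto simp: module_hom_def additive_def)

lemma module_hom_smult:
  "\<lbrakk>h \<in> module_hom R M N; a \<in> carrier R; x \<in> carrier M\<rbrakk> \<Longrightarrow> h (a \<odot>\<^bsub>M\<^esub> x) = a \<odot>\<^bsub>N\<^esub> h x"
  by (auto simp: module_hom_def)

lemma module_homI:
  assumes "h \<in> additive M N"
    and "\<And>a x. \<lbrakk>a \<in> carrier R; x \<in> carrier M\<rbrakk> \<Longrightarrow> h (a \<odot>\<^bsub>M\<^esub> x) = a \<odot>\<^bsub>N\<^esub> h x"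
  shows "h \<in> module_hom R M N"
  using assms by (auto simp: module_hom_def additive_def)

text \<open>Left modules over a ring that need not be commutative: the algebra \<open>B\<close> is only graded-commutative,
  and \<open>B \<otimes> M\<close> has to be a module over it.\<close>

locale lmod = R: ring R + M: abelian_group M
  for R :: "('a, 'p) ring_scheme" and M :: "('a, 'm, 'q) module_scheme" +
  assumes smult_closed: "\<lbrakk>a \<in> carrier R; x \<in> carrier M\<rbrakk> \<Longrightarrow> a \<odot>\<^bsub>M\<^esub> x \<in> carrier M"
    and smult_l_distr: "\<lbrakk>a \<in> carrier R; b \<in> carrier R; x \<in> carrier M\<rbrakk>
      \<Longrightarrow> (a \<oplus>\<^bsub>R\<^esub> b) \<odot>\<^bsub>M\<^esub> x = a \<odot>\<^bsub>M\<^esub> x \<oplus>\<^bsub>M\<^esub> b \<odot>\<^bsub>M\<^esub> x"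
    and smult_r_distr: "\<lbrakk>a \<in> carrier R; x \<in> carrier M; y \<in> carrier M\<rbrakk>
      \<Longrightarrow> a \<odot>\<^bsub>M\<^esub> (x \<oplus>\<^bsub>M\<^esub> y) = a \<odot>\<^bsub>M\<^esub> x \<oplus>\<^bsub>M\<^esub> a \<odot>\<^bsub>M\<^esub> y"
    and smult_assoc: "\<lbrakk>a \<in> carrier R; b \<in> carrier R; x \<in> carrier M\<rbrakk>
      \<Longrightarrow> (a \<otimes>\<^bsub>R\<^esub> b) \<odot>\<^bsub>M\<^esub> x = a \<odot>\<^bsub>M\<^esub> (b \<odot>\<^bsub>M\<^esub> x)"
    and smult_one: "x \<in> carrier M \<Longrightarrow> \<one>\<^bsub>R\<^esub> \<odot>\<^bsub>M\<^esub> x = x"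
begin

lemma smult_additive: "a \<in> carrier R \<Longrightarrow> (\<lambda>x. a \<odot>\<^bsub>M\<^esub> x) \<in> additive M M"
  by (intro additiveI) (auto simp: smult_closed smult_r_distr)

lemma smult_additive_left: "x \<in> carrier M \<Longrightarrow> (\<lambda>a. a \<odot>\<^bsub>M\<^esub> x) \<in> additive R M"
  by (intro additiveI) (auto simp: smult_closed smult_l_distr)

lemmas smult_minus = additive_minus[OF smult_additive M.abelian_group_axioms M.abelian_group_axioms]
lemmas smult_zero = additive_zero[OF smult_additive M.abelian_group_axioms M.abelian_group_axioms]
lemmas minus_smult = additive_minus[OF smult_additive_left R.abelian_group_axioms M.abelian_group_axioms]
lemmas zero_smult = additive_zero[OF smult_additive_left R.abelian_group_axioms M.abelian_group_axioms]

end

lemma module_imp_lmod: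
  assumes "module R M" shows "lmod R M"
proof -
  interpret module R M by fact
  show ?thesis
    by unfold_locales (auto simp: smult_l_distr smult_r_distr smult_assoc1)
qed

section \<open>The universal property of the tensor product\<close>

lemma base_change_simps:
  "carrier (base_change R S \<phi> M) = carrier (tensor_group R S \<phi> M)"
  "add (base_change R S \<phi> M) = monoid.mult (tensor_group R S \<phi> M)"
  "zero (base_change R S \<phi> M) = one (tensor_group R S \<phi> M)"
  by (auto simp: base_change_def)

locale tensor = lmod R M + S: ring S
  for R :: "('a, 'p) ring_scheme" and S :: "('s, 'q) ring_scheme" and \<phi> :: "'a \<Rightarrow> 's"
    and M :: "('a, 'm, 't) module_scheme" +
  assumes \<phi>_hom: "\<phi> \<in> ring_hom R S"
begin

abbreviation "T \<equiv> base_change R S \<phi> M"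
abbreviation ten (infixl \<open>\<otimes>t\<close> 75) where "s \<otimes>t m \<equiv> tens R S \<phi> M s m"

abbreviation "F \<equiv> free_Abelian_group (carrier S \<times> carrier M)"
abbreviation "Ker \<equiv> tensor_ker R S \<phi> M"

lemma \<phi>_closed: "a \<in> carrier R \<Longrightarrow> \<phi> a \<in> carrier S"
  using \<phi>_hom by (auto simp: ring_hom_def)

lemma keys_frag_of_diff:
  "\<lbrakk>x \<in> A; y \<in> A\<rbrakk> \<Longrightarrow> Poly_Mapping.keys (frag_of x - frag_of y) \<subseteq> A"
  "\<lbrakk>x \<in> A; y \<in> A; z \<in> A\<rbrakk> \<Longrightarrow> Poly_Mapping.keys (frag_of x - frag_of y - frag_of z) \<subseteq> A"
proof -
  show 1: "Poly_Mapping.keys (frag_of x - frag_of y) \<subseteq> A" if "x \<in> A" "y \<in> A" for x y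
    using that keys_diff[of "frag_of x" "frag_of y"] by auto
  show "Poly_Mapping.keys (frag_of x - frag_of y - frag_of z) \<subseteq> A" if "x \<in> A" "y \<in> A" "z \<in> A"
    using that 1[of x y] keys_diff[of "frag_of x - frag_of y" "frag_of z"] by auto
qed

lemma tensor_rels_closed: "tensor_rels R S \<phi> M \<subseteq> carrier F"
  unfolding tensor_rels_def
  by (intro Un_least subsetI; elim CollectE exE conjE; hypsubst;
      intro carrier_free_Abelian_group_iff[THEN iffD2] keys_frag_of_diff)
    (simp_all add: smult_closed \<phi>_closed)

lemma Ker_subgroup: "subgroup Ker F"
  unfolding tensor_ker_def
  by (rule group.generate_is_subgroup) (use tensor_rels_closed in auto)

lemma Ker_normal: "Ker \<lhd> F"
  by (simp add: Ker_subgroup comm_group.subgroup_imp_normal abelian_free_Abelian_group)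

lemma tensor_group_comm: "comm_group (tensor_group R S \<phi> M)"
  unfolding tensor_group_def
  by (rule comm_group.abelian_FactGroup[OF abelian_free_Abelian_group Ker_subgroup])

lemma T_abelian: "abelian_group T"
proof -
  interpret G: comm_group "tensor_group R S \<phi> M" by (rule tensor_group_comm)
  show ?thesis
    by (rule abelian_groupI, simp_all add: base_change_simps G.m_assoc G.l_inv_ex) (rule G.m_comm)
qed

sublocale T: abelian_group T by (rule T_abelian)

abbreviation coset where "coset x \<equiv> Ker #>\<^bsub>F\<^esub> x"

lemma coset_closed: "x \<in> carrier F \<Longrightarrow> coset x \<in> carrier T"
  by (auto simp: base_change_simps tensor_group_def FactGroup_def RCOSETS_def)

lemma coset_add: "\<lbrakk>x \<in> carrier F; y \<in> carrier F\<rbrakk> \<Longrightarrow> coset (x + y) = coset x \<oplus>\<^bsub>T\<^esub> coset y"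
  using normal.rcos_sum[OF Ker_normal, of x y] by (simp add: base_change_simps tensor_group_def FactGroup_def)

lemma coset_zero: "coset 0 = \<zero>\<^bsub>T\<^esub>"
  using subgroup.rcos_const[OF Ker_subgroup group_free_Abelian_group, of 0] subgroup.one_closed[OF Ker_subgroup]
  by (simp add: base_change_simps tensor_group_def FactGroup_def)

lemma coset_rel:
  assumes "x \<in> tensor_rels R S \<phi> M" shows "coset x = \<zero>\<^bsub>T\<^esub>"
proof -
  have "x \<in> Ker" unfolding tensor_ker_def using assms by (rule generate.incl)
  then show ?thesis
    using subgroup.rcos_const[OF Ker_subgroup group_free_Abelian_group]
    by (simp add: base_change_simps tensor_group_def FactGroup_def)
qed

lemma coset_diff:
  assumes "x \<in> carrier F" "y \<in> carrier F"
  shows "coset (x - y) = coset x \<ominus>\<^bsub>T\<^esub> coset y"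
proof -
  have k: "x - y \<in> carrier F" using assms keys_diff[of x y] by auto
  have "coset x = coset (x - y) \<oplus>\<^bsub>T\<^esub> coset y"
    using coset_add[OF k assms(2)] by simp
  then show ?thesis
    using coset_closed[OF k] coset_closed[OF assms(2)]
    by (simp add: T.minus_eq T.a_assoc T.r_neg)
qed

lemma ten_closed: "\<lbrakk>s \<in> carrier S; m \<in> carrier M\<rbrakk> \<Longrightarrow> s \<otimes>t m \<in> carrier T"
  unfolding tens_def by (rule coset_closed) simp

lemma coset_diff_zero:
  assumes "x \<in> carrier F" "y \<in> carrier F" "coset (x - y) = \<zero>\<^bsub>T\<^esub>" shows "coset x = coset y"
proof -
  have k: "x - y \<in> carrier F" using assms(1,2) keys_diff[of x y] by auto
  show ?thesis
    using coset_add[OF k assms(2)] assms(3) coset_closed[OF assms(2)] by simp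
qed

lemma ten_add_left:
  assumes "s \<in> carrier S" "s' \<in> carrier S" "m \<in> carrier M"
  shows "(s \<oplus>\<^bsub>S\<^esub> s') \<otimes>t m = s \<otimes>t m \<oplus>\<^bsub>T\<^esub> s' \<otimes>t m"
proof -
  have "frag_of (s \<oplus>\<^bsub>S\<^esub> s', m) - frag_of (s, m) - frag_of (s', m) \<in> tensor_rels R S \<phi> M"
    using assms unfolding tensor_rels_def by blast
  note z = coset_rel[OF this]
  have "coset (frag_of (s \<oplus>\<^bsub>S\<^esub> s', m)) = coset (frag_of (s, m) + frag_of (s', m))"
    by (rule coset_diff_zero)
      (use z assms keys_add[of "frag_of (s, m)" "frag_of (s', m)"] in \<open>auto simp: diff_diff_eq keys_single\<close>)
  also have "\<dots> = coset (frag_of (s, m)) \<oplus>\<^bsub>T\<^esub> coset (frag_of (s', m))"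
    by (rule coset_add) (use assms in auto)
  finally show ?thesis unfolding tens_def .
qed

lemma ten_add_right:
  assumes "s \<in> carrier S" "m \<in> carrier M" "m' \<in> carrier M"
  shows "s \<otimes>t (m \<oplus>\<^bsub>M\<^esub> m') = s \<otimes>t m \<oplus>\<^bsub>T\<^esub> s \<otimes>t m'"
proof -
  have "frag_of (s, m \<oplus>\<^bsub>M\<^esub> m') - frag_of (s, m) - frag_of (s, m') \<in> tensor_rels R S \<phi> M"
    using assms unfolding tensor_rels_def by blast
  note z = coset_rel[OF this]
  have "coset (frag_of (s, m \<oplus>\<^bsub>M\<^esub> m')) = coset (frag_of (s, m) + frag_of (s, m'))"
    by (rule coset_diff_zero)
      (use z assms keys_add[of "frag_of (s, m)" "frag_of (s, m')"] in \<open>auto simp: diff_diff_eq keys_single\<close>)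
  also have "\<dots> = coset (frag_of (s, m)) \<oplus>\<^bsub>T\<^esub> coset (frag_of (s, m'))"
    by (rule coset_add) (use assms in auto)
  finally show ?thesis unfolding tens_def .
qed

lemma ten_balanced:
  assumes "s \<in> carrier S" "a \<in> carrier R" "m \<in> carrier M"
  shows "(s \<otimes>\<^bsub>S\<^esub> \<phi> a) \<otimes>t m = s \<otimes>t (a \<odot>\<^bsub>M\<^esub> m)"
proof -
  have "frag_of (s \<otimes>\<^bsub>S\<^esub> \<phi> a, m) - frag_of (s, a \<odot>\<^bsub>M\<^esub> m) \<in> tensor_rels R S \<phi> M"
    using assms unfolding tensor_rels_def by blast
  note z = coset_rel[OF this]
  show ?thesis unfolding tens_def
    by (rule coset_diff_zero) (use z assms in \<open>auto simp: \<phi>_closed smult_closed\<close>)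
qed

lemma ten_additive_left: "m \<in> carrier M \<Longrightarrow> (\<lambda>s. s \<otimes>t m) \<in> additive S T"
  using ten_add_left ten_closed by (intro additiveI) (auto)

lemma ten_additive_right: "s \<in> carrier S \<Longrightarrow> (\<lambda>m. s \<otimes>t m) \<in> additive M T"
  using ten_add_right ten_closed by (intro additiveI) (auto)

lemmas ten_zero_left = additive_zero[OF ten_additive_left S.abelian_group_axioms T_abelian]
lemmas ten_minus_left = additive_minus[OF ten_additive_left S.abelian_group_axioms T_abelian]
text \<open>Every element is a sum of pure tensors, as \<open>- (s \<otimes> m) = (- s) \<otimes> m\<close>; hence the rule needs no case
  for negatives.\<close>

lemma ten_induct [consumes 1, case_names zero add ten]:
  assumes t: "t \<in> carrier T"
    and zero: "P \<zero>\<^bsub>T\<^esub>"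
    and add: "\<And>x y. \<lbrakk>x \<in> carrier T; y \<in> carrier T; P x; P y\<rbrakk> \<Longrightarrow> P (x \<oplus>\<^bsub>T\<^esub> y)"
    and ten: "\<And>s m. \<lbrakk>s \<in> carrier S; m \<in> carrier M\<rbrakk> \<Longrightarrow> P (s \<otimes>t m)"
  shows "P t"
proof -
  obtain x where x: "x \<in> carrier F" "t = coset x"
    using t by (auto simp: base_change_simps tensor_group_def FactGroup_def RCOSETS_def)
  have "Poly_Mapping.keys x \<subseteq> carrier S \<times> carrier M" using x by simp
  \<comment> \<open>The induction on the free abelian group has a case for differences, so negatives are carried along.\<close>
  then have "P (coset x) \<and> P (\<ominus>\<^bsub>T\<^esub> coset x)"
  proof (induction x rule: free_Abelian_group_induct[consumes 1, case_names zero diff gen])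
    case zero
    have m: "\<ominus>\<^bsub>T\<^esub> \<zero>\<^bsub>T\<^esub> = \<zero>\<^bsub>T\<^esub>" by (metis T.l_zero T.r_neg T.a_inv_closed T.zero_closed)
    show ?case unfolding coset_zero m using assms(2) by simp
  next
    case 2: (diff x y)
    have c: "coset x \<in> carrier T" "coset y \<in> carrier T"
      using 2 by (auto intro!: coset_closed)
    have "\<ominus>\<^bsub>T\<^esub> (coset x \<ominus>\<^bsub>T\<^esub> coset y) = \<ominus>\<^bsub>T\<^esub> coset x \<oplus>\<^bsub>T\<^esub> coset y"
      using c by (simp add: T.minus_eq T.minus_add)
    moreover have "coset (x - y) = coset x \<ominus>\<^bsub>T\<^esub> coset y"
      using 2 by (intro coset_diff) auto
    ultimately show ?case
      using add 2 c by (simp add: T.minus_eq)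
  next
    case (gen a)
    then obtain s m where "a = (s, m)" "s \<in> carrier S" "m \<in> carrier M" by auto
    then show ?case
      using ten[of s m] ten[of "\<ominus>\<^bsub>S\<^esub> s" m] by (simp add: ten_minus_left flip: tens_def)
  qed
  then show ?thesis using x by simp
qed

lemma additive_eqI:
  assumes "h \<in> additive T N" "k \<in> additive T N" "abelian_group N"
    and "\<And>s m. \<lbrakk>s \<in> carrier S; m \<in> carrier M\<rbrakk> \<Longrightarrow> h (s \<otimes>t m) = k (s \<otimes>t m)"
    and "t \<in> carrier T"
  shows "h t = k t"
  using assms(5)
  by (induction rule: ten_induct)
    (simp_all add: assms(4) additive_zero[OF assms(1) T_abelian assms(3)]
      additive_zero[OF assms(2) T_abelian assms(3)] additive_add[OF assms(1)] additive_add[OF assms(2)])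

end

definition balanced ::
  "('a, 'p) ring_scheme \<Rightarrow> ('s, 'q) ring_scheme \<Rightarrow> ('a \<Rightarrow> 's) \<Rightarrow> ('a, 'm, 't) module_scheme
    \<Rightarrow> ('k, 'u) ring_scheme \<Rightarrow> ('s \<Rightarrow> 'm \<Rightarrow> 'k) \<Rightarrow> bool" where
  "balanced R S \<phi> M N f \<longleftrightarrow>
     (\<forall>m \<in> carrier M. (\<lambda>s. f s m) \<in> additive S N) \<and>
     (\<forall>s \<in> carrier S. f s \<in> additive M N) \<and>
     (\<forall>s \<in> carrier S. \<forall>a \<in> carrier R. \<forall>m \<in> carrier M. f (s \<otimes>\<^bsub>S\<^esub> \<phi> a) m = f s (a \<odot>\<^bsub>M\<^esub> m))"

context tensor begin

text \<open>The additive map on the free abelian group that extends \<open>f\<close> kills the relations because \<open>f\<close> is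
  balanced, and so factors through the quotient.\<close>

lemma balanced_lift_ex:
  assumes N: "abelian_group N" and f: "balanced R S \<phi> M N f"
  shows "\<exists>h \<in> additive T N. \<forall>s \<in> carrier S. \<forall>m \<in> carrier M. h (s \<otimes>t m) = f s m"
proof -
  interpret N: abelian_group N by fact
  have fc: "f s m \<in> carrier N" if "s \<in> carrier S" "m \<in> carrier M" for s m
    using f that by (auto simp: balanced_def intro: additive_closed)
  have fl: "f (s \<oplus>\<^bsub>S\<^esub> s') m = f s m \<oplus>\<^bsub>N\<^esub> f s' m"
    if "s \<in> carrier S" "s' \<in> carrier S" "m \<in> carrier M" for s s' m
    using f that additive_add[of "\<lambda>s. f s m" S N s s'] by (auto simp: balanced_def)
  have fr: "f s (m \<oplus>\<^bsub>M\<^esub> m') = f s m \<oplus>\<^bsub>N\<^esub> f s m'"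
    if "s \<in> carrier S" "m \<in> carrier M" "m' \<in> carrier M" for s m m'
    using f that additive_add[of "f s" M N m m'] by (auto simp: balanced_def)
  obtain h where h: "h \<in> hom F (add_monoid N)"
    "\<And>x. x \<in> carrier S \<times> carrier M \<Longrightarrow> h (frag_of x) = case_prod f x"
  proof -
    have "case_prod f ` (carrier S \<times> carrier M) \<subseteq> carrier (add_monoid N)" using fc by auto
    from comm_group.free_Abelian_group_universal[OF N.a_comm_group this] that show ?thesis by metis
  qed
  interpret h: group_hom F "add_monoid N" h
    using h(1) by (simp add: group_hom_def group_hom_axioms_def N.add.group_axioms N.a_group)
  have hd: "h (x - y) = h x \<ominus>\<^bsub>N\<^esub> h y" if "x \<in> carrier F" "y \<in> carrier F" for x y
  proof -
    have k: "x - y \<in> carrier F" using that keys_diff[of x y] by auto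
    have "h x = h (x - y) \<oplus>\<^bsub>N\<^esub> h y"
      using h.hom_mult[OF k that(2)] by simp
    then show ?thesis
      using h.hom_closed[OF k] h.hom_closed[OF that(2)]
      by (simp add: N.minus_eq N.a_assoc N.r_neg)
  qed
  have "tensor_rels R S \<phi> M \<subseteq> kernel F (add_monoid N) h"
  proof
    fix x assume x: "x \<in> tensor_rels R S \<phi> M"
    have kd: "frag_of p - frag_of q \<in> carrier F" if "p \<in> carrier S \<times> carrier M" "q \<in> carrier S \<times> carrier M" for p q
      using keys_frag_of_diff(1)[OF that] by simp
    have "h x = \<zero>\<^bsub>N\<^esub>"
      using x unfolding tensor_rels_def
    proof (elim UnE CollectE exE conjE; hypsubst)
      fix s s' m assume "s \<in> carrier S" "s' \<in> carrier S" "m \<in> carrier M"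
      then show "h (frag_of (s \<oplus>\<^bsub>S\<^esub> s', m) - frag_of (s, m) - frag_of (s', m)) = \<zero>\<^bsub>N\<^esub>"
        using f fc by (simp add: hd kd h(2) fl fr balanced_def N.minus_eq N.a_ac N.r_neg N.r_neg2 keys_frag_of_diff)
    next
      fix s m m' assume "s \<in> carrier S" "m \<in> carrier M" "m' \<in> carrier M"
      then show "h (frag_of (s, m \<oplus>\<^bsub>M\<^esub> m') - frag_of (s, m) - frag_of (s, m')) = \<zero>\<^bsub>N\<^esub>"
        using f fc by (simp add: hd kd h(2) fl fr balanced_def N.minus_eq N.a_ac N.r_neg N.r_neg2 keys_frag_of_diff)
    next
      fix s a m assume "s \<in> carrier S" "a \<in> carrier R" "m \<in> carrier M"
      then show "h (frag_of (s \<otimes>\<^bsub>S\<^esub> \<phi> a, m) - frag_of (s, a \<odot>\<^bsub>M\<^esub> m)) = \<zero>\<^bsub>N\<^esub>"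
        using f fc by (simp add: hd kd h(2) balanced_def smult_closed \<phi>_closed N.minus_eq N.r_neg)
    qed
    then show "x \<in> kernel F (add_monoid N) h"
      using subsetD[OF tensor_rels_closed x] by (simp add: kernel_def)
  qed
  then have "Ker \<subseteq> kernel F (add_monoid N) h"
    unfolding tensor_ker_def
    by (rule group.generate_subgroup_incl[OF group_free_Abelian_group _ h.subgroup_kernel])
  from h.FactGroup_universal_kernel[OF Ker_normal this] obtain g where
    g: "g \<in> hom (F Mod Ker) (add_monoid N)" "\<And>x. x \<in> carrier F \<Longrightarrow> g (coset x) = h x"
    by metis
  show ?thesis
  proof (intro bexI[of _ g] ballI)
    show "g \<in> additive T N"
      using g(1) by (auto simp: additive_def hom_def tensor_group_def base_change_simps)
    show "g (s \<otimes>t m) = f s m" if "s \<in> carrier S" "m \<in> carrier M" for s m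
      using that g(2)[of "frag_of (s, m)"] h(2)[of "(s, m)"] by (simp add: tens_def)
  qed
qed

text \<open>The target \<open>K\<close> of \<open>tensor_lift\<close> is written multiplicatively; \<open>N\<close> is the same group written
  additively.\<close>

lemma lift_props:
  assumes N: "abelian_group N" and f: "balanced R S \<phi> M N f"
    and K: "carrier K = carrier N" "monoid.mult K = add N"
  shows lift_ext: "tensor_lift R S \<phi> M K f \<in> extensional (carrier T)"
    and lift_additive: "tensor_lift R S \<phi> M K f \<in> additive T N"
    and lift_ten: "\<lbrakk>s \<in> carrier S; m \<in> carrier M\<rbrakk> \<Longrightarrow> tensor_lift R S \<phi> M K f (s \<otimes>t m) = f s m"
proof -
  have homeq: "h \<in> hom (tensor_group R S \<phi> M) K \<longleftrightarrow> h \<in> additive T N" for h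
    by (auto simp: hom_def additive_def K base_change_simps)
  let ?P = "\<lambda>h. h \<in> extensional (carrier (tensor_group R S \<phi> M)) \<and>
             h \<in> hom (tensor_group R S \<phi> M) K \<and>
             (\<forall>s \<in> carrier S. \<forall>m \<in> carrier M. h (s \<otimes>t m) = f s m)"
  obtain g where g: "g \<in> additive T N" "\<And>s m. \<lbrakk>s \<in> carrier S; m \<in> carrier M\<rbrakk> \<Longrightarrow> g (s \<otimes>t m) = f s m"
    using balanced_lift_ex[OF N f] by blast
  have "?P (restrict g (carrier T))"
    using g ten_closed T.a_closed
    by (auto simp: homeq additive_def base_change_simps)
  then have ex: "\<exists>h. ?P h" by blast
  have un: "h = k" if "?P h" "?P k" for h k
  proof (rule extensionalityI)
    show "h \<in> extensional (carrier T)" "k \<in> extensional (carrier T)" using that by (auto simp: base_change_simps)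
    show "h t = k t" if t: "t \<in> carrier T" for t
      by (rule additive_eqI[OF _ _ N _ t]) (use \<open>?P h\<close> \<open>?P k\<close> homeq in auto)
  qed
  have "\<exists>!h. ?P h" using ex un by (rule ex_ex1I)
  then have "?P (tensor_lift R S \<phi> M K f)"
    unfolding tensor_lift_def by (rule theI')
  then show "tensor_lift R S \<phi> M K f \<in> extensional (carrier T)" "tensor_lift R S \<phi> M K f \<in> additive T N"
    "\<lbrakk>s \<in> carrier S; m \<in> carrier M\<rbrakk> \<Longrightarrow> tensor_lift R S \<phi> M K f (s \<otimes>t m) = f s m"
    by (auto simp: homeq base_change_simps)
qed

lemma smult_balanced:
  assumes "s \<in> carrier S"
  shows "balanced R S \<phi> M T (\<lambda>t m. (s \<otimes>\<^bsub>S\<^esub> t) \<otimes>t m)"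
  using assms
  by (auto simp: balanced_def S.r_distr ten_add_left ten_add_right ten_closed S.m_assoc \<phi>_closed
      simp flip: ten_balanced intro!: additiveI)

lemma T_smult: "smult T = (\<lambda>s. tensor_lift R S \<phi> M (tensor_group R S \<phi> M) (\<lambda>t m. (s \<otimes>\<^bsub>S\<^esub> t) \<otimes>t m))"
  by (simp add: base_change_def)

lemma T_smult_additive: "s \<in> carrier S \<Longrightarrow> (\<lambda>t. s \<odot>\<^bsub>T\<^esub> t) \<in> additive T T"
  unfolding T_smult by (rule lift_additive[OF T_abelian smult_balanced]) (auto simp: base_change_simps)

lemma smult_ten:
  "\<lbrakk>s \<in> carrier S; t \<in> carrier S; m \<in> carrier M\<rbrakk> \<Longrightarrow> s \<odot>\<^bsub>T\<^esub> (t \<otimes>t m) = (s \<otimes>\<^bsub>S\<^esub> t) \<otimes>t m"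
  unfolding T_smult by (rule lift_ten[OF T_abelian smult_balanced]) (auto simp: base_change_simps)

lemma T_lmod: "lmod S T"
proof (unfold_locales, goal_cases)
  case (1 a x)
  then show ?case by (rule additive_closed[OF T_smult_additive])
next
  case (2 a b x)
  show ?case
    by (rule additive_eqI[OF T_smult_additive additive_sum[OF T_smult_additive T_smult_additive T_abelian] T_abelian _ 2(3)])
      (use 2 in \<open>simp_all add: smult_ten S.l_distr ten_add_left\<close>)
next
  case (3 a x y)
  then show ?case by (simp add: additive_add[OF T_smult_additive])
next
  case (4 a b x)
  show ?case
    by (rule additive_eqI[OF T_smult_additive additive_comp[OF T_smult_additive T_smult_additive] T_abelian _ 4(3)])
      (use 4 in \<open>simp_all add: smult_ten S.m_assoc\<close>)
next
  case (5 x)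
  show ?case
    by (rule additive_eqI[OF T_smult_additive additive_id T_abelian _ 5])
      (simp_all add: smult_ten)
qed

sublocale T: lmod S T by (rule T_lmod)

end

text \<open>The map \<open>u \<otimes> id : S \<otimes> M \<rightarrow> S' \<otimes> M\<close>.\<close>

definition tmap ::
  "('a, 'p) ring_scheme \<Rightarrow> ('s, 'q) ring_scheme \<Rightarrow> ('a \<Rightarrow> 's) \<Rightarrow> ('u, 'v) ring_scheme \<Rightarrow> ('a \<Rightarrow> 'u)
    \<Rightarrow> ('a, 'm, 't) module_scheme \<Rightarrow> ('s \<Rightarrow> 'u)
    \<Rightarrow> ('s \<times> 'm \<Rightarrow>\<^sub>0 int) set \<Rightarrow> ('u \<times> 'm \<Rightarrow>\<^sub>0 int) set" where
  "tmap R S \<phi> S' \<phi>' M u =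
     tensor_lift R S \<phi> M (tensor_group R S' \<phi>' M) (\<lambda>s m. tens R S' \<phi>' M (u s) m)"

text \<open>The \<open>S\<close>-linear map \<open>S \<otimes> M \<rightarrow> N\<close> with \<open>1 \<otimes> m \<mapsto> f m\<close>.\<close>

definition lin_ext ::
  "('a, 'p) ring_scheme \<Rightarrow> ('s, 'q) ring_scheme \<Rightarrow> ('a \<Rightarrow> 's) \<Rightarrow> ('a, 'm, 't) module_scheme
    \<Rightarrow> ('s, 'n, 'v) module_scheme \<Rightarrow> ('m \<Rightarrow> 'n) \<Rightarrow> ('s \<times> 'm \<Rightarrow>\<^sub>0 int) set \<Rightarrow> 'n" where
  "lin_ext R S \<phi> M N f = tensor_lift R S \<phi> M (add_monoid N) (\<lambda>s m. s \<odot>\<^bsub>N\<^esub> f m)"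

context tensor begin

lemma ten_eq_smult: "\<lbrakk>s \<in> carrier S; m \<in> carrier M\<rbrakk> \<Longrightarrow> s \<otimes>t m = s \<odot>\<^bsub>T\<^esub> (\<one>\<^bsub>S\<^esub> \<otimes>t m)"
  by (simp add: smult_ten)

lemma one_ten_smult:
  "\<lbrakk>a \<in> carrier R; m \<in> carrier M\<rbrakk> \<Longrightarrow> \<one>\<^bsub>S\<^esub> \<otimes>t (a \<odot>\<^bsub>M\<^esub> m) = \<phi> a \<odot>\<^bsub>T\<^esub> (\<one>\<^bsub>S\<^esub> \<otimes>t m)"
  by (simp add: smult_ten \<phi>_closed flip: ten_balanced)

lemma linear_eqI:
  assumes "h \<in> module_hom S T N" "k \<in> module_hom S T N" "abelian_group N"
    and "\<And>m. m \<in> carrier M \<Longrightarrow> h (\<one>\<^bsub>S\<^esub> \<otimes>t m) = k (\<one>\<^bsub>S\<^esub> \<otimes>t m)"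
    and "t \<in> carrier T"
  shows "h t = k t"
proof (rule additive_eqI[OF module_hom_additive[OF assms(1)] module_hom_additive[OF assms(2)] assms(3) _ assms(5)])
  fix s m assume "s \<in> carrier S" "m \<in> carrier M"
  then show "h (s \<otimes>t m) = k (s \<otimes>t m)"
    by (simp add: ten_eq_smult[of s] module_hom_smult[OF assms(1)] module_hom_smult[OF assms(2)] assms(4) ten_closed)
qed

lemma tmap_props:
  assumes S': "tensor R S' \<phi>' M" and u: "u \<in> additive S S'"
    and b: "\<And>s a. \<lbrakk>s \<in> carrier S; a \<in> carrier R\<rbrakk> \<Longrightarrow> u (s \<otimes>\<^bsub>S\<^esub> \<phi> a) = u s \<otimes>\<^bsub>S'\<^esub> \<phi>' a"
  shows tmap_additive: "tmap R S \<phi> S' \<phi>' M u \<in> additive T (base_change R S' \<phi>' M)"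
    and tmap_ten: "\<lbrakk>s \<in> carrier S; m \<in> carrier M\<rbrakk>
      \<Longrightarrow> tmap R S \<phi> S' \<phi>' M u (s \<otimes>t m) = tens R S' \<phi>' M (u s) m"
proof -
  interpret S': tensor R S' \<phi>' M by fact
  have "balanced R S \<phi> M (base_change R S' \<phi>' M) (\<lambda>s m. tens R S' \<phi>' M (u s) m)"
    using additive_comp[OF u S'.ten_additive_left] S'.ten_additive_right additive_closed[OF u]
    by (simp add: balanced_def b S'.ten_balanced)
  note * = lift_props[OF S'.T_abelian this, of "tensor_group R S' \<phi>' M", folded tmap_def]
  show "tmap R S \<phi> S' \<phi>' M u \<in> additive T (base_change R S' \<phi>' M)"
    "\<lbrakk>s \<in> carrier S; m \<in> carrier M\<rbrakk> \<Longrightarrow> tmap R S \<phi> S' \<phi>' M u (s \<otimes>t m) = tens R S' \<phi>' M (u s) m"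
    using * by (simp_all add: base_change_simps)
qed

lemma lin_ext_props:
  assumes N: "lmod S N" and f: "f \<in> additive M N"
    and b: "\<And>a m. \<lbrakk>a \<in> carrier R; m \<in> carrier M\<rbrakk> \<Longrightarrow> f (a \<odot>\<^bsub>M\<^esub> m) = \<phi> a \<odot>\<^bsub>N\<^esub> f m"
  shows lin_ext_ext: "lin_ext R S \<phi> M N f \<in> extensional (carrier T)"
    and lin_ext_hom: "lin_ext R S \<phi> M N f \<in> module_hom S T N"
    and lin_ext_ten: "\<lbrakk>s \<in> carrier S; m \<in> carrier M\<rbrakk> \<Longrightarrow> lin_ext R S \<phi> M N f (s \<otimes>t m) = s \<odot>\<^bsub>N\<^esub> f m"
proof -
  interpret N: lmod S N by fact
  note fc = additive_closed[OF f]
  have "balanced R S \<phi> M N (\<lambda>s m. s \<odot>\<^bsub>N\<^esub> f m)"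
    using N.smult_additive_left[OF fc] additive_comp[OF f N.smult_additive] fc
    by (simp add: balanced_def b N.smult_assoc \<phi>_closed)
  note * = lift_props[OF N.M.abelian_group_axioms this, of "add_monoid N", folded lin_ext_def]
  show 1: "lin_ext R S \<phi> M N f \<in> extensional (carrier T)"
    and 2: "s \<in> carrier S \<Longrightarrow> m \<in> carrier M \<Longrightarrow> lin_ext R S \<phi> M N f (s \<otimes>t m) = s \<odot>\<^bsub>N\<^esub> f m" for s m
    using * by simp_all
  have 3: "lin_ext R S \<phi> M N f \<in> additive T N" using * by simp
  show "lin_ext R S \<phi> M N f \<in> module_hom S T N"
  proof (rule module_homI[OF 3])
    fix a x assume a: "a \<in> carrier S" and x: "x \<in> carrier T"
    show "lin_ext R S \<phi> M N f (a \<odot>\<^bsub>T\<^esub> x) = a \<odot>\<^bsub>N\<^esub> lin_ext R S \<phi> M N f x"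
      by (rule additive_eqI[OF additive_comp[OF T.smult_additive[OF a] 3]
            additive_comp[OF 3 N.smult_additive[OF a]] N.M.abelian_group_axioms _ x])
        (simp add: a smult_ten 2 N.smult_assoc fc)
  qed
qed

lemma base_change_map_props:
  assumes M': "lmod R M'" and h: "h \<in> module_hom R M M'"
  shows base_change_map_ext: "base_change_map R S \<phi> M M' h \<in> extensional (carrier T)"
    and base_change_map_hom: "base_change_map R S \<phi> M M' h \<in> module_hom S T (base_change R S \<phi> M')"
    and base_change_map_ten: "\<lbrakk>s \<in> carrier S; m \<in> carrier M\<rbrakk>
      \<Longrightarrow> base_change_map R S \<phi> M M' h (s \<otimes>t m) = tens R S \<phi> M' s (h m)"
proof -
  interpret T': tensor R S \<phi> M'
    using M' by (intro tensor.intro tensor_axioms.intro \<phi>_hom S.ring_axioms)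
  note ha = module_hom_additive[OF h]
  note hc = additive_closed[OF ha]
  have "balanced R S \<phi> M T'.T (\<lambda>s m. tens R S \<phi> M' s (h m))"
    using T'.ten_additive_left[OF hc] additive_comp[OF ha T'.ten_additive_right] hc
    by (simp add: balanced_def module_hom_smult[OF h] T'.ten_balanced)
  note * = lift_props[OF T'.T_abelian this, of "tensor_group R S \<phi> M'", folded base_change_map_def]
  show 1: "base_change_map R S \<phi> M M' h \<in> extensional (carrier T)"
    and 2: "s \<in> carrier S \<Longrightarrow> m \<in> carrier M \<Longrightarrow>
       base_change_map R S \<phi> M M' h (s \<otimes>t m) = tens R S \<phi> M' s (h m)" for s m
    using * by (simp_all add: base_change_simps)
  have 3: "base_change_map R S \<phi> M M' h \<in> additive T T'.T" using * by (simp add: base_change_simps)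
  show "base_change_map R S \<phi> M M' h \<in> module_hom S T T'.T"
  proof (rule module_homI[OF 3])
    fix a x assume a: "a \<in> carrier S" and x: "x \<in> carrier T"
    show "base_change_map R S \<phi> M M' h (a \<odot>\<^bsub>T\<^esub> x) = a \<odot>\<^bsub>T'.T\<^esub> base_change_map R S \<phi> M M' h x"
      by (rule additive_eqI[OF additive_comp[OF T.smult_additive[OF a] 3]
            additive_comp[OF 3 T'.T.smult_additive[OF a]] T'.T_abelian _ x])
        (simp add: a smult_ten 2 T'.smult_ten hc)
  qed
qed

end

section \<open>The cocycle condition over a truncated cosimplicial ring\<close>

lemma module_hom_compose:
  assumes "h \<in> module_hom A P Q" "k \<in> module_hom A Q V" "\<And>a x. \<lbrakk>a \<in> carrier A; x \<in> carrier P\<rbrakk> \<Longrightarrow> a \<odot>\<^bsub>P\<^esub> x \<in> carrier P"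
    "\<And>x y. \<lbrakk>x \<in> carrier P; y \<in> carrier P\<rbrakk> \<Longrightarrow> x \<oplus>\<^bsub>P\<^esub> y \<in> carrier P"
  shows "compose (carrier P) k h \<in> module_hom A P V"
  using assms by (auto simp: module_hom_def compose_def Pi_iff)

text \<open>A module over level 0 of a cosimplicial ring truncated at level 2. The six composites
  \<open>q j \<circ> p i\<close> are three maps, one for each vertex of the 2-simplex. The map \<open>c\<close> belongs to the vertex 0,
  and \<open>Y\<close> is the base change along it, to which \<open>Z 1 1\<close> and \<open>Z 2 1\<close> are canonically isomorphic.\<close>

locale cosimplicial_rings = lmod R M + S1: ring S1 + S2: ring S2
  for R :: "('a, 'p) ring_scheme" and S1 :: "('s, 'q) ring_scheme" and S2 :: "('u, 'v) ring_scheme"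
    and p :: "nat \<Rightarrow> 'a \<Rightarrow> 's" and q :: "nat \<Rightarrow> 's \<Rightarrow> 'u" and M :: "('a, 'm) module" +
  assumes p_hom: "i \<in> {0, 1} \<Longrightarrow> p i \<in> ring_hom R S1"
    and q_hom: "j \<in> {0, 1, 2} \<Longrightarrow> q j \<in> ring_hom S1 S2"
    and qp: "a \<in> carrier R \<Longrightarrow> q 1 (p 0 a) = q 0 (p 0 a)"
      "a \<in> carrier R \<Longrightarrow> q 0 (p 1 a) = q 2 (p 0 a)"
      "a \<in> carrier R \<Longrightarrow> q 2 (p 1 a) = q 1 (p 1 a)"
begin

abbreviation X where "X i \<equiv> base_change R S1 (p i) M"
abbreviation Z where "Z j i \<equiv> base_change S1 S2 (q j) (X i)"
abbreviation c where "c \<equiv> \<lambda>a. q 1 (p 1 a)"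
abbreviation Y where "Y \<equiv> base_change R S2 c M"
abbreviation xt where "xt i \<equiv> tens R S1 (p i) M"
abbreviation zt where "zt j i \<equiv> tens S1 S2 (q j) (X i)"
abbreviation yt where "yt \<equiv> tens R S2 c M"

lemma X_tensor: "i \<in> {0, 1} \<Longrightarrow> tensor R S1 (p i) M"
  using p_hom by (intro tensor.intro tensor_axioms.intro S1.ring_axioms lmod_axioms)

sublocale X0: tensor R S1 "p 0" M by (rule X_tensor) simp
sublocale X1: tensor R S1 "p 1" M by (rule X_tensor) simp

lemma Z_tensor: "\<lbrakk>i \<in> {0, 1}; j \<in> {0, 1, 2}\<rbrakk> \<Longrightarrow> tensor S1 S2 (q j) (X i)"
  using q_hom tensor.T_lmod[OF X_tensor] by (intro tensor.intro tensor_axioms.intro S2.ring_axioms)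

lemma q_closed: "\<lbrakk>j \<in> {0, 1, 2}; t \<in> carrier S1\<rbrakk> \<Longrightarrow> q j t \<in> carrier S2"
  and q_mult: "\<lbrakk>j \<in> {0, 1, 2}; t \<in> carrier S1; t' \<in> carrier S1\<rbrakk> \<Longrightarrow> q j (t \<otimes>\<^bsub>S1\<^esub> t') = q j t \<otimes>\<^bsub>S2\<^esub> q j t'"
  and q_one: "j \<in> {0, 1, 2} \<Longrightarrow> q j \<one>\<^bsub>S1\<^esub> = \<one>\<^bsub>S2\<^esub>"
  and q_additive: "j \<in> {0, 1, 2} \<Longrightarrow> q j \<in> additive S1 S2"
  using q_hom[of j] by (auto simp: ring_hom_def additive_def)

lemma c_hom: "c \<in> ring_hom R S2"
  using ring_hom_trans[OF p_hom q_hom, of 1 1] by (simp add: comp_def)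

sublocale Y: tensor R S2 c M
  using c_hom by (intro tensor.intro tensor_axioms.intro S2.ring_axioms lmod_axioms)

text \<open>The coherence isomorphism is a nested lift, so its additivity and balancedness in the outer
  variable are identities between maps on the inner tensor product, to be checked on pure tensors.\<close>

lemma coherence_props:
  assumes ij: "i \<in> {0, 1}" "j \<in> {0, 1, 2}" and kl: "k \<in> {0, 1}" "l \<in> {0, 1, 2}"
    and eq: "\<And>a. a \<in> carrier R \<Longrightarrow> q j (p i a) = q l (p k a)"
  defines "C \<equiv> base_change_coherence R S1 S2 (p i) (q j) (p k) (q l) M"
  shows coherence_ext: "C \<in> extensional (carrier (Z j i))"
    and coherence_hom: "C \<in> module_hom S2 (Z j i) (Z l k)"
    and coherence_ten: "\<lbrakk>s \<in> carrier S2; t \<in> carrier S1; m \<in> carrier M\<rbrakk>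
       \<Longrightarrow> C (zt j i s (xt i t m)) = zt l k (s \<otimes>\<^bsub>S2\<^esub> q j t) (xt k \<one>\<^bsub>S1\<^esub> m)"
proof -
  interpret Xi: tensor R S1 "p i" M by (rule X_tensor[OF ij(1)])
  interpret Xk: tensor R S1 "p k" M by (rule X_tensor[OF kl(1)])
  interpret Z: tensor S1 S2 "q j" "X i" by (rule Z_tensor[OF ij])
  interpret Z': tensor S1 S2 "q l" "X k" by (rule Z_tensor[OF kl])
  define I where "I s = tensor_lift R S1 (p i) M (tensor_group S1 S2 (q l) (X k))
     (\<lambda>t m. zt l k (s \<otimes>\<^bsub>S2\<^esub> q j t) (xt k \<one>\<^bsub>S1\<^esub> m))" for s
  have C: "C = tensor_lift S1 S2 (q j) (X i) (tensor_group S1 S2 (q l) (X k)) I"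
    unfolding C_def I_def[abs_def] base_change_coherence_def Let_def ..
  have bal: "balanced R S1 (p i) M (Z l k) (\<lambda>t m. zt l k (s \<otimes>\<^bsub>S2\<^esub> q j t) (xt k \<one>\<^bsub>S1\<^esub> m))"
    if s: "s \<in> carrier S2" for s
    unfolding balanced_def
  proof (intro conjI ballI)
    fix m assume m: "m \<in> carrier M"
    show "(\<lambda>t. zt l k (s \<otimes>\<^bsub>S2\<^esub> q j t) (xt k \<one>\<^bsub>S1\<^esub> m)) \<in> additive S1 (Z l k)"
    proof (rule additive_comp[OF _ Z'.ten_additive_left])
      show "(\<lambda>t. s \<otimes>\<^bsub>S2\<^esub> q j t) \<in> additive S1 S2"
        using s q_closed[OF ij(2)] additive_add[OF q_additive[OF ij(2)]]
        by (intro additiveI) (auto simp: S2.r_distr)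
      show "xt k \<one>\<^bsub>S1\<^esub> m \<in> carrier (X k)" using m by (simp add: Xk.ten_closed)
    qed
  next
    fix t assume t: "t \<in> carrier S1"
    show "(\<lambda>m. zt l k (s \<otimes>\<^bsub>S2\<^esub> q j t) (xt k \<one>\<^bsub>S1\<^esub> m)) \<in> additive M (Z l k)"
      by (rule additive_comp[OF Xk.ten_additive_right Z'.ten_additive_right])
        (use s t q_closed[OF ij(2)] in auto)
  next
    fix t a m assume t: "t \<in> carrier S1" "a \<in> carrier R" "m \<in> carrier M"
    have "s \<otimes>\<^bsub>S2\<^esub> q j (t \<otimes>\<^bsub>S1\<^esub> p i a) = (s \<otimes>\<^bsub>S2\<^esub> q j t) \<otimes>\<^bsub>S2\<^esub> q l (p k a)"
      using s t by (simp add: q_mult[OF ij(2)] Xi.\<phi>_closed S2.m_assoc q_closed[OF ij(2)] eq q_closed[OF kl(2)] Xk.\<phi>_closed flip: eq)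
    then show "zt l k (s \<otimes>\<^bsub>S2\<^esub> q j (t \<otimes>\<^bsub>S1\<^esub> p i a)) (xt k \<one>\<^bsub>S1\<^esub> m) =
        zt l k (s \<otimes>\<^bsub>S2\<^esub> q j t) (xt k \<one>\<^bsub>S1\<^esub> (a \<odot>\<^bsub>M\<^esub> m))"
      using s t by (simp add: Z'.ten_balanced q_closed[OF ij(2)] Xk.\<phi>_closed Xk.ten_closed Xk.one_ten_smult)
  qed
  have I_add: "I s \<in> additive (X i) (Z l k)" if "s \<in> carrier S2" for s
    using that Xi.lift_additive[OF Z'.T_abelian bal, of s "tensor_group S1 S2 (q l) (X k)"]
    by (simp add: I_def base_change_simps)
  have I_ten: "I s (xt i t m) = zt l k (s \<otimes>\<^bsub>S2\<^esub> q j t) (xt k \<one>\<^bsub>S1\<^esub> m)"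
    if "s \<in> carrier S2" "t \<in> carrier S1" "m \<in> carrier M" for s t m
    using that Xi.lift_ten[OF Z'.T_abelian bal, of s "tensor_group S1 S2 (q l) (X k)"]
    by (simp add: I_def base_change_simps)
  note simps = I_ten q_closed[OF ij(2)] Z'.ten_closed Xk.ten_closed Z'.ten_add_left
  have "balanced S1 S2 (q j) (X i) (Z l k) I"
    unfolding balanced_def
  proof (intro conjI ballI)
    fix n assume n: "n \<in> carrier (X i)"
    show "(\<lambda>s. I s n) \<in> additive S2 (Z l k)"
    proof (rule additiveI)
      fix s s' assume s: "s \<in> carrier S2" "s' \<in> carrier S2"
      show "I s n \<in> carrier (Z l k)" using additive_closed[OF I_add] s n by blast
      show "I (s \<oplus>\<^bsub>S2\<^esub> s') n = I s n \<oplus>\<^bsub>Z l k\<^esub> I s' n"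
        by (rule Xi.additive_eqI[OF I_add additive_sum[OF I_add I_add] Z'.T_abelian _ n])
          (use s in \<open>simp_all add: simps S2.l_distr Z'.T_abelian\<close>)
    qed
  next
    fix s assume "s \<in> carrier S2" then show "I s \<in> additive (X i) (Z l k)" by (rule I_add)
  next
    fix s t n assume s: "s \<in> carrier S2" "t \<in> carrier S1" and n: "n \<in> carrier (X i)"
    show "I (s \<otimes>\<^bsub>S2\<^esub> q j t) n = I s (t \<odot>\<^bsub>X i\<^esub> n)"
      by (rule Xi.additive_eqI[OF I_add additive_comp[OF Xi.T_smult_additive I_add] Z'.T_abelian _ n])
        (use s in \<open>simp_all add: simps Xi.smult_ten q_mult[OF ij(2)] S2.m_assoc\<close>)
  qed
  note * = Z.lift_props[OF Z'.T_abelian this, of "tensor_group S1 S2 (q l) (X k)", folded C]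
  show "C \<in> extensional (carrier (Z j i))" using * by (simp add: base_change_simps)
  have add: "C \<in> additive (Z j i) (Z l k)" using * by (simp add: base_change_simps)
  have ten1: "C (zt j i s n) = I s n" if "s \<in> carrier S2" "n \<in> carrier (X i)" for s n
    using * that by (simp add: base_change_simps)
  show ten: "C (zt j i s (xt i t m)) = zt l k (s \<otimes>\<^bsub>S2\<^esub> q j t) (xt k \<one>\<^bsub>S1\<^esub> m)"
    if "s \<in> carrier S2" "t \<in> carrier S1" "m \<in> carrier M" for s t m
    using that by (simp add: ten1 I_ten Xi.ten_closed)
  show "C \<in> module_hom S2 (Z j i) (Z l k)"
  proof (rule module_homI[OF add])
    fix a z assume a: "a \<in> carrier S2" and z: "z \<in> carrier (Z j i)"
    show "C (a \<odot>\<^bsub>Z j i\<^esub> z) = a \<odot>\<^bsub>Z l k\<^esub> C z"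
    proof (rule Z.additive_eqI[OF additive_comp[OF Z.T_smult_additive[OF a] add]
            additive_comp[OF add Z'.T_smult_additive[OF a]] Z'.T_abelian _ z])
      fix s n assume s: "s \<in> carrier S2" and n: "n \<in> carrier (X i)"
      have "I (a \<otimes>\<^bsub>S2\<^esub> s) n = a \<odot>\<^bsub>Z l k\<^esub> I s n"
        by (rule Xi.additive_eqI[OF I_add additive_comp[OF I_add Z'.T_smult_additive] Z'.T_abelian _ n])
          (use a s in \<open>simp_all add: simps Z'.smult_ten S2.m_assoc\<close>)
      then show "C (a \<odot>\<^bsub>Z j i\<^esub> zt j i s n) = a \<odot>\<^bsub>Z l k\<^esub> C (zt j i s n)"
        using a s n by (simp add: Z.smult_ten ten1)
    qed
  qed
qed

text \<open>The map \<open>q j \<otimes> id\<close> on \<open>X 1\<close>. It is well defined for \<open>j \<in> {1, 2}\<close>, where \<open>q j \<circ> p 1 = c\<close>.\<close>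

definition push where "push j = tmap R S1 (p 1) S2 c M (q j)"

lemma push_props:
  assumes "j \<in> {1, 2}"
  shows push_additive: "push j \<in> additive (X 1) Y"
    and push_ten: "\<lbrakk>t \<in> carrier S1; m \<in> carrier M\<rbrakk> \<Longrightarrow> push j (xt 1 t m) = yt (q j t) m"
    and push_smult: "\<lbrakk>t \<in> carrier S1; x \<in> carrier (X 1)\<rbrakk> \<Longrightarrow> push j (t \<odot>\<^bsub>X 1\<^esub> x) = q j t \<odot>\<^bsub>Y\<^esub> push j x"
proof -
  have b: "q j (s \<otimes>\<^bsub>S1\<^esub> p 1 a) = q j s \<otimes>\<^bsub>S2\<^esub> c a" if "s \<in> carrier S1" "a \<in> carrier R" for s a
    using that assms qp(3) by (auto simp: q_mult X1.\<phi>_closed)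
  have j: "j \<in> {0, 1, 2}" using assms by auto
  note * = X1.tmap_props[OF Y.tensor_axioms q_additive[OF j] b, folded push_def]
  show 1: "push j \<in> additive (X 1) Y"
    and 2: "t \<in> carrier S1 \<Longrightarrow> m \<in> carrier M \<Longrightarrow> push j (xt 1 t m) = yt (q j t) m" for t m
    using * by auto
  show "push j (t \<odot>\<^bsub>X 1\<^esub> x) = q j t \<odot>\<^bsub>Y\<^esub> push j x" if t: "t \<in> carrier S1" and x: "x \<in> carrier (X 1)"
    by (rule X1.additive_eqI[OF additive_comp[OF X1.T_smult_additive[OF t] 1]
          additive_comp[OF 1 Y.T_smult_additive[OF q_closed[OF j t]]] Y.T_abelian _ x])
      (use t in \<open>simp add: X1.smult_ten 2 Y.smult_ten q_closed[OF j] q_mult[OF j]\<close>)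
qed

text \<open>The map \<open>X 1 \<rightarrow> Y\<close> that corresponds to \<open>\<partial>\<^sup>2 g\<close> on the base change of \<open>X 1\<close> along \<open>q 0\<close>: it sends
  \<open>t \<otimes> m\<close> to \<open>q 0 t\<close> times \<open>\<partial>\<^sup>2 g\<close> at \<open>1 \<otimes> m\<close>, which is balanced since \<open>q 0 \<circ> p 1 = q 2 \<circ> p 0\<close>. Its
  value at \<open>g (1 \<otimes> m)\<close> is the right-hand side \<open>\<partial>\<^sup>2 g \<circ> \<partial>\<^sup>0 g\<close> of the cocycle condition at \<open>1 \<otimes> m\<close>.\<close>

definition cocycle_rhs where
  "cocycle_rhs g = tensor_lift R S1 (p 1) M (tensor_group R S2 c M)
     (\<lambda>t m. q 0 t \<odot>\<^bsub>Y\<^esub> push 2 (g (xt 0 \<one>\<^bsub>S1\<^esub> m)))"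

lemma cocycle_rhs_props:
  assumes g: "g \<in> module_hom S1 (X 0) (X 1)"
  shows cocycle_rhs_additive: "cocycle_rhs g \<in> additive (X 1) Y"
    and cocycle_rhs_ten: "\<lbrakk>t \<in> carrier S1; m \<in> carrier M\<rbrakk>
      \<Longrightarrow> cocycle_rhs g (xt 1 t m) = q 0 t \<odot>\<^bsub>Y\<^esub> push 2 (g (xt 0 \<one>\<^bsub>S1\<^esub> m))"
proof -
  note ga = module_hom_additive[OF g]
  have f: "(\<lambda>m. push 2 (g (xt 0 \<one>\<^bsub>S1\<^esub> m))) \<in> additive M Y"
    by (intro additive_comp[OF additive_comp[OF X0.ten_additive_right ga]] push_additive) auto
  note fc = additive_closed[OF f]
  have "balanced R S1 (p 1) M Y (\<lambda>t m. q 0 t \<odot>\<^bsub>Y\<^esub> push 2 (g (xt 0 \<one>\<^bsub>S1\<^esub> m)))"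
    unfolding balanced_def
  proof (intro conjI ballI)
    fix m assume m: "m \<in> carrier M"
    show "(\<lambda>t. q 0 t \<odot>\<^bsub>Y\<^esub> push 2 (g (xt 0 \<one>\<^bsub>S1\<^esub> m))) \<in> additive S1 Y"
      by (intro additive_comp[OF q_additive Y.T.smult_additive_left]) (use fc m in auto)
  next
    fix t assume t: "t \<in> carrier S1"
    show "(\<lambda>m. q 0 t \<odot>\<^bsub>Y\<^esub> push 2 (g (xt 0 \<one>\<^bsub>S1\<^esub> m))) \<in> additive M Y"
      by (intro additive_comp[OF f Y.T_smult_additive]) (use t q_closed in auto)
  next
    fix t a m assume t: "t \<in> carrier S1" "a \<in> carrier R" "m \<in> carrier M"
    have "g (xt 0 \<one>\<^bsub>S1\<^esub> (a \<odot>\<^bsub>M\<^esub> m)) = p 0 a \<odot>\<^bsub>X 1\<^esub> g (xt 0 \<one>\<^bsub>S1\<^esub> m)"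
      using t by (simp add: X0.one_ten_smult module_hom_smult[OF g] X0.\<phi>_closed X0.ten_closed)
    then have "push 2 (g (xt 0 \<one>\<^bsub>S1\<^esub> (a \<odot>\<^bsub>M\<^esub> m))) = q 2 (p 0 a) \<odot>\<^bsub>Y\<^esub> push 2 (g (xt 0 \<one>\<^bsub>S1\<^esub> m))"
      using t by (simp add: push_smult X0.\<phi>_closed additive_closed[OF ga] X0.ten_closed)
    moreover have "q 0 (t \<otimes>\<^bsub>S1\<^esub> p 1 a) = q 0 t \<otimes>\<^bsub>S2\<^esub> q 2 (p 0 a)"
      using t qp(2)[of a] by (simp add: q_mult X1.\<phi>_closed)
    ultimately show "q 0 (t \<otimes>\<^bsub>S1\<^esub> p 1 a) \<odot>\<^bsub>Y\<^esub> push 2 (g (xt 0 \<one>\<^bsub>S1\<^esub> m)) =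
        q 0 t \<odot>\<^bsub>Y\<^esub> push 2 (g (xt 0 \<one>\<^bsub>S1\<^esub> (a \<odot>\<^bsub>M\<^esub> m)))"
      using t by (simp add: Y.T.smult_assoc q_closed X0.\<phi>_closed fc)
  qed
  note * = X1.lift_props[OF Y.T_abelian this, of "tensor_group R S2 c M", folded cocycle_rhs_def]
  show "cocycle_rhs g \<in> additive (X 1) Y" using * by (simp add: base_change_simps)
  show "\<lbrakk>t \<in> carrier S1; m \<in> carrier M\<rbrakk>
      \<Longrightarrow> cocycle_rhs g (xt 1 t m) = q 0 t \<odot>\<^bsub>Y\<^esub> push 2 (g (xt 0 \<one>\<^bsub>S1\<^esub> m))"
    using * by (simp add: base_change_simps)
qed

text \<open>Both sides of the cocycle condition are \<open>S2\<close>-linear maps \<open>Z 1 0 \<rightarrow> Z 1 1\<close>, so it suffices to compare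
  them on \<open>1 \<otimes> (1 \<otimes> m)\<close>, after composing with the injective map \<open>\<kappa> : Z 1 1 \<rightarrow> Y\<close>,
  \<open>s \<otimes> (t \<otimes> m) \<mapsto> s q(t) \<otimes> m\<close>. In terms of single base changes the coherence isomorphisms are
  identities, so they drop out.\<close>

proposition descent_cocycle_iff:
  assumes g: "g \<in> module_hom S1 (X 0) (X 1)"
  shows "descent_cocycle (BGL n S2) (\<lambda>i. BGL_map R S1 (p i)) (\<lambda>j. BGL_map S1 S2 (q j))
      (\<lambda>(j, i) (l, k). base_change_coherence R S1 S2 (p i) (q j) (p k) (q l)) M g
    \<longleftrightarrow> (\<forall>m \<in> carrier M. push 1 (g (xt 0 \<one>\<^bsub>S1\<^esub> m)) = cocycle_rhs g (g (xt 0 \<one>\<^bsub>S1\<^esub> m)))"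
proof -
  define G where "G j = base_change_map S1 S2 (q j) (X 0) (X 1) g" for j
  define C where "C j i l k = base_change_coherence R S1 S2 (p i) (q j) (p k) (q l) M" for j i l k
  note ga = module_hom_additive[OF g]
  interpret Z10: tensor S1 S2 "q 1" "X 0" by (rule Z_tensor) auto
  interpret Z00: tensor S1 S2 "q 0" "X 0" by (rule Z_tensor) auto
  interpret Z01: tensor S1 S2 "q 0" "X 1" by (rule Z_tensor) auto
  interpret Z20: tensor S1 S2 "q 2" "X 0" by (rule Z_tensor) auto
  interpret Z21: tensor S1 S2 "q 2" "X 1" by (rule Z_tensor) auto
  interpret Z11: tensor S1 S2 "q 1" "X 1" by (rule Z_tensor) auto
  note G1 = Z10.base_change_map_props[OF X1.T_lmod g, folded G_def]
  note G0 = Z00.base_change_map_props[OF X1.T_lmod g, folded G_def]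
  note G2 = Z20.base_change_map_props[OF X1.T_lmod g, folded G_def]
  have C1: "C 1 0 0 0 \<in> module_hom S2 (Z 1 0) (Z 0 0)"
    "\<And>s t m. \<lbrakk>s \<in> carrier S2; t \<in> carrier S1; m \<in> carrier M\<rbrakk>
       \<Longrightarrow> C 1 0 0 0 (zt 1 0 s (xt 0 t m)) = zt 0 0 (s \<otimes>\<^bsub>S2\<^esub> q 1 t) (xt 0 \<one>\<^bsub>S1\<^esub> m)"
    unfolding C_def by (rule coherence_props; simp add: qp)+
  have C2: "C 0 1 2 0 \<in> module_hom S2 (Z 0 1) (Z 2 0)"
    "\<And>s t m. \<lbrakk>s \<in> carrier S2; t \<in> carrier S1; m \<in> carrier M\<rbrakk>
       \<Longrightarrow> C 0 1 2 0 (zt 0 1 s (xt 1 t m)) = zt 2 0 (s \<otimes>\<^bsub>S2\<^esub> q 0 t) (xt 0 \<one>\<^bsub>S1\<^esub> m)"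
    unfolding C_def by (rule coherence_props; simp add: qp)+
  have C3: "C 2 1 1 1 \<in> module_hom S2 (Z 2 1) (Z 1 1)"
    "\<And>s t m. \<lbrakk>s \<in> carrier S2; t \<in> carrier S1; m \<in> carrier M\<rbrakk>
       \<Longrightarrow> C 2 1 1 1 (zt 2 1 s (xt 1 t m)) = zt 1 1 (s \<otimes>\<^bsub>S2\<^esub> q 2 t) (xt 1 \<one>\<^bsub>S1\<^esub> m)"
    unfolding C_def by (rule coherence_props; simp add: qp)+
  define L where "L = compose (carrier (Z 1 0)) (C 2 1 1 1) (compose (carrier (Z 1 0)) (G 2)
     (compose (carrier (Z 1 0)) (C 0 1 2 0) (compose (carrier (Z 1 0)) (G 0) (C 1 0 0 0))))"
  have L_hom: "L \<in> module_hom S2 (Z 1 0) (Z 1 1)"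
    unfolding L_def
    by (intro module_hom_compose[OF _ C3(1)] module_hom_compose[OF _ G2(2)] module_hom_compose[OF _ C2(1)]
        module_hom_compose[OF _ G0(2)] C1(1)) (simp_all add: Z10.T.smult_closed)
  define \<kappa> where "\<kappa> = lin_ext S1 S2 (q 1) (X 1) Y (push 1)"
  have p1: "push 1 \<in> additive (X 1) Y" by (rule push_additive) simp
  have p1': "push 1 (a \<odot>\<^bsub>X 1\<^esub> x) = q 1 a \<odot>\<^bsub>Y\<^esub> push 1 x" if "a \<in> carrier S1" "x \<in> carrier (X 1)" for a x
    using that by (simp add: push_smult)
  note \<kappa> = Z11.lin_ext_props[OF Y.T_lmod p1 p1', folded \<kappa>_def]
  have bal: "balanced R S2 c M (Z 1 1) (\<lambda>s m. zt 1 1 s (xt 1 \<one>\<^bsub>S1\<^esub> m))"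
    unfolding balanced_def
  proof (intro conjI ballI)
    fix m assume m: "m \<in> carrier M"
    then show "(\<lambda>s. zt 1 1 s (xt 1 \<one>\<^bsub>S1\<^esub> m)) \<in> additive S2 (Z 1 1)"
      by (intro Z11.ten_additive_left X1.ten_closed) auto
  next
    fix s assume "s \<in> carrier S2"
    then show "(\<lambda>m. zt 1 1 s (xt 1 \<one>\<^bsub>S1\<^esub> m)) \<in> additive M (Z 1 1)"
      by (intro additive_comp[OF X1.ten_additive_right Z11.ten_additive_right]) auto
  next
    fix s a m assume "s \<in> carrier S2" "a \<in> carrier R" "m \<in> carrier M"
    then show "zt 1 1 (s \<otimes>\<^bsub>S2\<^esub> c a) (xt 1 \<one>\<^bsub>S1\<^esub> m) = zt 1 1 s (xt 1 \<one>\<^bsub>S1\<^esub> (a \<odot>\<^bsub>M\<^esub> m))"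
      by (simp add: Z11.ten_balanced X1.\<phi>_closed X1.ten_closed X1.one_ten_smult)
  qed
  \<comment> \<open>The left inverse \<open>s \<otimes> m \<mapsto> s \<otimes> (1 \<otimes> m)\<close> of \<open>\<kappa>\<close>.\<close>
  obtain \<nu> where l: "\<nu> \<in> additive Y (Z 1 1)"
    "\<And>s m. \<lbrakk>s \<in> carrier S2; m \<in> carrier M\<rbrakk> \<Longrightarrow> \<nu> (yt s m) = zt 1 1 s (xt 1 \<one>\<^bsub>S1\<^esub> m)"
    using Y.balanced_lift_ex[OF Z11.T_abelian bal] by blast
  have inj: "\<nu> (\<kappa> z) = z" if z: "z \<in> carrier (Z 1 1)" for z
  proof (rule Z11.additive_eqI[OF additive_comp[OF module_hom_additive[OF \<kappa>(2)] l(1)] additive_id Z11.T_abelian _ z])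
    fix s x assume s: "s \<in> carrier S2" and x: "x \<in> carrier (X 1)"
    have "\<nu> (s \<odot>\<^bsub>Y\<^esub> push 1 x) = zt 1 1 s x"
      by (rule X1.additive_eqI[OF additive_comp[OF additive_comp[OF push_additive Y.T_smult_additive] l(1)]
            Z11.ten_additive_right Z11.T_abelian _ x])
        (use s in \<open>simp_all add: push_ten Y.smult_ten q_closed l(2) Z11.ten_balanced X1.ten_closed flip: X1.ten_eq_smult\<close>)
    then show "\<nu> (\<kappa> (zt 1 1 s x)) = zt 1 1 s x" using s x by (simp add: \<kappa>(3))
  qed
  have 1: "\<kappa> (G 1 (zt 1 0 \<one>\<^bsub>S2\<^esub> (xt 0 \<one>\<^bsub>S1\<^esub> m))) = push 1 (g (xt 0 \<one>\<^bsub>S1\<^esub> m))" if "m \<in> carrier M" for m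
    using that by (simp add: G1(3) X0.ten_closed \<kappa>(3) additive_closed[OF ga]
        Y.T.smult_one additive_closed[OF push_additive])
  have 2: "\<kappa> (C 2 1 1 1 (zt 2 1 s x)) = s \<odot>\<^bsub>Y\<^esub> push 2 x" if s: "s \<in> carrier S2" and x: "x \<in> carrier (X 1)" for s x
    by (rule X1.additive_eqI[OF additive_comp[OF additive_comp[OF Z21.ten_additive_right module_hom_additive[OF C3(1)]]
            module_hom_additive[OF \<kappa>(2)]] additive_comp[OF push_additive Y.T_smult_additive] Y.T_abelian _ x])
      (use s in \<open>simp_all add: C3(2) \<kappa>(3) X1.ten_closed q_closed push_ten q_one Y.smult_ten\<close>)
  have 3: "\<kappa> (C 2 1 1 1 (G 2 (C 0 1 2 0 (zt 0 1 \<one>\<^bsub>S2\<^esub> x)))) = cocycle_rhs g x" if x: "x \<in> carrier (X 1)" for x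
    by (rule X1.additive_eqI[OF additive_comp[OF additive_comp[OF additive_comp[OF additive_comp[OF Z01.ten_additive_right
            module_hom_additive[OF C2(1)]] module_hom_additive[OF G2(2)]] module_hom_additive[OF C3(1)]]
            module_hom_additive[OF \<kappa>(2)]] cocycle_rhs_additive[OF g] Y.T_abelian _ x])
      (simp_all add: C2(2) G2(3) q_closed X0.ten_closed 2 additive_closed[OF ga] cocycle_rhs_ten[OF g])
  have 4: "\<kappa> (L (zt 1 0 \<one>\<^bsub>S2\<^esub> (xt 0 \<one>\<^bsub>S1\<^esub> m))) = cocycle_rhs g (g (xt 0 \<one>\<^bsub>S1\<^esub> m))" if m: "m \<in> carrier M" for m
  proof -
    have "zt 1 0 \<one>\<^bsub>S2\<^esub> (xt 0 \<one>\<^bsub>S1\<^esub> m) \<in> carrier (Z 1 0)"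
      using m by (simp add: Z10.ten_closed X0.ten_closed)
    then show ?thesis
      using m by (simp add: L_def compose_eq C1(2) q_one G0(3) X0.ten_closed 3 additive_closed[OF ga])
  qed
  have "descent_cocycle (BGL n S2) (\<lambda>i. BGL_map R S1 (p i)) (\<lambda>j. BGL_map S1 S2 (q j))
      (\<lambda>(j, i) (l, k). base_change_coherence R S1 S2 (p i) (q j) (p k) (q l)) M g \<longleftrightarrow> G 1 = L"
    by (simp add: descent_cocycle_def BGL_map_def BGL_def Let_def G_def L_def C_def)
  also have "\<dots> \<longleftrightarrow> (\<forall>m \<in> carrier M. G 1 (zt 1 0 \<one>\<^bsub>S2\<^esub> (xt 0 \<one>\<^bsub>S1\<^esub> m)) = L (zt 1 0 \<one>\<^bsub>S2\<^esub> (xt 0 \<one>\<^bsub>S1\<^esub> m)))"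
  proof
    assume r: "\<forall>m \<in> carrier M. G 1 (zt 1 0 \<one>\<^bsub>S2\<^esub> (xt 0 \<one>\<^bsub>S1\<^esub> m)) = L (zt 1 0 \<one>\<^bsub>S2\<^esub> (xt 0 \<one>\<^bsub>S1\<^esub> m))"
    show "G 1 = L"
    proof (rule extensionalityI[OF G1(1)])
      show "L \<in> extensional (carrier (Z 1 0))" by (simp add: L_def)
      fix z assume z: "z \<in> carrier (Z 1 0)"
      show "G 1 z = L z"
      proof (rule Z10.linear_eqI[OF G1(2) L_hom Z11.T_abelian _ z])
        fix x assume x: "x \<in> carrier (X 0)"
        show "G 1 (zt 1 0 \<one>\<^bsub>S2\<^esub> x) = L (zt 1 0 \<one>\<^bsub>S2\<^esub> x)"
        proof (rule X0.additive_eqI[OF additive_comp[OF Z10.ten_additive_right module_hom_additive[OF G1(2)]]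
            additive_comp[OF Z10.ten_additive_right module_hom_additive[OF L_hom]] Z11.T_abelian _ x])
          fix t m assume t: "t \<in> carrier S1" "m \<in> carrier M"
          have "zt 1 0 \<one>\<^bsub>S2\<^esub> (xt 0 t m) = q 1 t \<odot>\<^bsub>Z 1 0\<^esub> zt 1 0 \<one>\<^bsub>S2\<^esub> (xt 0 \<one>\<^bsub>S1\<^esub> m)"
            using t by (simp add: X0.ten_eq_smult[of t] Z10.one_ten_smult X0.ten_closed)
          then show "G 1 (zt 1 0 \<one>\<^bsub>S2\<^esub> (xt 0 t m)) = L (zt 1 0 \<one>\<^bsub>S2\<^esub> (xt 0 t m))"
            using t r by (simp add: module_hom_smult[OF G1(2)] module_hom_smult[OF L_hom] q_closed
                Z10.ten_closed X0.ten_closed)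
        qed auto
      qed
    qed
  qed auto
  also have "\<dots> \<longleftrightarrow> (\<forall>m \<in> carrier M. \<kappa> (G 1 (zt 1 0 \<one>\<^bsub>S2\<^esub> (xt 0 \<one>\<^bsub>S1\<^esub> m))) = \<kappa> (L (zt 1 0 \<one>\<^bsub>S2\<^esub> (xt 0 \<one>\<^bsub>S1\<^esub> m))))"
  proof (intro ball_cong refl)
    fix m assume "m \<in> carrier M"
    then have "zt 1 0 \<one>\<^bsub>S2\<^esub> (xt 0 \<one>\<^bsub>S1\<^esub> m) \<in> carrier (Z 1 0)"
      by (simp add: Z10.ten_closed X0.ten_closed)
    from this[THEN additive_closed[OF module_hom_additive[OF G1(2)]]] this[THEN additive_closed[OF module_hom_additive[OF L_hom]]]
    show "(G 1 (zt 1 0 \<one>\<^bsub>S2\<^esub> (xt 0 \<one>\<^bsub>S1\<^esub> m)) = L (zt 1 0 \<one>\<^bsub>S2\<^esub> (xt 0 \<one>\<^bsub>S1\<^esub> m))) \<longleftrightarrow>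
       (\<kappa> (G 1 (zt 1 0 \<one>\<^bsub>S2\<^esub> (xt 0 \<one>\<^bsub>S1\<^esub> m))) = \<kappa> (L (zt 1 0 \<one>\<^bsub>S2\<^esub> (xt 0 \<one>\<^bsub>S1\<^esub> m))))"
      using inj by metis
  qed
  finally show ?thesis by (simp add: 1 4)
qed

end

section \<open>Homogeneous components and the grading involution\<close>

lemma (in abelian_group) sign_pow_add_pow:
  "x \<in> carrier G \<Longrightarrow> [((- 1) ^ p :: int)] \<cdot>\<^bsub>G\<^esub> x = (if even p then x else \<ominus>\<^bsub>G\<^esub> x)"
  by (simp add: add.int_pow_1 add.int_pow_neg)

locale dg =
  fixes R :: "('r, 'x) ring_scheme" and B :: "('r, 'b, 'y) dg_alg_scheme"
  assumes dg: "DG_CAlg R B"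
begin

sublocale B: ring B
  using dg by (simp add: DG_CAlg_def)

lemma R_module: "module R B"
  using dg by (simp add: DG_CAlg_def)

lemma gr_carrier: "a \<in> gr B p \<Longrightarrow> a \<in> carrier B"
  and gr_zero: "\<zero>\<^bsub>B\<^esub> \<in> gr B p"
  and gr_add: "\<lbrakk>a \<in> gr B p; b \<in> gr B p\<rbrakk> \<Longrightarrow> a \<oplus>\<^bsub>B\<^esub> b \<in> gr B p"
  and gr_minus: "a \<in> gr B p \<Longrightarrow> \<ominus>\<^bsub>B\<^esub> a \<in> gr B p"
  and gr_smult: "\<lbrakk>r \<in> carrier R; a \<in> gr B p\<rbrakk> \<Longrightarrow> r \<odot>\<^bsub>B\<^esub> a \<in> gr B p"
proof -
  have s: "submodule (gr B p) R B" by (rule DG_CAlg.gr_submodule[OF dg])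
  note * = module.submoduleE[OF R_module s]
  show "a \<in> gr B p \<Longrightarrow> a \<in> carrier B" using * by auto
  show "\<zero>\<^bsub>B\<^esub> \<in> gr B p"
    using subgroup.one_closed[OF submodule.axioms(1)[OF s]] by simp
  show "\<lbrakk>a \<in> gr B p; b \<in> gr B p\<rbrakk> \<Longrightarrow> a \<oplus>\<^bsub>B\<^esub> b \<in> gr B p" "a \<in> gr B p \<Longrightarrow> \<ominus>\<^bsub>B\<^esub> a \<in> gr B p"
    "\<lbrakk>r \<in> carrier R; a \<in> gr B p\<rbrakk> \<Longrightarrow> r \<odot>\<^bsub>B\<^esub> a \<in> gr B p"
    using * by auto
qed

lemmas gr_one = DG_CAlg.one_gr[OF dg]
lemmas gr_mult = DG_CAlg.mult_gr[OF dg]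
lemmas d_gr = DG_CAlg.diff_gr[OF dg]
lemmas d_d = DG_CAlg.diff_diff[OF dg]

lemma gr_mult0: "\<lbrakk>a \<in> gr B 0; b \<in> gr B p\<rbrakk> \<Longrightarrow> a \<otimes>\<^bsub>B\<^esub> b \<in> gr B p"
  "\<lbrakk>b \<in> gr B p; a \<in> gr B 0\<rbrakk> \<Longrightarrow> b \<otimes>\<^bsub>B\<^esub> a \<in> gr B p"
  using gr_mult[of a 0 b p] gr_mult[of b p a 0] by auto

lemma gr_mult11: "\<lbrakk>a \<in> gr B 1; b \<in> gr B 1\<rbrakk> \<Longrightarrow> a \<otimes>\<^bsub>B\<^esub> b \<in> gr B 2"
  using gr_mult[of a 1 b 1] by simp

lemma d_gr0: "a \<in> gr B 0 \<Longrightarrow> diff B a \<in> gr B 1"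
  and d_gr1: "a \<in> gr B 1 \<Longrightarrow> diff B a \<in> gr B 2"
  using d_gr[of a 0] d_gr[of a 1] by (simp_all add: One_nat_def numeral_2_eq_2)

lemma d_additive: "diff B \<in> additive B B"
  by (rule module_hom_additive[OF DG_CAlg.diff_linear[OF dg]])

lemma d_smult: "\<lbrakk>r \<in> carrier R; a \<in> carrier B\<rbrakk> \<Longrightarrow> diff B (r \<odot>\<^bsub>B\<^esub> a) = r \<odot>\<^bsub>B\<^esub> diff B a"
  by (rule module_hom_smult[OF DG_CAlg.diff_linear[OF dg]])

lemmas d_closed = additive_closed[OF d_additive]
lemmas d_add = additive_add[OF d_additive]
lemmas d_zero = additive_zero[OF d_additive B.abelian_group_axioms B.abelian_group_axioms]
lemmas d_minus = additive_minus[OF d_additive B.abelian_group_axioms B.abelian_group_axioms]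

lemma leibniz: "\<lbrakk>a \<in> gr B p; b \<in> carrier B\<rbrakk> \<Longrightarrow> diff B (a \<otimes>\<^bsub>B\<^esub> b) =
    diff B a \<otimes>\<^bsub>B\<^esub> b \<oplus>\<^bsub>B\<^esub> (if even p then a \<otimes>\<^bsub>B\<^esub> diff B b else \<ominus>\<^bsub>B\<^esub> (a \<otimes>\<^bsub>B\<^esub> diff B b))"
  using DG_CAlg.diff_Leibniz[OF dg, of a p b] by (simp add: B.sign_pow_add_pow gr_carrier d_closed)

lemma d_one: "diff B \<one>\<^bsub>B\<^esub> = \<zero>\<^bsub>B\<^esub>"
proof -
  have "diff B \<one>\<^bsub>B\<^esub> \<oplus>\<^bsub>B\<^esub> diff B \<one>\<^bsub>B\<^esub> = diff B \<one>\<^bsub>B\<^esub>"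
    using leibniz[OF gr_one, of "\<one>\<^bsub>B\<^esub>"] by (simp add: d_closed)
  then show ?thesis by (simp add: d_closed B.add.r_cancel_one')
qed

lemma deg0_simps [simp]:
  "carrier (deg0 B) = gr B 0" "monoid.mult (deg0 B) = monoid.mult B" "one (deg0 B) = one B"
  "zero (deg0 B) = zero B" "add (deg0 B) = add B"
  by (simp_all add: deg0_def)

lemma deg0_ring: "ring (deg0 B)"
proof (rule ringI)
  show "abelian_group (deg0 B)"
  proof (rule abelian_groupI)
    fix x assume "x \<in> carrier (deg0 B)"
    then show "\<exists>y \<in> carrier (deg0 B). y \<oplus>\<^bsub>deg0 B\<^esub> x = \<zero>\<^bsub>deg0 B\<^esub>"
      by (intro bexI[of _ "\<ominus>\<^bsub>B\<^esub> x"]) (simp_all add: gr_carrier gr_minus B.l_neg)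
  qed (simp_all add: gr_carrier gr_zero gr_add B.a_ac)
qed (auto intro!: monoidI simp: gr_carrier gr_one gr_mult0 B.m_assoc B.l_distr B.r_distr)

definition homogeneous_parts :: "'b \<Rightarrow> nat \<Rightarrow> 'b" where
  "homogeneous_parts a = (THE c. (\<forall>m. c m \<in> gr B m) \<and> finite {m. c m \<noteq> \<zero>\<^bsub>B\<^esub>} \<and>
            a = (\<Oplus>\<^bsub>B\<^esub>m \<in> {m. c m \<noteq> \<zero>\<^bsub>B\<^esub>}. c m))"

definition hcomp :: "nat \<Rightarrow> 'b \<Rightarrow> 'b" where "hcomp p a = homogeneous_parts a p"

lemma hcomp_props:
  assumes "a \<in> carrier B"
  shows hcomp_gr: "hcomp p a \<in> gr B p"
    and hcomp_finite: "finite {p. hcomp p a \<noteq> \<zero>\<^bsub>B\<^esub>}"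
    and hcomp_sum: "a = (\<Oplus>\<^bsub>B\<^esub>p \<in> {p. hcomp p a \<noteq> \<zero>\<^bsub>B\<^esub>}. hcomp p a)"
  using theI'[OF DG_CAlg.gr_direct_sum[OF dg assms], folded homogeneous_parts_def] by (simp_all add: hcomp_def)

lemma finsum_support:
  assumes "finite A" "\<And>p. c p \<in> carrier B" "\<And>p. p \<notin> A \<Longrightarrow> c p = \<zero>\<^bsub>B\<^esub>"
  shows "(\<Oplus>\<^bsub>B\<^esub>p \<in> A. c p) = (\<Oplus>\<^bsub>B\<^esub>p \<in> {p. c p \<noteq> \<zero>\<^bsub>B\<^esub>}. c p)"
proof (rule B.add.finprod_mono_neutral_cong)
  show "finite {p. c p \<noteq> \<zero>\<^bsub>B\<^esub>}" using assms(1,3) by (auto intro: finite_subset[of _ A])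
  show "c \<in> A \<rightarrow> carrier B" "c \<in> {p. c p \<noteq> \<zero>\<^bsub>B\<^esub>} \<rightarrow> carrier B" using assms(2) by blast+
qed (use assms in auto)

text \<open>Any finite family of homogeneous elements, extended by zeros, is the decomposition of its sum. So
  components of sums and products are found by exhibiting a decomposition.\<close>

lemma hcomp_unique:
  assumes "finite A" "\<And>p. c p \<in> gr B p" "\<And>p. p \<notin> A \<Longrightarrow> c p = \<zero>\<^bsub>B\<^esub>"
  shows "hcomp p (\<Oplus>\<^bsub>B\<^esub>p \<in> A. c p) = c p"
proof -
  let ?a = "\<Oplus>\<^bsub>B\<^esub>p \<in> A. c p"
  have a: "?a \<in> carrier B" by (intro B.finsum_closed) (auto intro: gr_carrier[OF assms(2)])
  have "?a = (\<Oplus>\<^bsub>B\<^esub>p \<in> {p. c p \<noteq> \<zero>\<^bsub>B\<^esub>}. c p)"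
    by (rule finsum_support) (use assms gr_carrier in auto)
  moreover have "finite {p. c p \<noteq> \<zero>\<^bsub>B\<^esub>}" using assms by (auto intro: finite_subset[of _ A])
  ultimately have "homogeneous_parts ?a = c"
    unfolding homogeneous_parts_def using assms(2) DG_CAlg.gr_direct_sum[OF dg a]
    by (intro the1_equality) auto
  then show ?thesis by (simp add: hcomp_def)
qed

lemma hcomp_sum_on:
  assumes "a \<in> carrier B" "finite A" "{p. hcomp p a \<noteq> \<zero>\<^bsub>B\<^esub>} \<subseteq> A"
  shows "(\<Oplus>\<^bsub>B\<^esub>p \<in> A. hcomp p a) = a"
  using finsum_support[OF assms(2), of "\<lambda>p. hcomp p a"] hcomp_sum[OF assms(1)] assms(3)
    gr_carrier[OF hcomp_gr[OF assms(1)]]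
  by auto

lemma hcomp_additive: "hcomp p \<in> additive B (B\<lparr>carrier := gr B p\<rparr>)"
proof (rule additiveI)
  fix a b assume ab: "a \<in> carrier B" "b \<in> carrier B"
  show "hcomp p a \<in> carrier (B\<lparr>carrier := gr B p\<rparr>)" using ab hcomp_gr by simp
  let ?A = "{p. hcomp p a \<noteq> \<zero>\<^bsub>B\<^esub>} \<union> {p. hcomp p b \<noteq> \<zero>\<^bsub>B\<^esub>}"
  have f: "finite ?A" using ab hcomp_finite by simp
  have "(\<Oplus>\<^bsub>B\<^esub>p \<in> ?A. hcomp p a \<oplus>\<^bsub>B\<^esub> hcomp p b) = a \<oplus>\<^bsub>B\<^esub> b"
    using ab gr_carrier[OF hcomp_gr] hcomp_sum_on[OF ab(1) f] hcomp_sum_on[OF ab(2) f]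
    by (subst B.finsum_addf) auto
  moreover have "hcomp p (\<Oplus>\<^bsub>B\<^esub>p \<in> ?A. hcomp p a \<oplus>\<^bsub>B\<^esub> hcomp p b) = hcomp p a \<oplus>\<^bsub>B\<^esub> hcomp p b"
    by (rule hcomp_unique[OF f]) (use ab in \<open>auto simp: hcomp_gr gr_add\<close>)
  ultimately show "hcomp p (a \<oplus>\<^bsub>B\<^esub> b) = hcomp p a \<oplus>\<^bsub>B\<lparr>carrier := gr B p\<rparr>\<^esub> hcomp p b" by simp
qed

lemma hcomp_add: "\<lbrakk>a \<in> carrier B; b \<in> carrier B\<rbrakk> \<Longrightarrow> hcomp p (a \<oplus>\<^bsub>B\<^esub> b) = hcomp p a \<oplus>\<^bsub>B\<^esub> hcomp p b"
  using additive_add[OF hcomp_additive] by simp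

lemma hcomp_homogeneous: "a \<in> gr B q \<Longrightarrow> hcomp p a = (if p = q then a else \<zero>\<^bsub>B\<^esub>)"
  using hcomp_unique[of "{q}" "\<lambda>p. if p = q then a else \<zero>\<^bsub>B\<^esub>" p] by (simp add: gr_zero gr_carrier)

lemma hcomp_mult0:
  assumes a: "a \<in> carrier B" and b: "b \<in> gr B 0"
  shows "hcomp p (a \<otimes>\<^bsub>B\<^esub> b) = hcomp p a \<otimes>\<^bsub>B\<^esub> b"
proof -
  let ?A = "{p. hcomp p a \<noteq> \<zero>\<^bsub>B\<^esub>}"
  have "a \<otimes>\<^bsub>B\<^esub> b = (\<Oplus>\<^bsub>B\<^esub>p \<in> ?A. hcomp p a \<otimes>\<^bsub>B\<^esub> b)"
    using B.finsum_ldistr[of ?A b "\<lambda>p. hcomp p a"] hcomp_finite[OF a] hcomp_sum[OF a] b gr_carrier hcomp_gr[OF a] by auto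
  moreover have "hcomp p (\<Oplus>\<^bsub>B\<^esub>p \<in> ?A. hcomp p a \<otimes>\<^bsub>B\<^esub> b) = hcomp p a \<otimes>\<^bsub>B\<^esub> b"
    by (rule hcomp_unique[OF hcomp_finite[OF a]]) (use a b in \<open>auto simp: hcomp_gr gr_mult0 gr_carrier\<close>)
  ultimately show ?thesis by simp
qed

lemma homogeneous_induct [consumes 1, case_names zero add gr]:
  assumes a: "a \<in> carrier B" and zero: "P \<zero>\<^bsub>B\<^esub>"
    and add: "\<And>a b. \<lbrakk>a \<in> carrier B; b \<in> carrier B; P a; P b\<rbrakk> \<Longrightarrow> P (a \<oplus>\<^bsub>B\<^esub> b)"
    and gr: "\<And>p a. a \<in> gr B p \<Longrightarrow> P a"
  shows "P a"
proof -
  have "finite A \<Longrightarrow> P (\<Oplus>\<^bsub>B\<^esub>p \<in> A. hcomp p a)" for A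
  proof (induction A rule: finite_induct)
    case (insert x A)
    then show ?case using gr_carrier[OF hcomp_gr[OF a]] gr[OF hcomp_gr[OF a]]
      by (subst B.finsum_insert) (auto intro!: add B.finsum_closed)
  qed (simp add: zero)
  then show ?thesis using hcomp_sum[OF a] hcomp_finite[OF a] by metis
qed

text \<open>The grading involution \<open>b \<mapsto> (-1)\<^bsup>deg b\<^esup> b\<close>. It turns the sign of the Leibniz rule into an additive map,
  so that the rule makes sense for inhomogeneous elements and can define a map on \<open>B \<otimes> M\<close>.\<close>

definition bar :: "'b \<Rightarrow> 'b" where
  "bar a = (\<Oplus>\<^bsub>B\<^esub>p \<in> {p. hcomp p a \<noteq> \<zero>\<^bsub>B\<^esub>}. if even p then hcomp p a else \<ominus>\<^bsub>B\<^esub> hcomp p a)"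

lemma bar_on:
  assumes "a \<in> carrier B" "finite A" "{p. hcomp p a \<noteq> \<zero>\<^bsub>B\<^esub>} \<subseteq> A"
  shows "(\<Oplus>\<^bsub>B\<^esub>p \<in> A. if even p then hcomp p a else \<ominus>\<^bsub>B\<^esub> hcomp p a) = bar a"
  unfolding bar_def
  by (rule B.add.finprod_mono_neutral_cong)
    (use assms hcomp_finite[OF assms(1)] gr_carrier[OF hcomp_gr[OF assms(1)]] in \<open>auto\<close>)

lemma bar_additive: "bar \<in> additive B B"
proof (rule additiveI)
  fix a b assume ab: "a \<in> carrier B" "b \<in> carrier B"
  show "bar a \<in> carrier B"
    unfolding bar_def using ab gr_carrier[OF hcomp_gr] by (intro B.finsum_closed) auto
  let ?f = "\<lambda>a p. if even p then hcomp p a else \<ominus>\<^bsub>B\<^esub> hcomp p a"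
  let ?A = "{p. hcomp p a \<noteq> \<zero>\<^bsub>B\<^esub>} \<union> {p. hcomp p b \<noteq> \<zero>\<^bsub>B\<^esub>}"
  have f: "finite ?A" using ab hcomp_finite by simp
  have c: "?f a p \<in> carrier B" "?f b p \<in> carrier B" for p using ab gr_carrier[OF hcomp_gr] by auto
  have "bar (a \<oplus>\<^bsub>B\<^esub> b) = (\<Oplus>\<^bsub>B\<^esub>p \<in> ?A. ?f (a \<oplus>\<^bsub>B\<^esub> b) p)"
    by (rule bar_on[symmetric]) (use ab f in \<open>auto simp: hcomp_add\<close>)
  also have "\<dots> = (\<Oplus>\<^bsub>B\<^esub>p \<in> ?A. ?f a p \<oplus>\<^bsub>B\<^esub> ?f b p)"
    by (rule B.finsum_cong') (use ab gr_carrier[OF hcomp_gr] in \<open>auto simp: hcomp_add B.minus_add B.a_comm\<close>)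
  also have "\<dots> = (\<Oplus>\<^bsub>B\<^esub>p \<in> ?A. ?f a p) \<oplus>\<^bsub>B\<^esub> (\<Oplus>\<^bsub>B\<^esub>p \<in> ?A. ?f b p)"
    by (rule B.finsum_addf) (use c in auto)
  also have "\<dots> = bar a \<oplus>\<^bsub>B\<^esub> bar b"
    using bar_on[OF ab(1) f] bar_on[OF ab(2) f] by simp
  finally show "bar (a \<oplus>\<^bsub>B\<^esub> b) = bar a \<oplus>\<^bsub>B\<^esub> bar b" .
qed

lemmas bar_closed = additive_closed[OF bar_additive]
lemmas bar_add = additive_add[OF bar_additive]
lemmas bar_zero = additive_zero[OF bar_additive B.abelian_group_axioms B.abelian_group_axioms]

lemma bar_homogeneous: "a \<in> gr B p \<Longrightarrow> bar a = (if even p then a else \<ominus>\<^bsub>B\<^esub> a)"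
proof -
  assume a: "a \<in> gr B p"
  have "{q. hcomp q a \<noteq> \<zero>\<^bsub>B\<^esub>} \<subseteq> {p}" using hcomp_homogeneous[OF a] by auto
  then show ?thesis
    using bar_on[of a "{p}"] hcomp_homogeneous[OF a, of p] gr_carrier[OF a] by auto
qed

lemma bar_mult0:
  assumes "a \<in> carrier B" "b \<in> gr B 0"
  shows "bar (a \<otimes>\<^bsub>B\<^esub> b) = bar a \<otimes>\<^bsub>B\<^esub> b"
  using assms(1)
proof (induction rule: homogeneous_induct)
  case zero then show ?case using gr_carrier[OF assms(2)] by (simp add: bar_zero)
next
  case (add a a') then show ?case using gr_carrier[OF assms(2)] by (simp add: B.l_distr bar_add bar_closed)
next
  case (gr p a) then show ?case
    using gr_mult0(2)[OF gr assms(2)] gr_carrier[OF assms(2)]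
    by (simp add: bar_homogeneous gr_carrier[OF gr] B.l_minus)
qed

lemma leibniz_bar:
  assumes "a \<in> carrier B" "b \<in> carrier B"
  shows "diff B (a \<otimes>\<^bsub>B\<^esub> b) = diff B a \<otimes>\<^bsub>B\<^esub> b \<oplus>\<^bsub>B\<^esub> bar a \<otimes>\<^bsub>B\<^esub> diff B b"
  using assms(1)
proof (induction rule: homogeneous_induct)
  case zero then show ?case by (simp add: bar_zero assms d_zero d_closed)
next
  case (add a a') then show ?case
    by (simp add: B.l_distr bar_add bar_closed assms d_add d_closed B.a_ac)
next
  case (gr p a) then show ?case
    by (simp add: leibniz bar_homogeneous gr_carrier assms B.l_minus d_closed)
qed

end

section \<open>The first two levels of the denormalisation\<close>

lemma Pow_1: "Pow {1..1::nat} = {{}, {1}}" by auto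

lemma Pow_2: "Pow {1..2::nat} = {{}, {1}, {2}, {1, 2}}"
proof -
  have "{1..2::nat} = {1, 2}" by auto
  then show ?thesis by (auto simp: Pow_insert)
qed

text \<open>The element \<open>\<partial>\<^sup>1 a + b\<close> of \<open>D\<^sup>1 B\<close>, written \<open>a + \<epsilon>b\<close> in the comments.\<close>

definition level1 :: "'b \<Rightarrow> 'b \<Rightarrow> nat set \<Rightarrow> 'b" where
  "level1 a b = (\<lambda>I \<in> Pow {1..1}. if I = {} then b else a)"

text \<open>The element \<open>\<partial>\<^sup>2 \<partial>\<^sup>1 a + \<partial>\<^sup>1 b + \<partial>\<^sup>2 c + e\<close> of \<open>D\<^sup>2 B\<close>, written \<open>a + \<epsilon>\<^sub>1 b + \<epsilon>\<^sub>2 c + e\<close> in the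
  comments. By the shuffle product, \<open>(\<epsilon>\<^sub>2 b)(\<epsilon>\<^sub>1 c) = bc\<close>, \<open>(\<epsilon>\<^sub>1 b)(\<epsilon>\<^sub>2 c) = - bc\<close> and
  \<open>(\<epsilon>\<^sub>k b)(\<epsilon>\<^sub>k c) = 0\<close>.\<close>

definition level2 :: "'b \<Rightarrow> 'b \<Rightarrow> 'b \<Rightarrow> 'b \<Rightarrow> nat set \<Rightarrow> 'b" where
  "level2 a b c e = (\<lambda>I \<in> Pow {1..2}. if I = {} then e else if I = {1} then b else if I = {2} then c else a)"

lemma level1_simps [simp]: "level1 a b {} = b" "level1 a b {1} = a"
  by (simp_all add: level1_def)

lemma level2_simps [simp]: "level2 a b c e {} = e" "level2 a b c e {1} = b" "level2 a b c e {2} = c" "level2 a b c e {1, 2} = a"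
  by (auto simp: level2_def)

lemma eq_level1:
  assumes "x \<in> extensional (Pow {1..1})" shows "x = level1 (x {1}) (x {})"
proof (rule extensionalityI[OF assms])
  show "level1 (x {1}) (x {}) \<in> extensional (Pow {1..1})" by (simp add: level1_def del: Pow_iff atLeastAtMost_singleton)
  fix I :: "nat set" assume "I \<in> Pow {1..1}"
  then have "I \<in> {{}, {1}}" unfolding Pow_1 .
  then show "x I = level1 (x {1}) (x {}) I"
    by (elim insertE emptyE; hypsubst; simp only: level1_simps)
qed

lemma eq_level2:
  assumes "x \<in> extensional (Pow {1..2})" shows "x = level2 (x {1, 2}) (x {1}) (x {2}) (x {})"
proof (rule extensionalityI[OF assms])
  show "level2 (x {1, 2}) (x {1}) (x {2}) (x {}) \<in> extensional (Pow {1..2})" by (simp add: level2_def)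
  fix I :: "nat set" assume "I \<in> Pow {1..2}"
  then have "I \<in> {{}, {1}, {2}, {1, 2}}" unfolding Pow_2 .
  then show "x I = level2 (x {1, 2}) (x {1}) (x {2}) (x {}) I"
    by (elim insertE emptyE; hypsubst; simp only: level2_simps)
qed

lemma restrict_level1: "restrict f (Pow {1..1}) = level1 (f {1}) (f {})"
  by (subst eq_level1) (auto simp del: atLeastAtMost_singleton)

lemma restrict_level2: "restrict f (Pow {1..2}) = level2 (f {1, 2}) (f {1}) (f {2}) (f {})"
  by (subst eq_level2) auto

lemma level1_inject [simp]: "level1 a b = level1 a' b' \<longleftrightarrow> a = a' \<and> b = b'"
  by (metis level1_simps)

lemma level2_inject [simp]: "level2 a b c e = level2 a' b' c' e' \<longleftrightarrow> a = a' \<and> b = b' \<and> c = c' \<and> e = e'"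
  by (metis level2_simps)

lemma sorted_list_12: "sorted_list_of_set {1, 2::nat} = [1, 2]" "sorted_list_of_set {2, 1::nat} = [1, 2]"
  by (simp_all add: insert_commute)

lemma sign_shuffle:
  "sign (shuffle_perm {2} {1}) = - 1"
  "sign (shuffle_perm {1} {2}) = 1"
  "S \<subseteq> {1, 2} \<Longrightarrow> sign (shuffle_perm S {}) = 1"
  "S \<subseteq> {1, 2} \<Longrightarrow> sign (shuffle_perm {} S) = 1"
proof -
  have c: "{y. (y = 2 \<or> y = 1) \<and> y < (2::nat)} = {1}" "{y. (y = 1 \<or> y = 2) \<and> y < (2::nat)} = {1}"
    "{y. (y = 2 \<or> y = 1) \<and> y < (1::nat)} = {}" "{y. (y = 1 \<or> y = 2) \<and> y < (1::nat)} = {}"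
    "{y. y = n \<and> y < (n::nat)} = {}" "{y. y = 1 \<and> y = (0::nat)} = {}" "{y. y = 0 \<and> (y = 1 \<or> y = (2::nat))} = {}" "{y. y = 0 \<and> (y = 2 \<or> y = (1::nat))} = {}" for n
    by auto
  have "shuffle_perm {2} {1} = Transposition.transpose 1 2"
    by (rule ext) (auto simp: shuffle_perm_def transpose_def c)
  then show "sign (shuffle_perm {2} {1}) = - 1" by (simp add: sign_swap_id)
  have "shuffle_perm {1} {2} = id"
    by (rule ext) (auto simp: shuffle_perm_def c)
  then show "sign (shuffle_perm {1} {2}) = 1" by (simp add: sign_id)
  {
    fix S :: "nat set" assume S: "S \<subseteq> {1, 2}"
    have "S = {} \<or> S = {1} \<or> S = {2} \<or> S = {1, 2}" using S by auto
    then have "shuffle_perm S {} = id" "shuffle_perm {} S = id"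
      by (auto simp: shuffle_perm_def c sorted_list_12 fun_eq_iff)
    then show "sign (shuffle_perm S {}) = 1" "sign (shuffle_perm {} S) = 1" by (simp_all add: sign_id)
  }
qed

context dg begin

lemma D1_iff: "level1 a b \<in> carrier (denorm B 1) \<longleftrightarrow> a \<in> gr B 0 \<and> b \<in> gr B 1"
proof -
  have d: "1 - card {} = (1::nat)" "1 - card {1::nat} = 0"
    by simp_all
  have "level1 a b \<in> carrier (denorm B 1) \<longleftrightarrow> (\<forall>I \<in> Pow {1..1}. level1 a b I \<in> gr B (1 - card I))"
    by (simp add: denorm_def denorm_carrier_def PiE_iff level1_def del: Pow_iff atLeastAtMost_singleton)
  then show ?thesis
    unfolding Pow_1 by (simp only: ball_simps level1_simps d simp_thms) blast
qed

lemma D2_iff: "level2 a b c e \<in> carrier (denorm B 2) \<longleftrightarrow> a \<in> gr B 0 \<and> b \<in> gr B 1 \<and> c \<in> gr B 1 \<and> e \<in> gr B 2"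
proof -
  have d: "2 - card {} = (2::nat)" "2 - card {1::nat} = 1" "2 - card {2::nat} = 1" "2 - card {1, 2::nat} = 0"
    by simp_all
  have "level2 a b c e \<in> carrier (denorm B 2) \<longleftrightarrow> (\<forall>I \<in> Pow {1..2}. level2 a b c e I \<in> gr B (2 - card I))"
    by (simp add: denorm_def denorm_carrier_def PiE_iff level2_def)
  then show ?thesis
    unfolding Pow_2 by (simp only: ball_simps level2_simps d simp_thms) blast
qed

lemma D1_cases:
  assumes "x \<in> carrier (denorm B 1)"
  obtains a b where "x = level1 a b" "a \<in> gr B 0" "b \<in> gr B 1"
proof -
  have "x = level1 (x {1}) (x {})"
    by (rule eq_level1) (use assms in \<open>auto simp: denorm_def denorm_carrier_def PiE_iff\<close>)
  then show ?thesis using that assms D1_iff by metis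
qed

lemma D2_cases:
  assumes "x \<in> carrier (denorm B 2)"
  obtains a b c e where "x = level2 a b c e" "a \<in> gr B 0" "b \<in> gr B 1" "c \<in> gr B 1" "e \<in> gr B 2"
proof -
  have "x = level2 (x {1, 2}) (x {1}) (x {2}) (x {})"
    by (rule eq_level2) (use assms in \<open>auto simp: denorm_def denorm_carrier_def PiE_iff\<close>)
  then show ?thesis using that assms D2_iff by metis
qed

lemma finsum_Pow_1:
  assumes "\<And>I. I \<in> Pow {1..1} \<Longrightarrow> f I \<in> carrier B"
  shows "(\<Oplus>\<^bsub>B\<^esub>I \<in> Pow {1..1::nat}. f I) = f {} \<oplus>\<^bsub>B\<^esub> f {1}"
  using assms unfolding Pow_1 by simp

lemma finsum_Pow_2:
  assumes "\<And>I. I \<in> Pow {1..2} \<Longrightarrow> f I \<in> carrier B"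
  shows "(\<Oplus>\<^bsub>B\<^esub>I \<in> Pow {1..2::nat}. f I) = f {} \<oplus>\<^bsub>B\<^esub> (f {1} \<oplus>\<^bsub>B\<^esub> (f {2} \<oplus>\<^bsub>B\<^esub> f {1, 2}))"
  using assms unfolding Pow_2 by (simp add: doubleton_eq_iff)

lemma dpart_closed: "\<lbrakk>a \<in> carrier B; K \<in> Pow {1..n}\<rbrakk> \<Longrightarrow> dpart B n I a K \<in> carrier B"
  by (simp add: dpart_def)

lemma dmp_closed: "\<lbrakk>a \<in> carrier B; b \<in> carrier B; K \<in> Pow {1..n}\<rbrakk> \<Longrightarrow> denorm_mult_part B n I J a b K \<in> carrier B"
  by (simp add: denorm_mult_part_def dpart_closed)

lemma one_add_pow: "a \<in> carrier B \<Longrightarrow> [(1::int)] \<cdot>\<^bsub>B\<^esub> a = a" "a \<in> carrier B \<Longrightarrow> [(- 1::int)] \<cdot>\<^bsub>B\<^esub> a = \<ominus>\<^bsub>B\<^esub> a"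
  using B.sign_pow_add_pow[of a 0] B.sign_pow_add_pow[of a 1] by simp_all

lemma D1_ops:
  shows D1_zero: "\<zero>\<^bsub>denorm B 1\<^esub> = level1 \<zero>\<^bsub>B\<^esub> \<zero>\<^bsub>B\<^esub>"
    and D1_one: "\<one>\<^bsub>denorm B 1\<^esub> = level1 \<one>\<^bsub>B\<^esub> \<zero>\<^bsub>B\<^esub>"
    and D1_add: "level1 a b \<oplus>\<^bsub>denorm B 1\<^esub> level1 a' b' = level1 (a \<oplus>\<^bsub>B\<^esub> a') (b \<oplus>\<^bsub>B\<^esub> b')"
  by (auto simp: denorm_def dpart_def level1_def fun_eq_iff Pow_1[unfolded Pow_def] restrict_def)

lemma D1_mult:
  assumes "a \<in> carrier B" "b \<in> carrier B" "a' \<in> carrier B" "b' \<in> carrier B"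
  shows "level1 a b \<otimes>\<^bsub>denorm B 1\<^esub> level1 a' b' = level1 (a \<otimes>\<^bsub>B\<^esub> a') (a \<otimes>\<^bsub>B\<^esub> b' \<oplus>\<^bsub>B\<^esub> b \<otimes>\<^bsub>B\<^esub> a')"
proof -
  let ?m = "denorm_mult_part B 1"
  have v: "level1 a b I \<in> carrier B" "level1 a' b' I \<in> carrier B" if "I \<in> Pow {1..1}" for I
    using that assms unfolding Pow_1 by auto
  have t: "(\<Oplus>\<^bsub>B\<^esub>I \<in> Pow {1..1}. \<Oplus>\<^bsub>B\<^esub>J \<in> Pow {1..1}. ?m I J (level1 a b I) (level1 a' b' J) K) =
     (?m {} {} b b' K \<oplus>\<^bsub>B\<^esub> ?m {} {1} b a' K) \<oplus>\<^bsub>B\<^esub> (?m {1} {} a b' K \<oplus>\<^bsub>B\<^esub> ?m {1} {1} a a' K)"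
    if K: "K \<in> Pow {1..1}" for K
  proof -
    have t1: "(\<Oplus>\<^bsub>B\<^esub>J \<in> Pow {1..1}. ?m I J s (level1 a' b' J) K) = ?m I {} s b' K \<oplus>\<^bsub>B\<^esub> ?m I {1} s a' K"
      if "s \<in> carrier B" for I s
      by (subst finsum_Pow_1) (use v that K in \<open>auto intro!: dmp_closed simp del: Pow_iff atLeastAtMost_singleton\<close>)
    show ?thesis
      by (subst finsum_Pow_1)
        (use v K assms in \<open>auto intro!: dmp_closed B.finsum_closed simp: t1 simp del: Pow_iff atLeastAtMost_singleton\<close>)
  qed
  have p: "?m {} {} b b' = dpart B 1 {} \<zero>\<^bsub>B\<^esub>" "?m {} {1} b a' = dpart B 1 {} (b \<otimes>\<^bsub>B\<^esub> a')"
    "?m {1} {} a b' = dpart B 1 {} (a \<otimes>\<^bsub>B\<^esub> b')" "?m {1} {1} a a' = dpart B 1 {1} (a \<otimes>\<^bsub>B\<^esub> a')"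
    using assms by (simp_all add: denorm_mult_part_def sign_shuffle one_add_pow)
  have m: "level1 a b \<otimes>\<^bsub>denorm B 1\<^esub> level1 a' b' = (\<lambda>K \<in> Pow {1..1}. (?m {} {} b b' K \<oplus>\<^bsub>B\<^esub> ?m {} {1} b a' K) \<oplus>\<^bsub>B\<^esub> (?m {1} {} a b' K \<oplus>\<^bsub>B\<^esub> ?m {1} {1} a a' K))"
    (is "_ = ?r")
    unfolding denorm_def monoid.simps by (rule restrict_ext) (rule t)
  note m
  also have "?r = level1 ((?m {} {} b b' {1} \<oplus>\<^bsub>B\<^esub> ?m {} {1} b a' {1}) \<oplus>\<^bsub>B\<^esub> (?m {1} {} a b' {1} \<oplus>\<^bsub>B\<^esub> ?m {1} {1} a a' {1}))
     ((?m {} {} b b' {} \<oplus>\<^bsub>B\<^esub> ?m {} {1} b a' {}) \<oplus>\<^bsub>B\<^esub> (?m {1} {} a b' {} \<oplus>\<^bsub>B\<^esub> ?m {1} {1} a a' {}))"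
    by (rule restrict_level1)
  also have "\<dots> = level1 (a \<otimes>\<^bsub>B\<^esub> a') (a \<otimes>\<^bsub>B\<^esub> b' \<oplus>\<^bsub>B\<^esub> b \<otimes>\<^bsub>B\<^esub> a')"
    using assms unfolding p by (simp add: dpart_def B.a_comm)
  finally show ?thesis .
qed

lemma D2_ops:
  shows D2_zero: "\<zero>\<^bsub>denorm B 2\<^esub> = level2 \<zero>\<^bsub>B\<^esub> \<zero>\<^bsub>B\<^esub> \<zero>\<^bsub>B\<^esub> \<zero>\<^bsub>B\<^esub>" (is ?z)
    and D2_one: "\<one>\<^bsub>denorm B 2\<^esub> = level2 \<one>\<^bsub>B\<^esub> \<zero>\<^bsub>B\<^esub> \<zero>\<^bsub>B\<^esub> \<zero>\<^bsub>B\<^esub>" (is ?o)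
    and D2_add: "level2 a b c e \<oplus>\<^bsub>denorm B 2\<^esub> level2 a' b' c' e' =
      level2 (a \<oplus>\<^bsub>B\<^esub> a') (b \<oplus>\<^bsub>B\<^esub> b') (c \<oplus>\<^bsub>B\<^esub> c') (e \<oplus>\<^bsub>B\<^esub> e')" (is ?a)
proof -
  have i: "{1..2::nat} = {1, 2}" by auto
  have z: "\<zero>\<^bsub>denorm B 2\<^esub> = dpart B 2 {} \<zero>\<^bsub>B\<^esub>" and o: "\<one>\<^bsub>denorm B 2\<^esub> = dpart B 2 {1, 2} \<one>\<^bsub>B\<^esub>"
    and a: "level2 a b c e \<oplus>\<^bsub>denorm B 2\<^esub> level2 a' b' c' e' = (\<lambda>K \<in> Pow {1..2}. level2 a b c e K \<oplus>\<^bsub>B\<^esub> level2 a' b' c' e' K)"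
    by (simp_all add: denorm_def i)
  show ?z unfolding z by (subst eq_level2) (auto simp: dpart_def)
  show ?o unfolding o by (subst eq_level2) (auto simp: dpart_def)
  show ?a unfolding a by (subst eq_level2) auto
qed

lemma D2_mult:
  assumes "a \<in> carrier B" "b \<in> carrier B" "c \<in> carrier B" "e \<in> carrier B"
    "a' \<in> carrier B" "b' \<in> carrier B" "c' \<in> carrier B" "e' \<in> carrier B"
  shows "level2 a b c e \<otimes>\<^bsub>denorm B 2\<^esub> level2 a' b' c' e' =
    level2 (a \<otimes>\<^bsub>B\<^esub> a') (a \<otimes>\<^bsub>B\<^esub> b' \<oplus>\<^bsub>B\<^esub> b \<otimes>\<^bsub>B\<^esub> a') (a \<otimes>\<^bsub>B\<^esub> c' \<oplus>\<^bsub>B\<^esub> c \<otimes>\<^bsub>B\<^esub> a')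
      ((a \<otimes>\<^bsub>B\<^esub> e' \<oplus>\<^bsub>B\<^esub> e \<otimes>\<^bsub>B\<^esub> a') \<oplus>\<^bsub>B\<^esub> (c \<otimes>\<^bsub>B\<^esub> b' \<ominus>\<^bsub>B\<^esub> b \<otimes>\<^bsub>B\<^esub> c'))"
proof -
  let ?m = "denorm_mult_part B 2"
  let ?x = "level2 a b c e" and ?y = "level2 a' b' c' e'"
  have v: "?x I \<in> carrier B" "?y I \<in> carrier B" if "I \<in> Pow {1..2}" for I
    using that assms unfolding Pow_2 by (auto simp: level2_def)
  \<comment> \<open>The sixteen summands of the product, grouped by the index set of the left factor.\<close>
  let ?i = "\<lambda>I a K. ?m I {} a e' K \<oplus>\<^bsub>B\<^esub> (?m I {1} a b' K \<oplus>\<^bsub>B\<^esub> (?m I {2} a c' K \<oplus>\<^bsub>B\<^esub> ?m I {1, 2} a a' K))"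
  let ?o = "\<lambda>K. ?i {} e K \<oplus>\<^bsub>B\<^esub> (?i {1} b K \<oplus>\<^bsub>B\<^esub> (?i {2} c K \<oplus>\<^bsub>B\<^esub> ?i {1, 2} a K))"
  have t1: "(\<Oplus>\<^bsub>B\<^esub>J \<in> Pow {1..2}. ?m I J s (?y J) K) = ?i I s K"
    if "K \<in> Pow {1..2}" "s \<in> carrier B" for I K s
    by (subst finsum_Pow_2) (use v that in \<open>auto intro!: dmp_closed simp del: Pow_iff\<close>)
  have t: "(\<Oplus>\<^bsub>B\<^esub>I \<in> Pow {1..2}. \<Oplus>\<^bsub>B\<^esub>J \<in> Pow {1..2}. ?m I J (?x I) (?y J) K) = ?o K"
    if K: "K \<in> Pow {1..2}" for K
    by (subst finsum_Pow_2) (use v K assms in \<open>auto intro!: dmp_closed B.finsum_closed simp: t1 simp del: Pow_iff\<close>)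
  have p: "?m {} {} e e' = dpart B 2 {} \<zero>\<^bsub>B\<^esub>" "?m {} {1} e b' = dpart B 2 {} \<zero>\<^bsub>B\<^esub>"
    "?m {} {2} e c' = dpart B 2 {} \<zero>\<^bsub>B\<^esub>" "?m {} {1, 2} e a' = dpart B 2 {} (e \<otimes>\<^bsub>B\<^esub> a')"
    "?m {1} {} b e' = dpart B 2 {} \<zero>\<^bsub>B\<^esub>" "?m {1} {1} b b' = dpart B 2 {} \<zero>\<^bsub>B\<^esub>"
    "?m {1} {2} b c' = dpart B 2 {} (\<ominus>\<^bsub>B\<^esub> (b \<otimes>\<^bsub>B\<^esub> c'))" "?m {1} {1, 2} b a' = dpart B 2 {1} (b \<otimes>\<^bsub>B\<^esub> a')"
    "?m {2} {} c e' = dpart B 2 {} \<zero>\<^bsub>B\<^esub>" "?m {2} {1} c b' = dpart B 2 {} (c \<otimes>\<^bsub>B\<^esub> b')"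
    "?m {2} {2} c c' = dpart B 2 {} \<zero>\<^bsub>B\<^esub>" "?m {2} {1, 2} c a' = dpart B 2 {2} (c \<otimes>\<^bsub>B\<^esub> a')"
    "?m {1, 2} {} a e' = dpart B 2 {} (a \<otimes>\<^bsub>B\<^esub> e')" "?m {1, 2} {1} a b' = dpart B 2 {1} (a \<otimes>\<^bsub>B\<^esub> b')"
    "?m {1, 2} {2} a c' = dpart B 2 {2} (a \<otimes>\<^bsub>B\<^esub> c')" "?m {1, 2} {1, 2} a a' = dpart B 2 {1, 2} (a \<otimes>\<^bsub>B\<^esub> a')"
    using assms by (simp_all add: denorm_mult_part_def sign_shuffle one_add_pow insert_Diff_if)
  have m: "?x \<otimes>\<^bsub>denorm B 2\<^esub> ?y = restrict ?o (Pow {1..2})"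
    unfolding denorm_def monoid.simps by (rule restrict_ext) (rule t)
  have "restrict ?o (Pow {1..2}) = level2 (?o {1, 2}) (?o {1}) (?o {2}) (?o {})"
    by (rule restrict_level2)
  also have "\<dots> = level2 (a \<otimes>\<^bsub>B\<^esub> a') (a \<otimes>\<^bsub>B\<^esub> b' \<oplus>\<^bsub>B\<^esub> b \<otimes>\<^bsub>B\<^esub> a') (a \<otimes>\<^bsub>B\<^esub> c' \<oplus>\<^bsub>B\<^esub> c \<otimes>\<^bsub>B\<^esub> a')
      ((a \<otimes>\<^bsub>B\<^esub> e' \<oplus>\<^bsub>B\<^esub> e \<otimes>\<^bsub>B\<^esub> a') \<oplus>\<^bsub>B\<^esub> (c \<otimes>\<^bsub>B\<^esub> b' \<ominus>\<^bsub>B\<^esub> b \<otimes>\<^bsub>B\<^esub> c'))"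
    using assms unfolding p by (simp add: dpart_def doubleton_eq_iff B.a_ac B.minus_eq)
  finally show ?thesis using m by simp
qed

lemma D1_ring: "ring (denorm B 1)"
proof (rule ringI)
  show "abelian_group (denorm B 1)"
  proof (rule abelian_groupI; (elim D1_cases)?; hypsubst?)
    fix a b assume "a \<in> gr B 0" "b \<in> gr B 1"
    then show "\<exists>y \<in> carrier (denorm B 1). y \<oplus>\<^bsub>denorm B 1\<^esub> level1 a b = \<zero>\<^bsub>denorm B 1\<^esub>"
      by (intro bexI[of _ "level1 (\<ominus>\<^bsub>B\<^esub> a) (\<ominus>\<^bsub>B\<^esub> b)"]) (simp_all add: D1_ops D1_iff gr_minus gr_carrier B.l_neg)
  qed (simp_all add: D1_ops D1_iff gr_add gr_zero gr_carrier B.a_ac)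
  show "monoid (denorm B 1)"
    by (rule monoidI; (elim D1_cases)?; hypsubst?)
      (simp_all add: D1_ops D1_iff D1_mult gr_add gr_zero gr_one gr_mult0 gr_carrier B.l_distr B.r_distr B.m_assoc B.a_assoc)
qed ((elim D1_cases; hypsubst; simp add: D1_ops D1_iff D1_mult gr_add gr_zero gr_one gr_mult0 gr_carrier B.l_distr B.r_distr B.a_ac)+)

lemma D2_ring: "ring (denorm B 2)"
proof (rule ringI)
  show "abelian_group (denorm B 2)"
  proof (rule abelian_groupI; (elim D2_cases)?; hypsubst?)
    fix a b c e assume "a \<in> gr B 0" "b \<in> gr B 1" "c \<in> gr B 1" "e \<in> gr B 2"
    then show "\<exists>y \<in> carrier (denorm B 2). y \<oplus>\<^bsub>denorm B 2\<^esub> level2 a b c e = \<zero>\<^bsub>denorm B 2\<^esub>"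
      by (intro bexI[of _ "level2 (\<ominus>\<^bsub>B\<^esub> a) (\<ominus>\<^bsub>B\<^esub> b) (\<ominus>\<^bsub>B\<^esub> c) (\<ominus>\<^bsub>B\<^esub> e)"])
        (simp_all add: D2_ops D2_iff gr_minus gr_carrier B.l_neg)
  qed (simp_all add: D2_ops D2_iff gr_add gr_zero gr_carrier B.a_ac)
  show "monoid (denorm B 2)"
    by (rule monoidI; (elim D2_cases)?; hypsubst?)
      (simp_all add: D2_ops D2_iff D2_mult gr_add gr_zero gr_one gr_mult0 gr_mult11 gr_minus gr_carrier B.minus_eq
        B.l_distr B.r_distr B.m_assoc B.a_ac B.minus_add B.l_minus B.r_minus)
qed ((elim D2_cases; hypsubst; simp add: D2_ops D2_iff D2_mult gr_add gr_zero gr_one gr_mult0 gr_mult11 gr_minus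
   gr_carrier B.minus_eq B.l_distr B.r_distr B.a_ac B.minus_add)+)

lemma coface0_eq:
  assumes "a \<in> gr B 0"
  shows coface0_0: "coface0 B 0 a = level1 a (diff B a)"
    and coface0_1: "coface0 B 1 a = level1 a \<zero>\<^bsub>B\<^esub>"
proof -
  have P: "Pow {1..0::nat} = {{}}" by simp
  have i: "{1..Suc 0} = {1}" by auto
  have n: "Suc 0 = 1" by simp
  have a: "a \<in> carrier B" "diff B a \<in> carrier B" using assms gr_carrier d_closed by auto
  have c: "coface_part B 0 j {} a K \<in> carrier B" if "K \<in> Pow {1..1}" for K j
    using that a unfolding coface_part_def n by (auto intro!: B.minus_closed dpart_closed B.finsum_closed simp del: Pow_iff)
  have e: "coface0 B j a = level1 (coface_part B 0 j {} a {1}) (coface_part B 0 j {} a {})" for j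
    unfolding coface0_def coface_def P n
    by (subst eq_level1) (use c[of "{}"] c[of "{1}"] in \<open>auto simp: dpart_def\<close>)
  show "coface0 B 0 a = level1 a (diff B a)" unfolding e coface_part_def n
    using a by (simp add: dpart_def i one_add_pow B.minus_eq d_closed)
  show "coface0 B 1 a = level1 a \<zero>\<^bsub>B\<^esub>" unfolding e coface_part_def n
    using a by (simp add: dpart_def coface_ins_def)
qed

lemma coface_eq:
  assumes "a \<in> gr B 0" "b \<in> gr B 1"
  shows coface_0: "coface B 1 0 (level1 a b) = level2 a b (diff B a \<ominus>\<^bsub>B\<^esub> b) (diff B b)"
    and coface_1: "coface B 1 1 (level1 a b) = level2 a b \<zero>\<^bsub>B\<^esub> \<zero>\<^bsub>B\<^esub>"
    and coface_2: "coface B 1 2 (level1 a b) = level2 a \<zero>\<^bsub>B\<^esub> b \<zero>\<^bsub>B\<^esub>"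
proof -
  have i: "{1..Suc 1} = {1, 2}" by auto
  have n: "Suc 1 = 2" by simp
  have a: "a \<in> carrier B" "diff B a \<in> carrier B" "b \<in> carrier B" "diff B b \<in> carrier B"
    using assms gr_carrier d_closed by auto
  have c: "coface_part B 1 j I s K \<in> carrier B" if "K \<in> Pow {1..2}" "s \<in> carrier B" for K j I s
    using that d_closed unfolding coface_part_def n by (auto intro!: B.minus_closed dpart_closed B.finsum_closed simp del: Pow_iff)
  have e: "coface B 1 j (level1 a b) = (\<lambda>K \<in> Pow {1..2}. coface_part B 1 j {} b K \<oplus>\<^bsub>B\<^esub> coface_part B 1 j {1} a K)" for j
    unfolding coface_def n
    by (rule restrict_ext, subst finsum_Pow_1) (use c a in \<open>auto simp: Pow_1 level1_def simp del: Pow_iff\<close>)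
  have e': "coface B 1 j (level1 a b) = level2 (coface_part B 1 j {} b {1, 2} \<oplus>\<^bsub>B\<^esub> coface_part B 1 j {1} a {1, 2})
      (coface_part B 1 j {} b {1} \<oplus>\<^bsub>B\<^esub> coface_part B 1 j {1} a {1})
      (coface_part B 1 j {} b {2} \<oplus>\<^bsub>B\<^esub> coface_part B 1 j {1} a {2})
      (coface_part B 1 j {} b {} \<oplus>\<^bsub>B\<^esub> coface_part B 1 j {1} a {})" for j
    unfolding e by (subst eq_level2) auto
  have im: "coface_ins 1 {} = {1}" "coface_ins 1 {1} = {1, 2}" "coface_ins 2 {} = {2}" "coface_ins 2 {1} = {1, 2}"
    by (auto simp: coface_ins_def)
  have S: "{1..1::nat} = {1}" "Suc ` {1} = {2}" "Suc 0 = 1" by auto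
  show "coface B 1 0 (level1 a b) = level2 a b (diff B a \<ominus>\<^bsub>B\<^esub> b) (diff B b)" unfolding e' coface_part_def n
    using a by (simp add: dpart_def i[unfolded n] one_add_pow B.minus_eq S im doubleton_eq_iff B.minus_add B.a_ac)
  show "coface B 1 1 (level1 a b) = level2 a b \<zero>\<^bsub>B\<^esub> \<zero>\<^bsub>B\<^esub>" "coface B 1 2 (level1 a b) = level2 a \<zero>\<^bsub>B\<^esub> b \<zero>\<^bsub>B\<^esub>"
    unfolding e' coface_part_def n
    using a by (simp_all add: dpart_def im doubleton_eq_iff)
qed

lemma coface0_hom: "i \<in> {0, 1} \<Longrightarrow> coface0 B i \<in> ring_hom (deg0 B) (denorm B 1)"
  by (rule ring_hom_memI)
    (auto simp: coface0_eq D1_iff D1_ops D1_mult gr_carrier gr_zero gr_one gr_mult0 gr_add d_gr0 d_closed d_add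
      d_one leibniz B.a_comm)

lemma coface_hom: "j \<in> {0, 1, 2} \<Longrightarrow> coface B 1 j \<in> ring_hom (denorm B 1) (denorm B 2)"
proof (rule ring_hom_memI; (elim D1_cases)?; hypsubst?)
  assume "j \<in> {0, 1, 2}"
  fix a b a' b' assume "a \<in> gr B 0" "b \<in> gr B 1" "a' \<in> gr B 0" "b' \<in> gr B 1"
  then show "coface B 1 j (level1 a b \<otimes>\<^bsub>denorm B 1\<^esub> level1 a' b') =
      coface B 1 j (level1 a b) \<otimes>\<^bsub>denorm B 2\<^esub> coface B 1 j (level1 a' b')"
    using \<open>j \<in> {0, 1, 2}\<close>
    by (auto simp: D1_mult D2_mult coface_eq gr_carrier gr_mult0 gr_add d_add d_closed leibniz[of _ 0] leibniz[of _ 1]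
       B.minus_eq B.l_distr B.r_distr B.minus_add B.l_minus B.r_minus B.a_ac B.r_neg1 B.r_neg2)
qed (auto simp: coface_eq D1_iff D2_iff D1_ops D2_ops gr_carrier gr_zero gr_one gr_mult0 gr_add gr_minus d_gr0 d_gr1
      d_closed d_add d_one d_zero B.minus_eq B.minus_add B.a_ac B.add.inv_one)

lemma coface_identities:
  assumes "a \<in> gr B 0"
  shows "coface B 1 1 (coface0 B 0 a) = coface B 1 0 (coface0 B 0 a)"
    "coface B 1 0 (coface0 B 1 a) = coface B 1 2 (coface0 B 0 a)"
    "coface B 1 2 (coface0 B 1 a) = coface B 1 1 (coface0 B 1 a)"
    "coface B 1 1 (coface0 B 1 a) = level2 a \<zero>\<^bsub>B\<^esub> \<zero>\<^bsub>B\<^esub> \<zero>\<^bsub>B\<^esub>"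
  using assms by (simp_all add: coface0_eq coface_eq gr_zero gr_carrier d_gr0 d_closed d_d d_zero B.minus_eq B.r_neg)

end

section \<open>Connection forms and flat connections\<close>

text \<open>The reduction \<open>S \<otimes> M \<rightarrow> M\<close> along a retraction \<open>\<epsilon>\<close> of \<open>\<phi>\<close>.\<close>

definition augment ::
  "('a, 'p) ring_scheme \<Rightarrow> ('s, 'q) ring_scheme \<Rightarrow> ('a \<Rightarrow> 's) \<Rightarrow> ('a, 'm, 't) module_scheme
    \<Rightarrow> ('s \<Rightarrow> 'a) \<Rightarrow> ('s \<times> 'm \<Rightarrow>\<^sub>0 int) set \<Rightarrow> 'm" where
  "augment R S \<phi> M \<epsilon> = tensor_lift R S \<phi> M (add_monoid M) (\<lambda>s m. \<epsilon> s \<odot>\<^bsub>M\<^esub> m)"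

lemma (in tensor) augment_props:
  assumes e: "\<epsilon> \<in> ring_hom S R" and sec: "\<And>a. a \<in> carrier R \<Longrightarrow> \<epsilon> (\<phi> a) = a"
  shows augment_additive: "augment R S \<phi> M \<epsilon> \<in> additive T M"
    and augment_ten: "\<lbrakk>s \<in> carrier S; m \<in> carrier M\<rbrakk> \<Longrightarrow> augment R S \<phi> M \<epsilon> (s \<otimes>t m) = \<epsilon> s \<odot>\<^bsub>M\<^esub> m"
    and augment_smult: "\<lbrakk>s \<in> carrier S; t \<in> carrier T\<rbrakk>
      \<Longrightarrow> augment R S \<phi> M \<epsilon> (s \<odot>\<^bsub>T\<^esub> t) = \<epsilon> s \<odot>\<^bsub>M\<^esub> augment R S \<phi> M \<epsilon> t"
proof -
  have ea: "\<epsilon> \<in> additive S R" using e by (auto simp: ring_hom_def additive_def)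
  note ec = additive_closed[OF ea]
  have em: "\<epsilon> (s \<otimes>\<^bsub>S\<^esub> t) = \<epsilon> s \<otimes>\<^bsub>R\<^esub> \<epsilon> t" if "s \<in> carrier S" "t \<in> carrier S" for s t
    using e that by (auto simp: ring_hom_def)
  have "balanced R S \<phi> M M (\<lambda>s m. \<epsilon> s \<odot>\<^bsub>M\<^esub> m)"
    using additive_comp[OF ea smult_additive_left] smult_additive[OF ec]
    by (simp add: balanced_def em \<phi>_closed sec smult_assoc ec)
  note * = lift_props[OF M.abelian_group_axioms this, of "add_monoid M", folded augment_def]
  show 1: "augment R S \<phi> M \<epsilon> \<in> additive T M"
    and 2: "s \<in> carrier S \<Longrightarrow> m \<in> carrier M \<Longrightarrow> augment R S \<phi> M \<epsilon> (s \<otimes>t m) = \<epsilon> s \<odot>\<^bsub>M\<^esub> m" for s m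
    using * by simp_all
  show "augment R S \<phi> M \<epsilon> (s \<odot>\<^bsub>T\<^esub> t) = \<epsilon> s \<odot>\<^bsub>M\<^esub> augment R S \<phi> M \<epsilon> t" if s: "s \<in> carrier S" and t: "t \<in> carrier T"
    by (rule additive_eqI[OF additive_comp[OF T_smult_additive[OF s] 1]
          additive_comp[OF 1 smult_additive[OF ec[OF s]]] M.abelian_group_axioms _ t])
      (use s in \<open>simp add: smult_ten 2 em smult_assoc ec\<close>)
qed

context dg begin

lemma hcomp_closed: "a \<in> carrier B \<Longrightarrow> hcomp p a \<in> carrier B"
  using gr_carrier hcomp_gr by blast

lemma hcomp_zero: "hcomp p \<zero>\<^bsub>B\<^esub> = \<zero>\<^bsub>B\<^esub>"
  using hcomp_homogeneous[OF gr_zero, of p p] by simp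

lemma hcomp_mult_left:
  assumes "b \<in> carrier B" "a \<in> gr B p"
  shows "hcomp (p + q) (a \<otimes>\<^bsub>B\<^esub> b) = a \<otimes>\<^bsub>B\<^esub> hcomp q b"
  using assms(1)
proof (induction rule: homogeneous_induct)
  case zero then show ?case using gr_carrier[OF assms(2)] by (simp add: hcomp_zero)
next
  case (add b b') then show ?case using gr_carrier[OF assms(2)] by (simp add: B.r_distr hcomp_add hcomp_closed)
next
  case (gr r b)
  then show ?case
    using gr_mult[OF assms(2) gr] gr_carrier[OF assms(2)] by (auto simp: hcomp_homogeneous)
qed

lemma bar_mult:
  assumes "a \<in> carrier B" "b \<in> carrier B"
  shows "bar (a \<otimes>\<^bsub>B\<^esub> b) = bar a \<otimes>\<^bsub>B\<^esub> bar b"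
  using assms(1)
proof (induction rule: homogeneous_induct)
  case zero then show ?case using assms(2) by (simp add: bar_zero bar_closed)
next
  case (add a a') then show ?case using assms(2) by (simp add: B.l_distr bar_add bar_closed)
next
  case a: (gr p a)
  show ?case using assms(2)
  proof (induction rule: homogeneous_induct)
    case zero then show ?case using a by (simp add: bar_zero bar_closed gr_carrier)
  next
    case (add b b') then show ?case using a by (simp add: B.r_distr bar_add bar_closed gr_carrier)
  next
    case (gr q b)
    then show ?case
      using a gr_mult[OF a gr] by (auto simp: bar_homogeneous gr_carrier B.l_minus B.r_minus)
  qed
qed

lemma bar_d:
  assumes "a \<in> carrier B" shows "bar (diff B a) = \<ominus>\<^bsub>B\<^esub> diff B (bar a)"
  using assms
proof (induction rule: homogeneous_induct)
  case zero then show ?case by (simp add: bar_zero d_zero B.add.inv_one)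
next
  case (add a a') then show ?case by (simp add: d_add bar_add bar_closed d_closed B.minus_add)
next
  case (gr p a) then show ?case
    using d_gr[OF gr] by (simp add: bar_homogeneous gr_carrier d_closed d_minus)
qed

end

locale dg_module = dg R B
  for R :: "('r, 'x) ring_scheme" and B :: "('r, 'b, 'y) dg_alg_scheme" +
  fixes M :: "('b, 'm) module"
  assumes M_module: "module (deg0 B) M"
begin

abbreviation "D1 \<equiv> denorm B 1"
abbreviation "D2 \<equiv> denorm B 2"

sublocale M: lmod "deg0 B" M
  by (rule module_imp_lmod[OF M_module])

sublocale C: cosimplicial_rings "deg0 B" D1 D2 "coface0 B" "coface B 1" M
  by (intro cosimplicial_rings.intro cosimplicial_rings_axioms.intro M.lmod_axioms D1_ring D2_ring)
    (auto simp: coface0_hom coface_hom coface_identities)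

sublocale F: tensor "deg0 B" B "\<lambda>b. b" M
  by (intro tensor.intro tensor_axioms.intro M.lmod_axioms B.ring_axioms ring_hom_memI)
    (auto simp: gr_carrier)

abbreviation ft (infixl \<open>\<otimes>f\<close> 75) where "b \<otimes>f m \<equiv> tens (deg0 B) B (\<lambda>b. b) M b m"

lemma form_gr_eq: "form_gr B M p = generate (add_monoid F.T) {b \<otimes>f m | b m. b \<in> gr B p \<and> m \<in> carrier M}"
  by (simp add: form_gr_def form_module_def form_def)

lemma form_gr_induct [consumes 1, case_names zero add minus ten]:
  assumes t: "t \<in> form_gr B M p" and "P \<zero>\<^bsub>F.T\<^esub>"
    and "\<And>x y. \<lbrakk>x \<in> carrier F.T; y \<in> carrier F.T; P x; P y\<rbrakk> \<Longrightarrow> P (x \<oplus>\<^bsub>F.T\<^esub> y)"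
    and m: "\<And>x. \<lbrakk>x \<in> carrier F.T; P x\<rbrakk> \<Longrightarrow> P (\<ominus>\<^bsub>F.T\<^esub> x)"
    and ten: "\<And>b m. \<lbrakk>b \<in> gr B p; m \<in> carrier M\<rbrakk> \<Longrightarrow> P (b \<otimes>f m)"
  shows "P t"
proof -
  have "t \<in> carrier F.T \<and> P t"
    using t unfolding form_gr_eq
  proof (induction rule: generate.induct)
    case (inv h)
    then obtain b m where h: "h = b \<otimes>f m" "b \<in> gr B p" "m \<in> carrier M" by auto
    then have "h \<in> carrier F.T" by (simp add: F.ten_closed gr_carrier)
    then show ?case using h m ten by (simp flip: a_inv_def)
  qed (use assms in \<open>auto simp: F.ten_closed gr_carrier\<close>)
  then show ?thesis by simp
qed

lemma form_gr_closed: "t \<in> form_gr B M p \<Longrightarrow> t \<in> carrier F.T"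
  by (induction rule: form_gr_induct) (auto simp: F.ten_closed gr_carrier)

lemma form_gr_ten: "\<lbrakk>b \<in> gr B p; m \<in> carrier M\<rbrakk> \<Longrightarrow> b \<otimes>f m \<in> form_gr B M p"
  unfolding form_gr_eq by (rule generate.incl) auto

lemma form_gr_zero: "\<zero>\<^bsub>F.T\<^esub> \<in> form_gr B M p"
  using generate.one[of "add_monoid F.T"] unfolding form_gr_eq by simp

lemma form_gr_add: "\<lbrakk>s \<in> form_gr B M p; t \<in> form_gr B M p\<rbrakk> \<Longrightarrow> s \<oplus>\<^bsub>F.T\<^esub> t \<in> form_gr B M p"
  using generate.eng[of _ "add_monoid F.T"] unfolding form_gr_eq by simp

lemma form_gr_minus: "t \<in> form_gr B M p \<Longrightarrow> \<ominus>\<^bsub>F.T\<^esub> t \<in> form_gr B M p"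
proof -
  have "{b \<otimes>f m | b m. b \<in> gr B p \<and> m \<in> carrier M} \<subseteq> carrier (add_monoid F.T)"
    by (auto simp: F.ten_closed gr_carrier)
  then show "t \<in> form_gr B M p \<Longrightarrow> \<ominus>\<^bsub>F.T\<^esub> t \<in> form_gr B M p"
    unfolding form_gr_eq a_inv_def
    by (rule group.generate_m_inv_closed[OF F.T.a_group])
qed

lemma form_gr_eqI:
  assumes "h \<in> additive F.T N" "k \<in> additive F.T N" "abelian_group N"
    and "\<And>b m. \<lbrakk>b \<in> gr B p; m \<in> carrier M\<rbrakk> \<Longrightarrow> h (b \<otimes>f m) = k (b \<otimes>f m)"
    and "t \<in> form_gr B M p"
  shows "h t = k t"
  using assms(5)
  by (induction rule: form_gr_induct)
    (simp_all add: assms(4) additive_zero[OF assms(1) F.T_abelian assms(3)]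
      additive_zero[OF assms(2) F.T_abelian assms(3)] additive_add[OF assms(1)] additive_add[OF assms(2)]
      additive_minus[OF assms(1) F.T_abelian assms(3)] additive_minus[OF assms(2) F.T_abelian assms(3)])

lemma form_gr_smult:
  assumes "b \<in> gr B p" "t \<in> form_gr B M q"
  shows "b \<odot>\<^bsub>F.T\<^esub> t \<in> form_gr B M (p + q)"
  using assms(2)
  by (induction rule: form_gr_induct)
    (use assms(1) in \<open>simp_all add: gr_carrier F.smult_ten form_gr_ten gr_mult form_gr_zero form_gr_add form_gr_minus
      F.T.smult_zero F.T.smult_r_distr F.T.smult_minus\<close>)

text \<open>The restriction of a connection to \<open>M\<close>, without a flatness condition.\<close>

definition connection_form :: "('m \<Rightarrow> ('b \<times> 'm \<Rightarrow>\<^sub>0 int) set) \<Rightarrow> bool" where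
  "connection_form \<omega> \<longleftrightarrow> \<omega> \<in> additive M F.T \<and> (\<forall>m \<in> carrier M. \<omega> m \<in> form_gr B M 1) \<and>
     (\<forall>a \<in> gr B 0. \<forall>m \<in> carrier M. \<omega> (a \<odot>\<^bsub>M\<^esub> m) = a \<odot>\<^bsub>F.T\<^esub> \<omega> m \<oplus>\<^bsub>F.T\<^esub> diff B a \<otimes>f m)"

text \<open>The covariant derivative on \<open>B \<otimes> M\<close> with connection form \<open>\<omega>\<close>.\<close>

definition cov :: "('m \<Rightarrow> ('b \<times> 'm \<Rightarrow>\<^sub>0 int) set) \<Rightarrow> ('b \<times> 'm \<Rightarrow>\<^sub>0 int) set \<Rightarrow> ('b \<times> 'm \<Rightarrow>\<^sub>0 int) set" where
  "cov \<omega> = tensor_lift (deg0 B) B (\<lambda>b. b) M (tensor_group (deg0 B) B (\<lambda>b. b) M)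
     (\<lambda>b m. diff B b \<otimes>f m \<oplus>\<^bsub>F.T\<^esub> bar b \<odot>\<^bsub>F.T\<^esub> \<omega> m)"

context
  fixes \<omega> assumes \<omega>: "connection_form \<omega>"
begin

lemma \<omega>_additive: "\<omega> \<in> additive M F.T"
  and \<omega>_gr: "m \<in> carrier M \<Longrightarrow> \<omega> m \<in> form_gr B M 1"
  and \<omega>_smult: "\<lbrakk>a \<in> gr B 0; m \<in> carrier M\<rbrakk> \<Longrightarrow> \<omega> (a \<odot>\<^bsub>M\<^esub> m) = a \<odot>\<^bsub>F.T\<^esub> \<omega> m \<oplus>\<^bsub>F.T\<^esub> diff B a \<otimes>f m"
  using \<omega> by (auto simp: connection_form_def)

lemmas \<omega>_closed = additive_closed[OF \<omega>_additive]

lemma cov_props: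
  shows cov_ext: "cov \<omega> \<in> extensional (carrier F.T)"
    and cov_additive: "cov \<omega> \<in> additive F.T F.T"
    and cov_ten: "\<lbrakk>b \<in> carrier B; m \<in> carrier M\<rbrakk>
      \<Longrightarrow> cov \<omega> (b \<otimes>f m) = diff B b \<otimes>f m \<oplus>\<^bsub>F.T\<^esub> bar b \<odot>\<^bsub>F.T\<^esub> \<omega> m"
proof -
  have "balanced (deg0 B) B (\<lambda>b. b) M F.T (\<lambda>b m. diff B b \<otimes>f m \<oplus>\<^bsub>F.T\<^esub> bar b \<odot>\<^bsub>F.T\<^esub> \<omega> m)"
    unfolding balanced_def
  proof (intro conjI ballI)
    fix m assume m: "m \<in> carrier M"
    show "(\<lambda>b. diff B b \<otimes>f m \<oplus>\<^bsub>F.T\<^esub> bar b \<odot>\<^bsub>F.T\<^esub> \<omega> m) \<in> additive B F.T"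
      by (intro additive_sum F.T_abelian additive_comp[OF d_additive F.ten_additive_left[OF m]]
          additive_comp[OF bar_additive F.T.smult_additive_left] \<omega>_closed m)
  next
    fix b assume b: "b \<in> carrier B"
    show "(\<lambda>m. diff B b \<otimes>f m \<oplus>\<^bsub>F.T\<^esub> bar b \<odot>\<^bsub>F.T\<^esub> \<omega> m) \<in> additive M F.T"
      by (intro additive_sum F.T_abelian F.ten_additive_right
          additive_comp[OF \<omega>_additive F.T_smult_additive] d_closed bar_closed b)
  next
    fix b a m assume b: "b \<in> carrier B" and a: "a \<in> carrier (deg0 B)" and m: "m \<in> carrier M"
    then have c: "a \<in> carrier B" "a \<in> gr B 0" by (auto simp: gr_carrier)
    have "diff B (b \<otimes>\<^bsub>B\<^esub> a) \<otimes>f m \<oplus>\<^bsub>F.T\<^esub> bar (b \<otimes>\<^bsub>B\<^esub> a) \<odot>\<^bsub>F.T\<^esub> \<omega> m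
      = (diff B b \<otimes>\<^bsub>B\<^esub> a) \<otimes>f m \<oplus>\<^bsub>F.T\<^esub> (bar b \<otimes>\<^bsub>B\<^esub> diff B a) \<otimes>f m \<oplus>\<^bsub>F.T\<^esub> (bar b \<otimes>\<^bsub>B\<^esub> a) \<odot>\<^bsub>F.T\<^esub> \<omega> m"
      using b c m by (simp add: leibniz_bar bar_mult0 F.ten_add_left d_closed bar_closed)
    also have "\<dots> = diff B b \<otimes>f (a \<odot>\<^bsub>M\<^esub> m) \<oplus>\<^bsub>F.T\<^esub> bar b \<odot>\<^bsub>F.T\<^esub> \<omega> (a \<odot>\<^bsub>M\<^esub> m)"
      using b c m F.ten_balanced[of "diff B b" a m]
      by (simp add: \<omega>_smult F.T.smult_r_distr F.T.smult_assoc F.T.smult_closed \<omega>_closed F.smult_ten F.ten_closed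
          M.smult_closed d_closed bar_closed F.T.a_ac)
    finally show "diff B (b \<otimes>\<^bsub>B\<^esub> a) \<otimes>f m \<oplus>\<^bsub>F.T\<^esub> bar (b \<otimes>\<^bsub>B\<^esub> a) \<odot>\<^bsub>F.T\<^esub> \<omega> m =
       diff B b \<otimes>f (a \<odot>\<^bsub>M\<^esub> m) \<oplus>\<^bsub>F.T\<^esub> bar b \<odot>\<^bsub>F.T\<^esub> \<omega> (a \<odot>\<^bsub>M\<^esub> m)" .
  qed
  note * = F.lift_props[OF F.T_abelian this, of "tensor_group (deg0 B) B (\<lambda>b. b) M", folded cov_def]
  show "cov \<omega> \<in> extensional (carrier F.T)" "cov \<omega> \<in> additive F.T F.T"
    "\<lbrakk>b \<in> carrier B; m \<in> carrier M\<rbrakk> \<Longrightarrow> cov \<omega> (b \<otimes>f m) = diff B b \<otimes>f m \<oplus>\<^bsub>F.T\<^esub> bar b \<odot>\<^bsub>F.T\<^esub> \<omega> m"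
    using * by (simp_all add: base_change_simps)
qed

lemmas cov_closed = additive_closed[OF cov_additive]

lemma bar_one: "bar \<one>\<^bsub>B\<^esub> = \<one>\<^bsub>B\<^esub>"
  using bar_homogeneous[OF gr_one] by simp

lemma cov_one: "m \<in> carrier M \<Longrightarrow> cov \<omega> (\<one>\<^bsub>B\<^esub> \<otimes>f m) = \<omega> m"
  by (simp add: cov_ten d_one bar_one F.ten_zero_left F.T.smult_one \<omega>_closed)

lemma cov_smult:
  assumes b: "b \<in> carrier B" and t: "t \<in> carrier F.T"
  shows "cov \<omega> (b \<odot>\<^bsub>F.T\<^esub> t) = diff B b \<odot>\<^bsub>F.T\<^esub> t \<oplus>\<^bsub>F.T\<^esub> bar b \<odot>\<^bsub>F.T\<^esub> cov \<omega> t"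
proof (rule F.additive_eqI[OF additive_comp[OF F.T_smult_additive[OF b] cov_additive] _ F.T_abelian _ t])
  show "(\<lambda>t. diff B b \<odot>\<^bsub>F.T\<^esub> t \<oplus>\<^bsub>F.T\<^esub> bar b \<odot>\<^bsub>F.T\<^esub> cov \<omega> t) \<in> additive F.T F.T"
    by (intro additive_sum F.T_abelian F.T_smult_additive additive_comp[OF cov_additive F.T_smult_additive]
        d_closed bar_closed b)
  fix s m assume "s \<in> carrier B" "m \<in> carrier M"
  then show "cov \<omega> (b \<odot>\<^bsub>F.T\<^esub> (s \<otimes>f m)) =
     diff B b \<odot>\<^bsub>F.T\<^esub> (s \<otimes>f m) \<oplus>\<^bsub>F.T\<^esub> bar b \<odot>\<^bsub>F.T\<^esub> cov \<omega> (s \<otimes>f m)"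
    using b by (simp add: F.smult_ten cov_ten leibniz_bar bar_mult F.ten_add_left d_closed bar_closed
        F.T.smult_r_distr F.T.smult_closed \<omega>_closed F.T.smult_assoc F.ten_closed F.T.a_assoc)
qed

lemma cov_gr:
  assumes "t \<in> form_gr B M p" shows "cov \<omega> t \<in> form_gr B M (Suc p)"
  using assms
proof (induction rule: form_gr_induct)
  case (ten b m)
  have "bar b \<in> gr B p" using ten by (simp add: bar_homogeneous gr_minus)
  from form_gr_smult[OF this \<omega>_gr[OF ten(2)], folded Suc_eq_plus1] show ?case
    using ten by (simp add: cov_ten gr_carrier form_gr_add form_gr_ten d_gr)
qed (simp_all add: additive_zero[OF cov_additive F.T_abelian F.T_abelian] form_gr_zero
    additive_add[OF cov_additive] form_gr_add additive_minus[OF cov_additive F.T_abelian F.T_abelian] form_gr_minus)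

text \<open>The square of \<open>\<nabla>\<close> is \<open>B\<close>-linear: the two terms with \<open>\<partial>b\<close> in \<open>\<nabla>(\<nabla>(bt))\<close> cancel, as \<open>\<partial>\<close> changes the
  parity. So it vanishes as soon as it does on \<open>1 \<otimes> m\<close>.\<close>

lemma cov_cov:
  assumes flat: "\<And>m. m \<in> carrier M \<Longrightarrow> cov \<omega> (\<omega> m) = \<zero>\<^bsub>F.T\<^esub>" and t: "t \<in> carrier F.T"
  shows "cov \<omega> (cov \<omega> t) = \<zero>\<^bsub>F.T\<^esub>"
proof (rule F.additive_eqI[OF additive_comp[OF cov_additive cov_additive] _ F.T_abelian _ t])
  show "(\<lambda>t. \<zero>\<^bsub>F.T\<^esub>) \<in> additive F.T F.T" by (intro additiveI) auto
  fix b m assume b: "b \<in> carrier B" and m: "m \<in> carrier M"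
  then show "cov \<omega> (cov \<omega> (b \<otimes>f m)) = \<zero>\<^bsub>F.T\<^esub>"
    by (simp add: cov_ten d_d additive_add[OF cov_additive] cov_smult F.ten_closed F.T.smult_closed \<omega>_closed
        d_closed bar_closed flat F.T.smult_zero F.ten_zero_left bar_d F.T.minus_smult F.T.l_neg)
qed

lemma cov_flat_connection:
  assumes flat: "\<And>m. m \<in> carrier M \<Longrightarrow> cov \<omega> (\<omega> m) = \<zero>\<^bsub>F.T\<^esub>"
  shows "flat_connection R B M (cov \<omega>)"
proof -
  have r: "cov \<omega> ((r \<odot>\<^bsub>B\<^esub> \<one>\<^bsub>B\<^esub>) \<odot>\<^bsub>F.T\<^esub> t) = (r \<odot>\<^bsub>B\<^esub> \<one>\<^bsub>B\<^esub>) \<odot>\<^bsub>F.T\<^esub> cov \<omega> t"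
    if "r \<in> carrier R" "t \<in> carrier F.T" for r t
  proof -
    have g: "r \<odot>\<^bsub>B\<^esub> \<one>\<^bsub>B\<^esub> \<in> gr B 0" using that gr_smult gr_one by blast
    have "diff B (r \<odot>\<^bsub>B\<^esub> \<one>\<^bsub>B\<^esub>) = \<zero>\<^bsub>B\<^esub>"
      using that module.smult_r_null[OF R_module] by (simp add: d_smult d_one)
    then show ?thesis
      using that g by (simp add: cov_smult gr_carrier F.T.zero_smult bar_homogeneous F.T.smult_closed cov_closed)
  qed
  have l: "cov \<omega> (b \<otimes>f m) = diff B b \<otimes>f m \<oplus>\<^bsub>F.T\<^esub> [((- 1) ^ p :: int)] \<cdot>\<^bsub>F.T\<^esub> (b \<odot>\<^bsub>F.T\<^esub> cov \<omega> (\<one>\<^bsub>B\<^esub> \<otimes>f m))"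
    if "b \<in> gr B p" "m \<in> carrier M" for b m p
  proof -
    have "b \<odot>\<^bsub>F.T\<^esub> \<omega> m \<in> carrier F.T" using that by (simp add: gr_carrier F.T.smult_closed \<omega>_closed)
    note s = F.T.sign_pow_add_pow[OF this, of p]
    show ?thesis
      unfolding cov_one[OF that(2)] s
      using that by (simp add: cov_ten gr_carrier bar_homogeneous \<omega>_closed F.T.minus_smult)
  qed
  show ?thesis
    unfolding flat_connection_def Let_def form_module_def form_def
    using cov_ext cov_closed r l cov_gr cov_cov[OF flat] additive_add[OF cov_additive]
    by (auto simp: PiE_def)
qed

end

definition flat_form where "flat_form \<D> m = \<D> (\<one>\<^bsub>B\<^esub> \<otimes>f m)"

text \<open>The Leibniz rule recovers a connection from its values on \<open>1 \<otimes> m\<close>, first on \<open>b \<otimes> m\<close> with \<open>b\<close>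
  homogeneous and then by additivity.\<close>

lemma flat_form_props:
  assumes D: "flat_connection R B M \<D>"
  shows flat_form: "connection_form (flat_form \<D>)"
    and cov_flat_form: "cov (flat_form \<D>) = \<D>"
    and flat_form_flat: "m \<in> carrier M \<Longrightarrow> cov (flat_form \<D>) (flat_form \<D> m) = \<zero>\<^bsub>F.T\<^esub>"
proof -
  note D' = D[unfolded flat_connection_def Let_def form_module_def form_def]
  have add: "\<D> \<in> additive F.T F.T" and ext: "\<D> \<in> extensional (carrier F.T)"
    using D' by (auto simp: additive_def PiE_def)
  have leib: "\<D> (b \<otimes>f m) = diff B b \<otimes>f m \<oplus>\<^bsub>F.T\<^esub> (bar b \<odot>\<^bsub>F.T\<^esub> flat_form \<D> m)"
    if "b \<in> gr B p" "m \<in> carrier M" for b m p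
  proof -
    have "\<D> (b \<otimes>f m) = diff B b \<otimes>f m \<oplus>\<^bsub>F.T\<^esub> [((- 1) ^ p :: int)] \<cdot>\<^bsub>F.T\<^esub> (b \<odot>\<^bsub>F.T\<^esub> \<D> (\<one>\<^bsub>B\<^esub> \<otimes>f m))"
      using D' that by blast
    moreover have "\<D> (\<one>\<^bsub>B\<^esub> \<otimes>f m) \<in> carrier F.T"
      using that by (simp add: additive_closed[OF add] F.ten_closed)
    ultimately show ?thesis
      using that by (simp add: flat_form_def gr_carrier bar_homogeneous F.T.sign_pow_add_pow F.T.smult_closed F.T.minus_smult)
  qed
  show 1: "connection_form (flat_form \<D>)"
    unfolding connection_form_def
  proof (intro conjI ballI)
    show "flat_form \<D> \<in> additive M F.T"
      using additive_comp[OF F.ten_additive_right add, of "\<one>\<^bsub>B\<^esub>"] by (simp add: flat_form_def[abs_def])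
    fix m assume m: "m \<in> carrier M"
    have "\<D> (\<one>\<^bsub>B\<^esub> \<otimes>f m) \<in> form_gr B M (Suc 0)" using D' form_gr_ten[OF gr_one m] by blast
    then show "flat_form \<D> m \<in> form_gr B M 1" by (simp add: flat_form_def One_nat_def)
    fix a assume a: "a \<in> gr B 0"
    have "flat_form \<D> (a \<odot>\<^bsub>M\<^esub> m) = \<D> (a \<otimes>f m)"
      using a m F.ten_balanced[of "\<one>\<^bsub>B\<^esub>" a m] by (simp add: flat_form_def gr_carrier)
    also have "\<dots> = a \<odot>\<^bsub>F.T\<^esub> flat_form \<D> m \<oplus>\<^bsub>F.T\<^esub> diff B a \<otimes>f m"
      using a m \<open>flat_form \<D> m \<in> form_gr B M 1\<close>[THEN form_gr_closed]
      by (simp add: leib bar_homogeneous F.T.a_comm F.ten_closed F.T.smult_closed gr_carrier d_closed)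
    finally show "flat_form \<D> (a \<odot>\<^bsub>M\<^esub> m) = a \<odot>\<^bsub>F.T\<^esub> flat_form \<D> m \<oplus>\<^bsub>F.T\<^esub> diff B a \<otimes>f m" .
  qed
  show 2: "cov (flat_form \<D>) = \<D>"
  proof (rule extensionalityI[OF cov_ext[OF 1] ext])
    fix t assume t: "t \<in> carrier F.T"
    show "cov (flat_form \<D>) t = \<D> t"
    proof (rule F.additive_eqI[OF cov_additive[OF 1] add F.T_abelian _ t])
      fix b m assume b: "b \<in> carrier B" and m: "m \<in> carrier M"
      note l = additive_comp[OF F.ten_additive_left[OF m]]
      from b show "cov (flat_form \<D>) (b \<otimes>f m) = \<D> (b \<otimes>f m)"
      proof (induction rule: homogeneous_induct)
        case zero
        show ?case
          using additive_zero[OF l[OF cov_additive[OF 1]] B.abelian_group_axioms F.T_abelian]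
            additive_zero[OF l[OF add] B.abelian_group_axioms F.T_abelian] by simp
      next
        case (add b b')
        then show ?case
          using additive_add[OF l[OF cov_additive[OF 1]]] additive_add[OF l[OF \<open>\<D> \<in> additive F.T F.T\<close>]] by simp
      next
        case (gr p b)
        then show ?case using m by (simp add: cov_ten[OF 1] leib gr_carrier)
      qed
    qed
  qed
  show "m \<in> carrier M \<Longrightarrow> cov (flat_form \<D>) (flat_form \<D> m) = \<zero>\<^bsub>F.T\<^esub>"
    unfolding 2 unfolding flat_form_def using D' F.ten_closed by simp
qed

end

section \<open>Connection forms and descent data\<close>

lemma (in abelian_group) add_minus_cancel:
  assumes "x \<in> carrier G" "y \<in> carrier G"
  shows "x \<oplus> (y \<oplus> \<ominus> x) = y"
  using assms by (metis a_inv_closed a_lcomm r_neg r_zero)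

lemma (in abelian_group) cancel_middle:
  assumes "w \<in> carrier G" "x \<in> carrier G" "y \<in> carrier G" "z \<in> carrier G"
  shows "(w \<oplus> x) \<oplus> ((y \<oplus> \<ominus> x) \<oplus> z) = (w \<oplus> y) \<oplus> z"
proof -
  have "(w \<oplus> x) \<oplus> ((y \<oplus> \<ominus> x) \<oplus> z) = ((w \<oplus> y) \<oplus> z) \<oplus> (x \<oplus> \<ominus> x)"
    using assms by (simp only: a_ac a_closed a_inv_closed)
  then show ?thesis using assms by (simp add: r_neg)
qed

context dg_module begin

lemma aug1_hom: "(\<lambda>s. s {1}) \<in> ring_hom D1 (deg0 B)"
  by (rule ring_hom_memI; (elim D1_cases)?; hypsubst?)
    (simp_all add: D1_mult D1_ops gr_carrier)

lemma aug2_hom: "(\<lambda>s. s {1, 2}) \<in> ring_hom D2 (deg0 B)"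
  by (rule ring_hom_memI; (elim D2_cases)?; hypsubst?)
    (simp_all add: D2_mult D2_ops gr_carrier)

abbreviation xt where "xt i \<equiv> tens (deg0 B) D1 (coface0 B i) M"
abbreviation yt where "yt \<equiv> tens (deg0 B) D2 (\<lambda>a. coface B 1 1 (coface0 B 1 a)) M"

text \<open>Reduction modulo \<open>\<epsilon>\<close>, for both cofaces \<open>B\<^sup>0 \<rightarrow> D\<^sup>1 B\<close>, and its analogue at level 2.\<close>

definition red where "red i = augment (deg0 B) D1 (coface0 B i) M (\<lambda>s. s {1})"
definition red2 where "red2 = augment (deg0 B) D2 (\<lambda>a. coface B 1 1 (coface0 B 1 a)) M (\<lambda>s. s {1, 2})"

lemma red_props:
  assumes "i \<in> {0, 1}"
  shows red_additive: "red i \<in> additive (C.X i) M"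
    and red_ten: "\<lbrakk>s \<in> carrier D1; m \<in> carrier M\<rbrakk> \<Longrightarrow> red i (xt i s m) = s {1} \<odot>\<^bsub>M\<^esub> m"
    and red_smult: "\<lbrakk>s \<in> carrier D1; t \<in> carrier (C.X i)\<rbrakk> \<Longrightarrow> red i (s \<odot>\<^bsub>C.X i\<^esub> t) = s {1} \<odot>\<^bsub>M\<^esub> red i t"
proof -
  have "coface0 B i a {1} = a" if "a \<in> carrier (deg0 B)" for a
    using that assms by (auto simp: coface0_eq)
  note * = tensor.augment_props[OF C.X_tensor[OF assms] aug1_hom, OF this, folded red_def]
  show "red i \<in> additive (C.X i) M"
    "\<lbrakk>s \<in> carrier D1; m \<in> carrier M\<rbrakk> \<Longrightarrow> red i (xt i s m) = s {1} \<odot>\<^bsub>M\<^esub> m"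
    "\<lbrakk>s \<in> carrier D1; t \<in> carrier (C.X i)\<rbrakk> \<Longrightarrow> red i (s \<odot>\<^bsub>C.X i\<^esub> t) = s {1} \<odot>\<^bsub>M\<^esub> red i t"
    using * by auto
qed

lemma red_one: "\<lbrakk>i \<in> {0, 1}; m \<in> carrier M\<rbrakk> \<Longrightarrow> red i (xt i \<one>\<^bsub>D1\<^esub> m) = m"
  using red_ten[of i "\<one>\<^bsub>D1\<^esub>" m] M.smult_one by (simp add: C.S1.one_closed) (simp add: D1_ops)

lemma red2_props:
  shows red2_additive: "red2 \<in> additive C.Y M"
    and red2_ten: "\<lbrakk>s \<in> carrier D2; m \<in> carrier M\<rbrakk> \<Longrightarrow> red2 (yt s m) = s {1, 2} \<odot>\<^bsub>M\<^esub> m"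
    and red2_smult: "\<lbrakk>s \<in> carrier D2; t \<in> carrier C.Y\<rbrakk> \<Longrightarrow> red2 (s \<odot>\<^bsub>C.Y\<^esub> t) = s {1, 2} \<odot>\<^bsub>M\<^esub> red2 t"
proof -
  have "coface B 1 1 (coface0 B 1 a) {1, 2} = a" if "a \<in> carrier (deg0 B)" for a
    using that by (simp add: coface_identities)
  note * = C.Y.augment_props[OF aug2_hom, OF this, folded red2_def]
  show "red2 \<in> additive C.Y M"
    "\<lbrakk>s \<in> carrier D2; m \<in> carrier M\<rbrakk> \<Longrightarrow> red2 (yt s m) = s {1, 2} \<odot>\<^bsub>M\<^esub> m"
    "\<lbrakk>s \<in> carrier D2; t \<in> carrier C.Y\<rbrakk> \<Longrightarrow> red2 (s \<odot>\<^bsub>C.Y\<^esub> t) = s {1, 2} \<odot>\<^bsub>M\<^esub> red2 t"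
    using * by auto
qed

text \<open>The inclusion \<open>B\<^sup>1 \<otimes> M \<rightarrow> D\<^sup>1 B \<otimes> M\<close>, \<open>b \<otimes> m \<mapsto> \<epsilon>b \<otimes> m\<close>, extended to \<open>B \<otimes> M\<close> by projecting to
  degree 1. It exists for both cofaces, because they agree modulo \<open>\<epsilon>\<close> and \<open>\<epsilon>\<^sup>2 = 0\<close>. Its left inverse on
  the degree 1 part is the coefficient \<open>coeff\<close> of \<open>\<epsilon>\<close>.\<close>

definition eps where "eps i = tmap (deg0 B) B (\<lambda>b. b) D1 (coface0 B i) M (\<lambda>b. level1 \<zero>\<^bsub>B\<^esub> (hcomp 1 b))"

lemma level1_hcomp_closed: "b \<in> carrier B \<Longrightarrow> level1 \<zero>\<^bsub>B\<^esub> (hcomp 1 b) \<in> carrier D1"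
  by (simp add: D1_iff gr_zero hcomp_gr)

lemma eps_props:
  assumes i: "i \<in> {0, 1}"
  shows eps_additive: "eps i \<in> additive F.T (C.X i)"
    and eps_ten: "\<lbrakk>b \<in> carrier B; m \<in> carrier M\<rbrakk> \<Longrightarrow> eps i (b \<otimes>f m) = xt i (level1 \<zero>\<^bsub>B\<^esub> (hcomp 1 b)) m"
    and eps_smult: "\<lbrakk>a \<in> gr B 0; b \<in> gr B 1; t \<in> carrier F.T\<rbrakk> \<Longrightarrow> level1 a b \<odot>\<^bsub>C.X i\<^esub> eps i t = eps i (a \<odot>\<^bsub>F.T\<^esub> t)"
proof -
  interpret X: tensor "deg0 B" D1 "coface0 B i" M by (rule C.X_tensor[OF i])
  have u: "(\<lambda>b. level1 \<zero>\<^bsub>B\<^esub> (hcomp 1 b)) \<in> additive B D1"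
    by (intro additiveI) (simp_all add: D1_iff gr_zero hcomp_gr hcomp_add D1_ops)
  have b: "level1 \<zero>\<^bsub>B\<^esub> (hcomp 1 (s \<otimes>\<^bsub>B\<^esub> a)) = level1 \<zero>\<^bsub>B\<^esub> (hcomp 1 s) \<otimes>\<^bsub>D1\<^esub> coface0 B i a"
    if "s \<in> carrier B" "a \<in> carrier (deg0 B)" for s a
    using that i by (auto simp: coface0_eq D1_mult gr_carrier hcomp_closed hcomp_mult0 d_closed)
  note * = F.tmap_props[OF X.tensor_axioms u b, folded eps_def]
  show 1: "eps i \<in> additive F.T (C.X i)"
    and 2: "b \<in> carrier B \<Longrightarrow> m \<in> carrier M \<Longrightarrow> eps i (b \<otimes>f m) = xt i (level1 \<zero>\<^bsub>B\<^esub> (hcomp 1 b)) m" for b m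
    using * by auto
  show "level1 a b \<odot>\<^bsub>C.X i\<^esub> eps i t = eps i (a \<odot>\<^bsub>F.T\<^esub> t)"
    if a: "a \<in> gr B 0" and b: "b \<in> gr B 1" and t: "t \<in> carrier F.T"
  proof -
    have ab: "level1 a b \<in> carrier D1" using a b by (simp add: D1_iff)
    show ?thesis
      by (rule F.additive_eqI[OF additive_comp[OF 1 X.T_smult_additive[OF ab]]
            additive_comp[OF F.T_smult_additive[OF gr_carrier[OF a]] 1] X.T_abelian _ t])
        (use a b hcomp_mult_left[OF _ a, of _ 1] in
          \<open>simp add: 2 F.smult_ten gr_carrier X.smult_ten ab level1_hcomp_closed D1_mult hcomp_closed\<close>)
  qed
qed

definition coeff where "coeff = tmap (deg0 B) D1 (coface0 B 1) B (\<lambda>b. b) M (\<lambda>s. s {})"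

lemma coeff_props:
  shows coeff_additive: "coeff \<in> additive (C.X 1) F.T"
    and coeff_ten: "\<lbrakk>s \<in> carrier D1; m \<in> carrier M\<rbrakk> \<Longrightarrow> coeff (xt 1 s m) = s {} \<otimes>f m"
proof -
  have u: "(\<lambda>s. s {}) \<in> additive D1 B"
    by (rule additiveI; (elim D1_cases)?; hypsubst?) (simp_all add: D1_ops gr_carrier)
  have b: "(s \<otimes>\<^bsub>D1\<^esub> coface0 B 1 a) {} = s {} \<otimes>\<^bsub>B\<^esub> a"
    if "s \<in> carrier D1" "a \<in> carrier (deg0 B)" for s a
    using that by (elim D1_cases) (simp add: coface0_eq D1_mult gr_carrier)
  show "coeff \<in> additive (C.X 1) F.T"
    "\<lbrakk>s \<in> carrier D1; m \<in> carrier M\<rbrakk> \<Longrightarrow> coeff (xt 1 s m) = s {} \<otimes>f m"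
    using C.X1.tmap_props[OF F.tensor_axioms u b, folded coeff_def] by auto
qed

lemma coeff_one: "m \<in> carrier M \<Longrightarrow> coeff (xt 1 \<one>\<^bsub>D1\<^esub> m) = \<zero>\<^bsub>F.T\<^esub>"
  by (simp add: coeff_ten D1_ops D1_iff gr_one gr_zero F.ten_zero_left)

lemma coeff_gr: "x \<in> carrier (C.X 1) \<Longrightarrow> coeff x \<in> form_gr B M 1"
proof (induction rule: C.X1.ten_induct)
  case zero
  then show ?case
    by (simp add: additive_zero[OF coeff_additive C.X1.T_abelian F.T_abelian] form_gr_zero)
next
  case (ten s m)
  then show ?case by (auto elim!: D1_cases simp: coeff_ten D1_iff intro: form_gr_ten)
qed (simp add: additive_add[OF coeff_additive] form_gr_add)

lemma coeff_eps: "t \<in> form_gr B M 1 \<Longrightarrow> coeff (eps 1 t) = t"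
  by (rule form_gr_eqI[OF additive_comp[OF eps_additive coeff_additive] additive_id F.T_abelian])
    (simp_all add: eps_ten coeff_ten D1_iff gr_zero gr_carrier hcomp_homogeneous)

text \<open>The splitting \<open>X\<^sub>1 = M \<oplus> \<epsilon>(B\<^sup>1 \<otimes> M)\<close>, which exists because \<open>\<partial>\<^sup>1\<close> splits \<open>D\<^sup>1 B\<close> over \<open>B\<^sup>0\<close>.\<close>

lemma X1_decomp: "x \<in> carrier (C.X 1) \<Longrightarrow> x = xt 1 \<one>\<^bsub>D1\<^esub> (red 1 x) \<oplus>\<^bsub>C.X 1\<^esub> eps 1 (coeff x)"
proof (rule C.X1.additive_eqI[OF additive_id additive_sum[OF additive_comp[OF red_additive C.X1.ten_additive_right]
    additive_comp[OF coeff_additive eps_additive] C.X1.T_abelian] C.X1.T_abelian])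
  fix s m assume "s \<in> carrier D1" and m: "m \<in> carrier M"
  then obtain a b where s: "s = level1 a b" "a \<in> gr B 0" "b \<in> gr B 1" by (elim D1_cases)
  have c: "level1 a b \<in> carrier D1" "level1 a \<zero>\<^bsub>B\<^esub> \<in> carrier D1" "level1 \<zero>\<^bsub>B\<^esub> b \<in> carrier D1"
    using s by (simp_all add: D1_iff gr_zero)
  have "xt 1 \<one>\<^bsub>D1\<^esub> (a \<odot>\<^bsub>M\<^esub> m) = xt 1 (level1 a \<zero>\<^bsub>B\<^esub>) m"
    using s m C.X1.ten_balanced[of "\<one>\<^bsub>D1\<^esub>" a m] c by (simp add: coface0_eq)
  then have "xt 1 \<one>\<^bsub>D1\<^esub> (red 1 (xt 1 s m)) \<oplus>\<^bsub>C.X 1\<^esub> eps 1 (coeff (xt 1 s m)) =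
      xt 1 (level1 a \<zero>\<^bsub>B\<^esub>) m \<oplus>\<^bsub>C.X 1\<^esub> xt 1 (level1 \<zero>\<^bsub>B\<^esub> b) m"
    using s c m by (simp add: red_ten coeff_ten eps_ten gr_carrier hcomp_homogeneous)
  moreover have "xt 1 (level1 a b) m = xt 1 (level1 a \<zero>\<^bsub>B\<^esub>) m \<oplus>\<^bsub>C.X 1\<^esub> xt 1 (level1 \<zero>\<^bsub>B\<^esub> b) m"
    using C.X1.ten_add_left[OF c(2,3) m] s by (simp add: D1_ops gr_carrier)
  ultimately show "xt 1 s m = xt 1 \<one>\<^bsub>D1\<^esub> (red 1 (xt 1 s m)) \<oplus>\<^bsub>C.X 1\<^esub> eps 1 (coeff (xt 1 s m))"
    using s by simp
qed auto

text \<open>The descent datum \<open>1 \<otimes> m \<mapsto> 1 \<otimes> m + \<epsilon> \<omega>(m)\<close>.\<close>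

definition gauge where
  "gauge \<omega> = lin_ext (deg0 B) D1 (coface0 B 0) M (C.X 1) (\<lambda>m. xt 1 \<one>\<^bsub>D1\<^esub> m \<oplus>\<^bsub>C.X 1\<^esub> eps 1 (\<omega> m))"

lemma one_ten_coface:
  assumes "a \<in> gr B 0" "m \<in> carrier M"
  shows "xt 1 \<one>\<^bsub>D1\<^esub> (a \<odot>\<^bsub>M\<^esub> m) = xt 1 (level1 a \<zero>\<^bsub>B\<^esub>) m"
    "xt 0 \<one>\<^bsub>D1\<^esub> (a \<odot>\<^bsub>M\<^esub> m) = xt 0 (level1 a (diff B a)) m"
  using C.X1.ten_balanced[of "\<one>\<^bsub>D1\<^esub>" a m] C.X0.ten_balanced[of "\<one>\<^bsub>D1\<^esub>" a m] assms
  by (simp_all add: coface0_eq D1_iff gr_zero d_gr0)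

context
  fixes \<omega> assumes \<omega>: "connection_form \<omega>"
begin

lemmas \<omega>_simps = \<omega>_closed[OF \<omega>] \<omega>_gr[OF \<omega>] \<omega>_smult[OF \<omega>]

lemma gauge_hom: "gauge \<omega> \<in> module_hom D1 (C.X 0) (C.X 1)"
  and gauge_ext: "gauge \<omega> \<in> extensional (carrier (C.X 0))"
  and gauge_ten: "\<lbrakk>s \<in> carrier D1; m \<in> carrier M\<rbrakk>
     \<Longrightarrow> gauge \<omega> (xt 0 s m) = s \<odot>\<^bsub>C.X 1\<^esub> (xt 1 \<one>\<^bsub>D1\<^esub> m \<oplus>\<^bsub>C.X 1\<^esub> eps 1 (\<omega> m))"
proof -
  have f: "(\<lambda>m. xt 1 \<one>\<^bsub>D1\<^esub> m \<oplus>\<^bsub>C.X 1\<^esub> eps 1 (\<omega> m)) \<in> additive M (C.X 1)"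
    by (intro additive_sum C.X1.T_abelian C.X1.ten_additive_right
        additive_comp[OF \<omega>_additive[OF \<omega>] eps_additive]) auto
  have b: "xt 1 \<one>\<^bsub>D1\<^esub> (a \<odot>\<^bsub>M\<^esub> m) \<oplus>\<^bsub>C.X 1\<^esub> eps 1 (\<omega> (a \<odot>\<^bsub>M\<^esub> m)) =
      coface0 B 0 a \<odot>\<^bsub>C.X 1\<^esub> (xt 1 \<one>\<^bsub>D1\<^esub> m \<oplus>\<^bsub>C.X 1\<^esub> eps 1 (\<omega> m))"
    if "a \<in> carrier (deg0 B)" and m: "m \<in> carrier M" for a m
  proof -
    have a: "a \<in> gr B 0" using that by simp
    have c: "level1 a (diff B a) \<in> carrier D1" "level1 a \<zero>\<^bsub>B\<^esub> \<in> carrier D1" "level1 \<zero>\<^bsub>B\<^esub> (diff B a) \<in> carrier D1"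
      using a by (simp_all add: D1_iff gr_zero d_gr0)
    have E: "eps 1 t \<in> carrier (C.X 1)" if "t \<in> carrier F.T" for t
      using that by (simp add: additive_closed[OF eps_additive])
    have "xt 1 (level1 a (diff B a)) m = xt 1 (level1 a \<zero>\<^bsub>B\<^esub>) m \<oplus>\<^bsub>C.X 1\<^esub> xt 1 (level1 \<zero>\<^bsub>B\<^esub> (diff B a)) m"
      using C.X1.ten_add_left[OF c(2,3) m] a by (simp add: D1_ops gr_carrier d_closed)
    moreover have "eps 1 (diff B a \<otimes>f m) = xt 1 (level1 \<zero>\<^bsub>B\<^esub> (diff B a)) m"
      using a m by (simp add: eps_ten d_closed gr_carrier hcomp_homogeneous[OF d_gr0])
    ultimately show ?thesis
      using a m c by (simp add: one_ten_coface coface0_eq \<omega>_simps additive_add[OF eps_additive] F.T.smult_closed F.ten_closed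
          gr_carrier d_closed C.X1.T.smult_r_distr C.X1.ten_closed E C.X1.smult_ten eps_smult d_gr0 C.X1.T.a_ac)
  qed
  note * = C.X0.lin_ext_props[OF C.X1.T_lmod f b, folded gauge_def]
  show "gauge \<omega> \<in> module_hom D1 (C.X 0) (C.X 1)" "gauge \<omega> \<in> extensional (carrier (C.X 0))"
    "\<lbrakk>s \<in> carrier D1; m \<in> carrier M\<rbrakk>
     \<Longrightarrow> gauge \<omega> (xt 0 s m) = s \<odot>\<^bsub>C.X 1\<^esub> (xt 1 \<one>\<^bsub>D1\<^esub> m \<oplus>\<^bsub>C.X 1\<^esub> eps 1 (\<omega> m))"
    using * by auto
qed

lemma gauge_one: "m \<in> carrier M \<Longrightarrow> gauge \<omega> (xt 0 \<one>\<^bsub>D1\<^esub> m) = xt 1 \<one>\<^bsub>D1\<^esub> m \<oplus>\<^bsub>C.X 1\<^esub> eps 1 (\<omega> m)"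
  by (simp add: gauge_ten C.X1.T.smult_one C.X1.ten_closed additive_closed[OF eps_additive] \<omega>_simps)

lemma coeff_gauge: "m \<in> carrier M \<Longrightarrow> coeff (gauge \<omega> (xt 0 \<one>\<^bsub>D1\<^esub> m)) = \<omega> m"
  by (simp add: gauge_one additive_add[OF coeff_additive] C.X1.ten_closed additive_closed[OF eps_additive] \<omega>_simps
      coeff_one coeff_eps)

text \<open>The inverse is \<open>k(1 \<otimes> m) = 1 \<otimes> m - \<epsilon> \<omega>(m)\<close>; linearity along \<open>\<partial>\<^sup>1\<close> holds because the term
  \<open>\<epsilon> \<partial>a \<otimes> m\<close> from \<open>\<partial>\<^sup>0 a\<close> cancels the one from \<open>\<omega>(am)\<close>. Both \<open>g\<close> and \<open>k\<close> send \<open>\<epsilon>b \<otimes> m\<close> to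
  \<open>\<epsilon>b \<otimes> m\<close>, by \<open>\<epsilon>\<^sup>2 = 0\<close>.\<close>

lemma gauge_bij: "bij_betw (gauge \<omega>) (carrier (C.X 0)) (carrier (C.X 1))"
proof -
  define k where "k = lin_ext (deg0 B) D1 (coface0 B 1) M (C.X 0)
    (\<lambda>m. xt 0 \<one>\<^bsub>D1\<^esub> m \<oplus>\<^bsub>C.X 0\<^esub> \<ominus>\<^bsub>C.X 0\<^esub> eps 0 (\<omega> m))"
  have E0: "eps 0 t \<in> carrier (C.X 0)" if "t \<in> carrier F.T" for t
    using that by (simp add: additive_closed[OF eps_additive])
  have E1: "eps 1 t \<in> carrier (C.X 1)" if "t \<in> carrier F.T" for t
    using that by (simp add: additive_closed[OF eps_additive])
  have f: "(\<lambda>m. xt 0 \<one>\<^bsub>D1\<^esub> m \<oplus>\<^bsub>C.X 0\<^esub> \<ominus>\<^bsub>C.X 0\<^esub> eps 0 (\<omega> m)) \<in> additive M (C.X 0)"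
    by (intro additive_sum additive_uminus C.X0.T_abelian C.X0.ten_additive_right
        additive_comp[OF \<omega>_additive[OF \<omega>] eps_additive]) auto
  have b: "xt 0 \<one>\<^bsub>D1\<^esub> (a \<odot>\<^bsub>M\<^esub> m) \<oplus>\<^bsub>C.X 0\<^esub> \<ominus>\<^bsub>C.X 0\<^esub> eps 0 (\<omega> (a \<odot>\<^bsub>M\<^esub> m)) =
      coface0 B 1 a \<odot>\<^bsub>C.X 0\<^esub> (xt 0 \<one>\<^bsub>D1\<^esub> m \<oplus>\<^bsub>C.X 0\<^esub> \<ominus>\<^bsub>C.X 0\<^esub> eps 0 (\<omega> m))"
    if "a \<in> carrier (deg0 B)" and m: "m \<in> carrier M" for a m
  proof -
    have a: "a \<in> gr B 0" using that by simp
    have c: "level1 a (diff B a) \<in> carrier D1" "level1 a \<zero>\<^bsub>B\<^esub> \<in> carrier D1" "level1 \<zero>\<^bsub>B\<^esub> (diff B a) \<in> carrier D1"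
      using a by (simp_all add: D1_iff gr_zero d_gr0)
    have "xt 0 (level1 a (diff B a)) m = xt 0 (level1 a \<zero>\<^bsub>B\<^esub>) m \<oplus>\<^bsub>C.X 0\<^esub> xt 0 (level1 \<zero>\<^bsub>B\<^esub> (diff B a)) m"
      using C.X0.ten_add_left[OF c(2,3) m] a by (simp add: D1_ops gr_carrier d_closed)
    moreover have "eps 0 (diff B a \<otimes>f m) = xt 0 (level1 \<zero>\<^bsub>B\<^esub> (diff B a)) m"
      using a m by (simp add: eps_ten d_closed gr_carrier hcomp_homogeneous[OF d_gr0])
    moreover have "level1 a \<zero>\<^bsub>B\<^esub> \<odot>\<^bsub>C.X 0\<^esub> \<ominus>\<^bsub>C.X 0\<^esub> eps 0 (\<omega> m) = \<ominus>\<^bsub>C.X 0\<^esub> eps 0 (a \<odot>\<^bsub>F.T\<^esub> \<omega> m)"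
      using a m c by (simp add: C.X0.T.smult_minus E0 \<omega>_simps eps_smult gr_zero)
    ultimately show ?thesis
      using a m c by (simp add: one_ten_coface coface0_eq \<omega>_simps additive_add[OF eps_additive] F.T.smult_closed F.ten_closed
          gr_carrier d_closed C.X0.T.smult_r_distr C.X0.ten_closed E0 C.X0.smult_ten C.X0.T.minus_add
          C.X0.T.a_ac C.X0.T.add_minus_cancel)
  qed
  note * = C.X1.lin_ext_props[OF C.X0.T_lmod f b, folded k_def]
  have k: "k \<in> extensional (carrier (C.X 1))" "k \<in> module_hom D1 (C.X 1) (C.X 0)"
    "\<And>s m. \<lbrakk>s \<in> carrier D1; m \<in> carrier M\<rbrakk> \<Longrightarrow> k (xt 1 s m) =
       s \<odot>\<^bsub>C.X 0\<^esub> (xt 0 \<one>\<^bsub>D1\<^esub> m \<oplus>\<^bsub>C.X 0\<^esub> \<ominus>\<^bsub>C.X 0\<^esub> eps 0 (\<omega> m))"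
    using * by auto
  note ka = module_hom_additive[OF k(2)]
  note ga = module_hom_additive[OF gauge_hom]
  have nil: "level1 \<zero>\<^bsub>B\<^esub> (hcomp 1 b) \<odot>\<^bsub>C.X i\<^esub> eps i (\<omega> m) = \<zero>\<^bsub>C.X i\<^esub>"
    if "b \<in> carrier B" "m \<in> carrier M" "i \<in> {0, 1}" for b m i
    using that C.X0.T_abelian C.X1.T_abelian
    by (auto simp: eps_smult gr_zero hcomp_gr \<omega>_simps F.T.zero_smult additive_zero[OF eps_additive F.T_abelian])
  have kE: "k (eps 1 t) = eps 0 t" if t: "t \<in> carrier F.T" for t
  proof (rule F.additive_eqI[OF additive_comp[OF eps_additive ka] eps_additive C.X0.T_abelian _ t])
    fix b m assume "b \<in> carrier B" "m \<in> carrier M"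
    then show "k (eps 1 (b \<otimes>f m)) = eps 0 (b \<otimes>f m)"
      by (simp add: eps_ten k(3) level1_hcomp_closed C.X0.T.smult_r_distr C.X0.ten_closed E0 \<omega>_simps C.X0.smult_ten
          C.X0.T.smult_minus nil C.X0.T.add.inv_one)
  qed auto
  have gE: "gauge \<omega> (eps 0 t) = eps 1 t" if t: "t \<in> carrier F.T" for t
  proof (rule F.additive_eqI[OF additive_comp[OF eps_additive ga] eps_additive C.X1.T_abelian _ t])
    fix b m assume "b \<in> carrier B" "m \<in> carrier M"
    then show "gauge \<omega> (eps 0 (b \<otimes>f m)) = eps 1 (b \<otimes>f m)"
      by (simp add: eps_ten gauge_ten level1_hcomp_closed C.X1.T.smult_r_distr C.X1.ten_closed E1 \<omega>_simps C.X1.smult_ten nil)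
  qed auto
  have k1: "k (xt 1 \<one>\<^bsub>D1\<^esub> m) = xt 0 \<one>\<^bsub>D1\<^esub> m \<oplus>\<^bsub>C.X 0\<^esub> \<ominus>\<^bsub>C.X 0\<^esub> eps 0 (\<omega> m)" if "m \<in> carrier M" for m
    using that by (simp add: k(3) C.X0.T.smult_one C.X0.ten_closed E0 \<omega>_simps)
  have kg: "k (gauge \<omega> x) = x" if x: "x \<in> carrier (C.X 0)" for x
  proof (rule C.X0.linear_eqI[OF _ _ C.X0.T_abelian _ x])
    show "(\<lambda>x. k (gauge \<omega> x)) \<in> module_hom D1 (C.X 0) (C.X 0)"
      by (intro module_homI additive_comp[OF ga ka])
        (simp add: module_hom_smult[OF gauge_hom] module_hom_smult[OF k(2)] additive_closed[OF ga])
    show "(\<lambda>x. x) \<in> module_hom D1 (C.X 0) (C.X 0)" by (intro module_homI additive_id) simp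
    fix m assume m: "m \<in> carrier M"
    then show "k (gauge \<omega> (xt 0 \<one>\<^bsub>D1\<^esub> m)) = xt 0 \<one>\<^bsub>D1\<^esub> m"
      by (simp add: gauge_one additive_add[OF ka] C.X1.ten_closed E1 \<omega>_simps k1 kE C.X0.T.a_assoc C.X0.T.l_neg
          C.X0.ten_closed E0)
  qed
  have gk: "gauge \<omega> (k x) = x" if x: "x \<in> carrier (C.X 1)" for x
  proof (rule C.X1.linear_eqI[OF _ _ C.X1.T_abelian _ x])
    show "(\<lambda>x. gauge \<omega> (k x)) \<in> module_hom D1 (C.X 1) (C.X 1)"
      by (intro module_homI additive_comp[OF ka ga])
        (simp add: module_hom_smult[OF gauge_hom] module_hom_smult[OF k(2)] additive_closed[OF ka])
    show "(\<lambda>x. x) \<in> module_hom D1 (C.X 1) (C.X 1)" by (intro module_homI additive_id) simp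
    fix m assume m: "m \<in> carrier M"
    then show "gauge \<omega> (k (xt 1 \<one>\<^bsub>D1\<^esub> m)) = xt 1 \<one>\<^bsub>D1\<^esub> m"
      by (simp add: k1 additive_add[OF ga] additive_minus[OF ga C.X0.T_abelian C.X1.T_abelian] C.X0.ten_closed E0
          \<omega>_simps gauge_one gE C.X1.T.a_assoc C.X1.T.r_neg C.X1.ten_closed E1)
  qed
  show ?thesis
    by (rule bij_betw_byWitness[where f' = k])
      (use kg gk additive_closed[OF ka] additive_closed[OF ga] in auto)
qed

lemma gauge_iso: "gauge \<omega> \<in> module_iso D1 (C.X 0) (C.X 1)"
  using gauge_hom gauge_ext gauge_bij by (simp add: module_iso_def)

end

text \<open>The inclusions of \<open>\<epsilon>\<^sub>1(B\<^sup>1 \<otimes> M)\<close>, \<open>\<epsilon>\<^sub>2(B\<^sup>1 \<otimes> M)\<close> and \<open>B\<^sup>2 \<otimes> M\<close> into \<open>D\<^sup>2 B \<otimes> M\<close>, for \<open>u\<close> one of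
  \<open>u1\<close>, \<open>u2\<close>, \<open>u0\<close> below.\<close>

definition inc2 :: "('b \<Rightarrow> nat set \<Rightarrow> 'b) \<Rightarrow> _" where
  "inc2 u = tmap (deg0 B) B (\<lambda>b. b) D2 (\<lambda>a. coface B 1 1 (coface0 B 1 a)) M u"

abbreviation "u1 \<equiv> \<lambda>b. level2 \<zero>\<^bsub>B\<^esub> (hcomp 1 b) \<zero>\<^bsub>B\<^esub> \<zero>\<^bsub>B\<^esub>"
abbreviation "u2 \<equiv> \<lambda>b. level2 \<zero>\<^bsub>B\<^esub> \<zero>\<^bsub>B\<^esub> (hcomp 1 b) \<zero>\<^bsub>B\<^esub>"
abbreviation "u0 \<equiv> \<lambda>b. level2 \<zero>\<^bsub>B\<^esub> \<zero>\<^bsub>B\<^esub> \<zero>\<^bsub>B\<^esub> (hcomp 2 b)"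

lemma u_closed: "b \<in> carrier B \<Longrightarrow> u \<in> {u0, u1, u2} \<Longrightarrow> u b \<in> carrier D2"
  by (auto simp: D2_iff gr_zero hcomp_gr)

lemma inc2_props:
  assumes u: "u \<in> {u0, u1, u2}"
  shows inc2_additive: "inc2 u \<in> additive F.T C.Y"
    and inc2_ten: "\<lbrakk>b \<in> carrier B; m \<in> carrier M\<rbrakk> \<Longrightarrow> inc2 u (b \<otimes>f m) = yt (u b) m"
proof -
  have a: "u \<in> additive B D2"
    using u by (intro additiveI) (auto simp: D2_iff gr_zero hcomp_gr hcomp_add D2_ops)
  have b: "u (s \<otimes>\<^bsub>B\<^esub> a) = u s \<otimes>\<^bsub>D2\<^esub> coface B 1 1 (coface0 B 1 a)"
    if "s \<in> carrier B" "a \<in> carrier (deg0 B)" for s a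
    using that u by (auto simp: coface_identities D2_mult gr_carrier hcomp_closed hcomp_mult0 B.minus_eq B.add.inv_one)
  show "inc2 u \<in> additive F.T C.Y"
    "\<lbrakk>b \<in> carrier B; m \<in> carrier M\<rbrakk> \<Longrightarrow> inc2 u (b \<otimes>f m) = yt (u b) m"
    using F.tmap_props[OF C.Y.tensor_axioms a b, folded inc2_def] by auto
qed

lemma inc2_u0_eq_zero:
  assumes t: "t \<in> form_gr B M 2" and z: "inc2 u0 t = \<zero>\<^bsub>C.Y\<^esub>" shows "t = \<zero>\<^bsub>F.T\<^esub>"
proof -
  define Q where "Q = tmap (deg0 B) D2 (\<lambda>a. coface B 1 1 (coface0 B 1 a)) B (\<lambda>b. b) M (\<lambda>s. s {})"
  have u: "(\<lambda>s. s {}) \<in> additive D2 B"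
    by (rule additiveI; (elim D2_cases)?; hypsubst?) (simp_all add: D2_ops gr_carrier)
  have b: "(s \<otimes>\<^bsub>D2\<^esub> coface B 1 1 (coface0 B 1 a)) {} = s {} \<otimes>\<^bsub>B\<^esub> a"
    if "s \<in> carrier D2" "a \<in> carrier (deg0 B)" for s a
    using that by (elim D2_cases) (simp add: coface_identities D2_mult gr_carrier B.minus_eq B.add.inv_one)
  have Q: "Q \<in> additive C.Y F.T"
    "\<And>s m. \<lbrakk>s \<in> carrier D2; m \<in> carrier M\<rbrakk> \<Longrightarrow> Q (yt s m) = s {} \<otimes>f m"
    using C.Y.tmap_props[OF F.tensor_axioms u b, folded Q_def] by auto
  have "Q (inc2 u0 t) = t"
    by (rule form_gr_eqI[OF additive_comp[OF inc2_additive Q(1)] additive_id F.T_abelian _ t])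
      (simp_all add: inc2_ten Q(2) D2_iff gr_zero gr_carrier hcomp_homogeneous)
  then show ?thesis using z additive_zero[OF Q(1) C.Y.T_abelian F.T_abelian] by simp
qed

lemma push_eps:
  assumes "t \<in> carrier F.T"
  shows "C.push 1 (eps 1 t) = inc2 u1 t" "C.push 2 (eps 1 t) = inc2 u2 t"
proof -
  show "C.push 1 (eps 1 t) = inc2 u1 t"
    by (rule F.additive_eqI[OF additive_comp[OF eps_additive C.push_additive] inc2_additive C.Y.T_abelian _ assms])
      (simp_all add: eps_ten C.push_ten level1_hcomp_closed inc2_ten coface_eq gr_zero hcomp_gr)
  show "C.push 2 (eps 1 t) = inc2 u2 t"
    by (rule F.additive_eqI[OF additive_comp[OF eps_additive C.push_additive] inc2_additive C.Y.T_abelian _ assms])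
      (simp_all add: eps_ten C.push_ten level1_hcomp_closed inc2_ten coface_eq gr_zero hcomp_gr)
qed

lemma push_one: "\<lbrakk>j \<in> {1, 2}; m \<in> carrier M\<rbrakk> \<Longrightarrow> C.push j (xt 1 \<one>\<^bsub>D1\<^esub> m) = yt \<one>\<^bsub>D2\<^esub> m"
  by (subst C.push_ten) (auto simp: C.q_one)

abbreviation cocycle where
  "cocycle g \<equiv> \<forall>m \<in> carrier M. C.push 1 (g (xt 0 \<one>\<^bsub>D1\<^esub> m)) = C.cocycle_rhs g (g (xt 0 \<one>\<^bsub>D1\<^esub> m))"

text \<open>The left-hand side of the cocycle condition is \<open>m + \<epsilon>\<^sub>1 \<omega>(m)\<close>. On the right, \<open>\<partial>\<^sup>2 g\<close> contributes
  \<open>m + \<epsilon>\<^sub>2 \<omega>(m)\<close>, and \<open>\<partial>\<^sup>0(\<epsilon>b) = \<epsilon>\<^sub>1 b - \<epsilon>\<^sub>2 b + \<partial>b\<close> turns \<open>\<epsilon> \<omega>(m)\<close> into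
  \<open>\<epsilon>\<^sub>1 \<omega>(m) - \<epsilon>\<^sub>2 \<omega>(m)\<close> plus a term in \<open>B\<^sup>2 \<otimes> M\<close>. That term collects \<open>\<partial>b \<otimes> m\<close> and the shuffle product
  \<open>(\<epsilon>\<^sub>1 b)(\<epsilon>\<^sub>2 \<omega>(m)) = - b \<omega>(m)\<close>, so it is the covariant derivative of \<open>\<omega>(m)\<close>.\<close>

lemma cocycle_iff_flat:
  assumes g: "g \<in> module_hom D1 (C.X 0) (C.X 1)" and \<omega>: "connection_form \<omega>"
    and g\<omega>: "\<And>m. m \<in> carrier M \<Longrightarrow> g (xt 0 \<one>\<^bsub>D1\<^esub> m) = xt 1 \<one>\<^bsub>D1\<^esub> m \<oplus>\<^bsub>C.X 1\<^esub> eps 1 (\<omega> m)"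
  shows "cocycle g \<longleftrightarrow> (\<forall>m \<in> carrier M. cov \<omega> (\<omega> m) = \<zero>\<^bsub>F.T\<^esub>)"
proof (rule ball_cong[OF refl])
  fix m assume m: "m \<in> carrier M"
  note \<omega>c = \<omega>_closed[OF \<omega>]
  note ra = C.cocycle_rhs_additive[OF g]
  have E1: "eps 1 t \<in> carrier (C.X 1)" if "t \<in> carrier F.T" for t
    using that by (simp add: additive_closed[OF eps_additive])
  have ic: "inc2 u t \<in> carrier C.Y" if "t \<in> carrier F.T" "u \<in> {u0, u1, u2}" for t u
    using additive_closed[OF inc2_additive[OF that(2)] that(1)] .
  have P: "C.push j (xt 1 \<one>\<^bsub>D1\<^esub> m \<oplus>\<^bsub>C.X 1\<^esub> eps 1 t) = yt \<one>\<^bsub>D2\<^esub> m \<oplus>\<^bsub>C.Y\<^esub> C.push j (eps 1 t)"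
    if "j \<in> {1, 2}" "m \<in> carrier M" "t \<in> carrier F.T" for j m t
    using that by (simp only: additive_add[OF C.push_additive] push_one C.X1.ten_closed C.S1.one_closed E1)
  have nil: "level2 \<zero>\<^bsub>B\<^esub> b (\<ominus>\<^bsub>B\<^esub> b) e \<odot>\<^bsub>C.Y\<^esub> inc2 u2 t = inc2 u0 (\<ominus>\<^bsub>F.T\<^esub> (b \<odot>\<^bsub>F.T\<^esub> t))"
    if b: "b \<in> gr B 1" "e \<in> gr B 2" and t: "t \<in> carrier F.T" for b e t
  proof -
    have c: "level2 \<zero>\<^bsub>B\<^esub> b (\<ominus>\<^bsub>B\<^esub> b) e \<in> carrier D2" using b by (simp add: D2_iff gr_zero gr_minus)
    have n: "\<ominus>\<^bsub>F.T\<^esub> (b \<odot>\<^bsub>F.T\<^esub> t) = (\<ominus>\<^bsub>B\<^esub> b) \<odot>\<^bsub>F.T\<^esub> t"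
      using b t by (simp add: F.T.minus_smult gr_carrier)
    have mb: "\<ominus>\<^bsub>B\<^esub> b \<in> carrier B" using b by (simp add: gr_carrier)
    show ?thesis unfolding n
    proof (rule F.additive_eqI[OF additive_comp[OF inc2_additive C.Y.T_smult_additive[OF c]]
        additive_comp[OF F.T_smult_additive[OF mb] inc2_additive] C.Y.T_abelian _ t])
      fix s m assume s: "s \<in> carrier B" "m \<in> carrier M"
      have "hcomp (1 + 1) (\<ominus>\<^bsub>B\<^esub> b \<otimes>\<^bsub>B\<^esub> s) = \<ominus>\<^bsub>B\<^esub> b \<otimes>\<^bsub>B\<^esub> hcomp 1 s"
        by (rule hcomp_mult_left[OF s(1) gr_minus[OF b(1)]])
      then have h: "hcomp 2 (\<ominus>\<^bsub>B\<^esub> b \<otimes>\<^bsub>B\<^esub> s) = \<ominus>\<^bsub>B\<^esub> b \<otimes>\<^bsub>B\<^esub> hcomp 1 s" by (simp only: one_add_one)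
      have hh: "hcomp 2 (\<ominus>\<^bsub>B\<^esub> (b \<otimes>\<^bsub>B\<^esub> s)) = \<ominus>\<^bsub>B\<^esub> (b \<otimes>\<^bsub>B\<^esub> hcomp 1 s)"
        using h s b by (simp add: B.l_minus gr_carrier hcomp_closed)
      have cc: "b \<in> carrier B" "e \<in> carrier B" "hcomp 1 s \<in> carrier B" using b s gr_carrier hcomp_closed by auto
      have uc: "level2 \<zero>\<^bsub>B\<^esub> \<zero>\<^bsub>B\<^esub> (hcomp 1 s) \<zero>\<^bsub>B\<^esub> \<in> carrier D2" using s by (simp add: D2_iff gr_zero hcomp_gr)
      show "level2 \<zero>\<^bsub>B\<^esub> b (\<ominus>\<^bsub>B\<^esub> b) e \<odot>\<^bsub>C.Y\<^esub> inc2 u2 (s \<otimes>f m) = inc2 u0 ((\<ominus>\<^bsub>B\<^esub> b) \<odot>\<^bsub>F.T\<^esub> (s \<otimes>f m))"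
        using s mb cc c by (simp add: F.smult_ten inc2_ten C.Y.smult_ten uc D2_mult hh B.minus_eq B.l_minus)
    qed auto
  qed
  have main: "C.cocycle_rhs g (eps 1 t) = (inc2 u1 t \<oplus>\<^bsub>C.Y\<^esub> \<ominus>\<^bsub>C.Y\<^esub> inc2 u2 t) \<oplus>\<^bsub>C.Y\<^esub> inc2 u0 (cov \<omega> t)"
    if t: "t \<in> form_gr B M 1" for t
  proof (rule form_gr_eqI[OF additive_comp[OF eps_additive ra] additive_sum[OF additive_sum[OF inc2_additive
      additive_uminus[OF inc2_additive]] additive_comp[OF cov_additive[OF \<omega>] inc2_additive]] C.Y.T_abelian _ t])
    fix b m assume b: "b \<in> gr B 1" and m: "m \<in> carrier M"
    have bc: "b \<in> carrier B" "diff B b \<in> carrier B" "diff B b \<in> gr B 2" using b gr_carrier d_closed d_gr1 by auto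
    have c: "level2 \<zero>\<^bsub>B\<^esub> b (\<ominus>\<^bsub>B\<^esub> b) (diff B b) \<in> carrier D2" "level2 \<zero>\<^bsub>B\<^esub> b \<zero>\<^bsub>B\<^esub> \<zero>\<^bsub>B\<^esub> \<in> carrier D2"
      "level2 \<zero>\<^bsub>B\<^esub> \<zero>\<^bsub>B\<^esub> b \<zero>\<^bsub>B\<^esub> \<in> carrier D2" "level2 \<zero>\<^bsub>B\<^esub> \<zero>\<^bsub>B\<^esub> (\<ominus>\<^bsub>B\<^esub> b) \<zero>\<^bsub>B\<^esub> \<in> carrier D2"
      "level2 \<zero>\<^bsub>B\<^esub> \<zero>\<^bsub>B\<^esub> \<zero>\<^bsub>B\<^esub> (diff B b) \<in> carrier D2" "level2 \<zero>\<^bsub>B\<^esub> b (\<ominus>\<^bsub>B\<^esub> b) \<zero>\<^bsub>B\<^esub> \<in> carrier D2"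
      using b bc by (simp_all add: D2_iff gr_zero gr_minus)
    have q: "coface B 1 0 (level1 \<zero>\<^bsub>B\<^esub> b) = level2 \<zero>\<^bsub>B\<^esub> b (\<ominus>\<^bsub>B\<^esub> b) (diff B b)"
      using b bc by (simp add: coface_eq gr_zero d_zero B.minus_eq)
    have "C.cocycle_rhs g (eps 1 (b \<otimes>f m)) = coface B 1 0 (level1 \<zero>\<^bsub>B\<^esub> b) \<odot>\<^bsub>C.Y\<^esub> C.push 2 (g (xt 0 \<one>\<^bsub>D1\<^esub> m))"
      using b bc m C.cocycle_rhs_ten[OF g, of "level1 \<zero>\<^bsub>B\<^esub> b" m]
      by (simp add: eps_ten hcomp_homogeneous D1_iff gr_zero)
    also have "\<dots> = level2 \<zero>\<^bsub>B\<^esub> b (\<ominus>\<^bsub>B\<^esub> b) (diff B b) \<odot>\<^bsub>C.Y\<^esub> (yt \<one>\<^bsub>D2\<^esub> m \<oplus>\<^bsub>C.Y\<^esub> inc2 u2 (\<omega> m))"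
      using m by (simp add: q g\<omega> P \<omega>c push_eps)
    also have "\<dots> = yt (level2 \<zero>\<^bsub>B\<^esub> b (\<ominus>\<^bsub>B\<^esub> b) (diff B b)) m \<oplus>\<^bsub>C.Y\<^esub> inc2 u0 (\<ominus>\<^bsub>F.T\<^esub> (b \<odot>\<^bsub>F.T\<^esub> \<omega> m))"
      using m b bc c by (simp add: C.Y.T.smult_r_distr C.Y.ten_closed ic \<omega>c C.Y.smult_ten nil)
    also have "yt (level2 \<zero>\<^bsub>B\<^esub> b (\<ominus>\<^bsub>B\<^esub> b) (diff B b)) m =
      (yt (level2 \<zero>\<^bsub>B\<^esub> b \<zero>\<^bsub>B\<^esub> \<zero>\<^bsub>B\<^esub>) m \<oplus>\<^bsub>C.Y\<^esub> yt (level2 \<zero>\<^bsub>B\<^esub> \<zero>\<^bsub>B\<^esub> (\<ominus>\<^bsub>B\<^esub> b) \<zero>\<^bsub>B\<^esub>) m) \<oplus>\<^bsub>C.Y\<^esub> yt (level2 \<zero>\<^bsub>B\<^esub> \<zero>\<^bsub>B\<^esub> \<zero>\<^bsub>B\<^esub> (diff B b)) m"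
      using m c bc by (simp add: D2_ops flip: C.Y.ten_add_left)
    also have "yt (level2 \<zero>\<^bsub>B\<^esub> \<zero>\<^bsub>B\<^esub> (\<ominus>\<^bsub>B\<^esub> b) \<zero>\<^bsub>B\<^esub>) m = \<ominus>\<^bsub>C.Y\<^esub> yt (level2 \<zero>\<^bsub>B\<^esub> \<zero>\<^bsub>B\<^esub> b \<zero>\<^bsub>B\<^esub>) m"
    proof -
      have "\<ominus>\<^bsub>D2\<^esub> level2 \<zero>\<^bsub>B\<^esub> \<zero>\<^bsub>B\<^esub> b \<zero>\<^bsub>B\<^esub> = level2 \<zero>\<^bsub>B\<^esub> \<zero>\<^bsub>B\<^esub> (\<ominus>\<^bsub>B\<^esub> b) \<zero>\<^bsub>B\<^esub>"
        by (rule C.S2.minus_equality) (use c bc in \<open>simp_all add: D2_ops B.l_neg\<close>)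
      then show ?thesis using C.Y.ten_minus_left[OF m c(3)] by simp
    qed
    finally have "C.cocycle_rhs g (eps 1 (b \<otimes>f m)) = ((inc2 u1 (b \<otimes>f m) \<oplus>\<^bsub>C.Y\<^esub> \<ominus>\<^bsub>C.Y\<^esub> inc2 u2 (b \<otimes>f m)) \<oplus>\<^bsub>C.Y\<^esub>
        inc2 u0 (diff B b \<otimes>f m)) \<oplus>\<^bsub>C.Y\<^esub> inc2 u0 (\<ominus>\<^bsub>F.T\<^esub> (b \<odot>\<^bsub>F.T\<^esub> \<omega> m))"
      using b bc m by (simp add: inc2_ten hcomp_homogeneous)
    also have "\<dots> = (inc2 u1 (b \<otimes>f m) \<oplus>\<^bsub>C.Y\<^esub> \<ominus>\<^bsub>C.Y\<^esub> inc2 u2 (b \<otimes>f m)) \<oplus>\<^bsub>C.Y\<^esub>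
        inc2 u0 (diff B b \<otimes>f m \<oplus>\<^bsub>F.T\<^esub> \<ominus>\<^bsub>F.T\<^esub> (b \<odot>\<^bsub>F.T\<^esub> \<omega> m))"
      using b bc m by (simp add: additive_add[OF inc2_additive] F.ten_closed F.T.smult_closed \<omega>c ic C.Y.T.a_assoc)
    also have "diff B b \<otimes>f m \<oplus>\<^bsub>F.T\<^esub> \<ominus>\<^bsub>F.T\<^esub> (b \<odot>\<^bsub>F.T\<^esub> \<omega> m) = cov \<omega> (b \<otimes>f m)"
      using b bc m by (simp add: cov_ten[OF \<omega>] bar_homogeneous F.T.minus_smult \<omega>c)
    finally show "C.cocycle_rhs g (eps 1 (b \<otimes>f m)) = (inc2 u1 (b \<otimes>f m) \<oplus>\<^bsub>C.Y\<^esub> \<ominus>\<^bsub>C.Y\<^esub> inc2 u2 (b \<otimes>f m)) \<oplus>\<^bsub>C.Y\<^esub> inc2 u0 (cov \<omega> (b \<otimes>f m))" .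
  qed (auto simp: C.Y.T_abelian)
  let ?w = "\<omega> m"
  let ?y = "yt \<one>\<^bsub>D2\<^esub> m"
  have c: "?y \<in> carrier C.Y" "?w \<in> carrier F.T" "cov \<omega> ?w \<in> carrier F.T"
    using m by (auto simp: C.Y.ten_closed \<omega>c cov_closed[OF \<omega>])
  note i = ic[OF c(2), of u1, simplified] ic[OF c(2), of u2, simplified] ic[OF c(3), of u0, simplified]
  have one: "C.cocycle_rhs g (xt 1 \<one>\<^bsub>D1\<^esub> m) = ?y \<oplus>\<^bsub>C.Y\<^esub> inc2 u2 ?w"
    using m c i C.cocycle_rhs_ten[OF g, of "\<one>\<^bsub>D1\<^esub>" m]
    by (simp add: C.q_one g\<omega> P push_eps C.Y.T.smult_one)
  have "C.push 1 (g (xt 0 \<one>\<^bsub>D1\<^esub> m)) = ?y \<oplus>\<^bsub>C.Y\<^esub> inc2 u1 ?w"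
    using m c by (simp add: g\<omega> P push_eps)
  moreover have "C.cocycle_rhs g (g (xt 0 \<one>\<^bsub>D1\<^esub> m)) =
     (?y \<oplus>\<^bsub>C.Y\<^esub> inc2 u2 ?w) \<oplus>\<^bsub>C.Y\<^esub> ((inc2 u1 ?w \<oplus>\<^bsub>C.Y\<^esub> \<ominus>\<^bsub>C.Y\<^esub> inc2 u2 ?w) \<oplus>\<^bsub>C.Y\<^esub> inc2 u0 (cov \<omega> ?w))"
    using m c by (simp add: g\<omega> additive_add[OF ra] C.X1.ten_closed E1 one main \<omega>_gr[OF \<omega>])
  moreover have "\<dots> = (?y \<oplus>\<^bsub>C.Y\<^esub> inc2 u1 ?w) \<oplus>\<^bsub>C.Y\<^esub> inc2 u0 (cov \<omega> ?w)"
    using c i by (simp add: C.Y.T.cancel_middle)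
  moreover have "(?y \<oplus>\<^bsub>C.Y\<^esub> inc2 u1 ?w = (?y \<oplus>\<^bsub>C.Y\<^esub> inc2 u1 ?w) \<oplus>\<^bsub>C.Y\<^esub> inc2 u0 (cov \<omega> ?w)) \<longleftrightarrow> inc2 u0 (cov \<omega> ?w) = \<zero>\<^bsub>C.Y\<^esub>"
    using c i by (metis C.Y.T.add.r_cancel_one' C.Y.T.a_comm C.Y.T.a_closed C.Y.T.add.l_cancel_one)
  moreover have "inc2 u0 (cov \<omega> ?w) = \<zero>\<^bsub>C.Y\<^esub> \<longleftrightarrow> cov \<omega> ?w = \<zero>\<^bsub>F.T\<^esub>"
  proof
    have "cov \<omega> ?w \<in> form_gr B M (Suc 1)" by (rule cov_gr[OF \<omega> \<omega>_gr[OF \<omega> m]])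
    then have "cov \<omega> ?w \<in> form_gr B M 2" by (simp only: Suc_1)
    then show "inc2 u0 (cov \<omega> ?w) = \<zero>\<^bsub>C.Y\<^esub> \<Longrightarrow> cov \<omega> ?w = \<zero>\<^bsub>F.T\<^esub>" by (rule inc2_u0_eq_zero)
    show "cov \<omega> ?w = \<zero>\<^bsub>F.T\<^esub> \<Longrightarrow> inc2 u0 (cov \<omega> ?w) = \<zero>\<^bsub>C.Y\<^esub>"
      by (simp add: additive_zero[OF inc2_additive F.T_abelian C.Y.T_abelian])
  qed
  ultimately show "(C.push 1 (g (xt 0 \<one>\<^bsub>D1\<^esub> m)) = C.cocycle_rhs g (g (xt 0 \<one>\<^bsub>D1\<^esub> m))) \<longleftrightarrow> cov \<omega> (\<omega> m) = \<zero>\<^bsub>F.T\<^esub>"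
    by simp
qed

definition gauge_form where "gauge_form g m = coeff (g (xt 0 \<one>\<^bsub>D1\<^esub> m))"

text \<open>Modulo the augmentation ideals the cocycle condition says that \<open>\<gamma>\<close>, the reduction of \<open>g\<close>, is idempotent.
  Surjectivity of \<open>g\<close> passes to \<open>\<gamma>\<close>, and a surjective idempotent is the identity.\<close>

lemma cocycle_unipotent:
  assumes g: "g \<in> module_iso D1 (C.X 0) (C.X 1)" and coc: "cocycle g" and m: "m \<in> carrier M"
  shows "red 1 (g (xt 0 \<one>\<^bsub>D1\<^esub> m)) = m"
proof -
  have gh: "g \<in> module_hom D1 (C.X 0) (C.X 1)" and gb: "bij_betw g (carrier (C.X 0)) (carrier (C.X 1))"
    using g by (auto simp: module_iso_def)
  note ga = module_hom_additive[OF gh]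
  have gc: "g (xt 0 \<one>\<^bsub>D1\<^esub> m) \<in> carrier (C.X 1)" if "m \<in> carrier M" for m
    using that by (simp add: additive_closed[OF ga] C.X0.ten_closed)
  define \<gamma> where "\<gamma> m = red 1 (g (xt 0 \<one>\<^bsub>D1\<^esub> m))" for m
  have \<gamma>a: "\<gamma> \<in> additive M M"
    unfolding \<gamma>_def by (intro additive_comp[OF additive_comp[OF C.X0.ten_additive_right ga] red_additive]) auto
  have \<gamma>s: "\<gamma> (a \<odot>\<^bsub>M\<^esub> m) = a \<odot>\<^bsub>M\<^esub> \<gamma> m" if "a \<in> gr B 0" "m \<in> carrier M" for a m
    using that by (simp add: \<gamma>_def C.X0.one_ten_smult module_hom_smult[OF gh] C.X0.\<phi>_closed C.X0.ten_closed
        red_smult gc coface0_eq D1_iff d_gr0)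
  have mg: "red 1 (g x) = \<gamma> (red 0 x)" if x: "x \<in> carrier (C.X 0)" for x
  proof (rule C.X0.additive_eqI[OF additive_comp[OF ga red_additive] additive_comp[OF red_additive \<gamma>a] M.M.abelian_group_axioms _ x])
    fix s m assume s: "s \<in> carrier D1" "m \<in> carrier M"
    then have "s {1} \<in> gr B 0" by (auto elim: D1_cases)
    then show "red 1 (g (xt 0 s m)) = \<gamma> (red 0 (xt 0 s m))"
      using s by (simp add: C.X0.ten_eq_smult[of s] module_hom_smult[OF gh] C.X0.ten_closed red_smult gc \<gamma>s red_one
          flip: \<gamma>_def)
  qed auto
  have mp: "red2 (C.push j x) = red 1 x" if j: "j \<in> {1, 2}" and x: "x \<in> carrier (C.X 1)" for j x
  proof (rule C.X1.additive_eqI[OF additive_comp[OF C.push_additive[OF j] red2_additive] red_additive M.M.abelian_group_axioms _ x])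
    fix s m assume s: "s \<in> carrier D1" "m \<in> carrier M"
    then have "coface B 1 j s {1, 2} = s {1}" using j by (auto elim!: D1_cases simp: coface_eq)
    moreover have "coface B 1 j s \<in> carrier D2" using j s C.q_closed[of j s] by auto
    ultimately show "red2 (C.push j (xt 1 s m)) = red 1 (xt 1 s m)"
      using s j by (simp add: C.push_ten[OF j] red2_ten red_ten)
  qed auto
  have mr: "red2 (C.cocycle_rhs g x) = \<gamma> (red 1 x)" if x: "x \<in> carrier (C.X 1)" for x
  proof (rule C.X1.additive_eqI[OF additive_comp[OF C.cocycle_rhs_additive[OF gh] red2_additive]
      additive_comp[OF red_additive \<gamma>a] M.M.abelian_group_axioms _ x])
    fix s m assume s: "s \<in> carrier D1" "m \<in> carrier M"
    then have "coface B 1 0 s {1, 2} = s {1}" "s {1} \<in> gr B 0" by (auto elim!: D1_cases simp: coface_eq)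
    moreover have "coface B 1 0 s \<in> carrier D2" using s C.q_closed[of 0 s] by auto
    moreover have "C.push 2 (g (xt 0 \<one>\<^bsub>D1\<^esub> m)) \<in> carrier C.Y"
      using s gc additive_closed[OF C.push_additive] by blast
    ultimately show "red2 (C.cocycle_rhs g (xt 1 s m)) = \<gamma> (red 1 (xt 1 s m))"
      using s by (simp add: C.cocycle_rhs_ten[OF gh] red2_smult mp gc red_ten \<gamma>s flip: \<gamma>_def)
  qed auto
  have idem: "\<gamma> m = \<gamma> (\<gamma> m)" if "m \<in> carrier M" for m
    using coc that mp[OF _ gc, of 1 m] mr[OF gc, of m] by (simp add: \<gamma>_def)
  have "xt 1 \<one>\<^bsub>D1\<^esub> m \<in> carrier (C.X 1)" using m by (simp add: C.X1.ten_closed)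
  then have "xt 1 \<one>\<^bsub>D1\<^esub> m \<in> g ` carrier (C.X 0)"
    unfolding bij_betw_imp_surj_on[OF gb] .
  then obtain x where x: "xt 1 \<one>\<^bsub>D1\<^esub> m = g x" "x \<in> carrier (C.X 0)" ..
  have "red 1 (g x) = m" unfolding x(1)[symmetric] using m by (simp add: red_one)
  then have e: "m = \<gamma> (red 0 x)" using mg[OF x(2)] by simp
  have "red 0 x \<in> carrier M" using x by (simp add: additive_closed[OF red_additive])
  then show ?thesis using idem e by (metis \<gamma>_def)
qed

text \<open>Linearity of \<open>g\<close> over \<open>\<partial>\<^sup>0 a = a + \<epsilon> \<partial>a\<close> is the Leibniz rule for its \<open>\<epsilon>\<close>-coefficient.\<close>

lemma gauge_form_props:
  assumes g: "g \<in> module_iso D1 (C.X 0) (C.X 1)" and coc: "cocycle g"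
  shows gauge_form_one: "m \<in> carrier M \<Longrightarrow>
      g (xt 0 \<one>\<^bsub>D1\<^esub> m) = xt 1 \<one>\<^bsub>D1\<^esub> m \<oplus>\<^bsub>C.X 1\<^esub> eps 1 (gauge_form g m)"
    and gauge_form: "connection_form (gauge_form g)"
    and gauge_form_flat: "m \<in> carrier M \<Longrightarrow> cov (gauge_form g) (gauge_form g m) = \<zero>\<^bsub>F.T\<^esub>"
proof -
  have gh: "g \<in> module_hom D1 (C.X 0) (C.X 1)"
    using g by (auto simp: module_iso_def)
  note ga = module_hom_additive[OF gh]
  have gc: "g (xt 0 \<one>\<^bsub>D1\<^esub> m) \<in> carrier (C.X 1)" if "m \<in> carrier M" for m
    using that by (simp add: additive_closed[OF ga] C.X0.ten_closed)
  show 1: "g (xt 0 \<one>\<^bsub>D1\<^esub> m) = xt 1 \<one>\<^bsub>D1\<^esub> m \<oplus>\<^bsub>C.X 1\<^esub> eps 1 (gauge_form g m)" if "m \<in> carrier M" for m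
    using X1_decomp[OF gc[OF that]] cocycle_unipotent[OF g coc that] by (simp add: gauge_form_def)
  show 2: "connection_form (gauge_form g)"
    unfolding connection_form_def
  proof (intro conjI ballI)
    show "gauge_form g \<in> additive M F.T"
      unfolding gauge_form_def[abs_def]
      by (intro additive_comp[OF additive_comp[OF C.X0.ten_additive_right ga] coeff_additive]) auto
    fix m assume m: "m \<in> carrier M"
    show w: "gauge_form g m \<in> form_gr B M 1" unfolding gauge_form_def by (rule coeff_gr[OF gc[OF m]])
    note wc = form_gr_closed[OF w]
    fix a assume a: "a \<in> gr B 0"
    have c: "level1 a (diff B a) \<in> carrier D1" using a by (simp add: D1_iff d_gr0)
    have E1: "eps 1 t \<in> carrier (C.X 1)" if "t \<in> carrier F.T" for t
      using that by (simp add: additive_closed[OF eps_additive])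
    have "g (xt 0 \<one>\<^bsub>D1\<^esub> (a \<odot>\<^bsub>M\<^esub> m)) = level1 a (diff B a) \<odot>\<^bsub>C.X 1\<^esub> g (xt 0 \<one>\<^bsub>D1\<^esub> m)"
      using a m c by (simp add: C.X0.one_ten_smult module_hom_smult[OF gh] C.X0.ten_closed coface0_eq)
    also have "\<dots> = xt 1 (level1 a (diff B a)) m \<oplus>\<^bsub>C.X 1\<^esub> eps 1 (a \<odot>\<^bsub>F.T\<^esub> gauge_form g m)"
      using a m c wc by (simp add: 1 C.X1.T.smult_r_distr C.X1.ten_closed E1 C.X1.smult_ten eps_smult d_gr0)
    finally have "gauge_form g (a \<odot>\<^bsub>M\<^esub> m) = coeff (xt 1 (level1 a (diff B a)) m \<oplus>\<^bsub>C.X 1\<^esub> eps 1 (a \<odot>\<^bsub>F.T\<^esub> gauge_form g m))"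
      by (simp add: gauge_form_def)
    also have "\<dots> = diff B a \<otimes>f m \<oplus>\<^bsub>F.T\<^esub> a \<odot>\<^bsub>F.T\<^esub> gauge_form g m"
      using a m c wc form_gr_smult[OF a w]
      by (simp add: additive_add[OF coeff_additive] C.X1.ten_closed E1 F.T.smult_closed gr_carrier coeff_ten coeff_eps)
    finally show "gauge_form g (a \<odot>\<^bsub>M\<^esub> m) = a \<odot>\<^bsub>F.T\<^esub> gauge_form g m \<oplus>\<^bsub>F.T\<^esub> diff B a \<otimes>f m"
      using a m wc by (simp add: F.T.a_comm F.T.smult_closed F.ten_closed gr_carrier d_closed)
  qed
  show "m \<in> carrier M \<Longrightarrow> cov (gauge_form g) (gauge_form g m) = \<zero>\<^bsub>F.T\<^esub>"
    using cocycle_iff_flat[OF gh 2 1] coc by blast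
qed

end

section \<open>The equivalence\<close>

context tensor begin

lemma base_change_map_id:
  assumes t: "t \<in> carrier T"
  shows "base_change_map R S \<phi> M M (\<lambda>x \<in> carrier M. x) t = t"
proof -
  have "(\<lambda>x \<in> carrier M. x) \<in> module_hom R M M"
    by (auto simp: module_hom_def smult_closed)
  note * = base_change_map_props[OF lmod_axioms this]
  show ?thesis
    by (rule additive_eqI[OF module_hom_additive[OF *(2)] additive_id T_abelian _ t]) (simp add: *(3))
qed

lemma base_change_map_compose:
  assumes M': "lmod R M'" and M'': "lmod R M''" and f: "f \<in> module_hom R M M'" and g: "g \<in> module_hom R M' M''"
    and t: "t \<in> carrier T"
  shows "base_change_map R S \<phi> M M'' (compose (carrier M) g f) t =
    base_change_map R S \<phi> M' M'' g (base_change_map R S \<phi> M M' f t)"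
proof -
  interpret T': tensor R S \<phi> M'
    using M' by (intro tensor.intro tensor_axioms.intro \<phi>_hom S.ring_axioms)
  interpret T'': tensor R S \<phi> M''
    using M'' by (intro tensor.intro tensor_axioms.intro \<phi>_hom S.ring_axioms)
  have gf: "compose (carrier M) g f \<in> module_hom R M M''"
    using f g by (auto simp: module_hom_def compose_def Pi_iff smult_closed)
  note F = base_change_map_props[OF M' f] and G = T'.base_change_map_props[OF M'' g] and GF = base_change_map_props[OF M'' gf]
  show ?thesis
    by (rule additive_eqI[OF module_hom_additive[OF GF(2)]
          additive_comp[OF module_hom_additive[OF F(2)] module_hom_additive[OF G(2)]] T''.T_abelian _ t])
      (simp add: GF(3) F(3) G(3) compose_eq additive_closed[OF module_hom_additive[OF f]])
qed

end

text \<open>A groupoid of pairs \<open>X\<close> of a module \<open>M\<close> and a structure on it, which enters the morphisms only through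
  a map \<open>W X : M \<rightarrow> A \<otimes> M\<close>. Both descent data and flat connections are of this form, with \<open>W X\<close> the
  connection form.\<close>

locale connection_groupoid =
  fixes S :: "('a, 'p) ring_scheme" and A :: "('s, 'q) ring_scheme" and \<phi> :: "'a \<Rightarrow> 's"
    and G :: "(('a, 'm) module \<times> 'c, 'm \<Rightarrow> 'm) gpd"
    and W :: "('a, 'm) module \<times> 'c \<Rightarrow> 'm \<Rightarrow> ('s \<times> 'm \<Rightarrow>\<^sub>0 int) set"
  assumes Ob_tensor: "X \<in> Ob G \<Longrightarrow> tensor S A \<phi> (fst X)"
    and W_closed: "\<lbrakk>X \<in> Ob G; m \<in> carrier (fst X)\<rbrakk> \<Longrightarrow> W X m \<in> carrier (base_change S A \<phi> (fst X))"
    and Hom_iff: "\<lbrakk>X \<in> Ob G; Y \<in> Ob G\<rbrakk> \<Longrightarrow> h \<in> Hom G X Y \<longleftrightarrow> h \<in> module_iso S (fst X) (fst Y) \<and>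
       (\<forall>m \<in> carrier (fst X). W Y (h m) = base_change_map S A \<phi> (fst X) (fst Y) h (W X m))"
    and Comp_eq: "Comp G X = compose (carrier (fst X))"
    and Ident_eq: "Ident G X = (\<lambda>x \<in> carrier (fst X). x)"
begin

lemma id_in_Hom:
  assumes "X \<in> Ob G" "Y \<in> Ob G" "fst Y = fst X" "\<And>m. m \<in> carrier (fst X) \<Longrightarrow> W Y m = W X m"
  shows "Ident G X \<in> Hom G X Y"
proof -
  interpret X: tensor S A \<phi> "fst X" by (rule Ob_tensor[OF assms(1)])
  show ?thesis
    using assms by (auto simp: Hom_iff Ident_eq module_iso_def module_hom_def X.smult_closed X.base_change_map_id W_closed bij_betw_def inj_on_def)
qed

lemma groupoid: "groupoid G"
proof (unfold_locales, goal_cases)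
  case (1 X Y Z f g)
  interpret X: tensor S A \<phi> "fst X" by (rule Ob_tensor[OF 1(1)])
  interpret Y: tensor S A \<phi> "fst Y" by (rule Ob_tensor[OF 1(2)])
  interpret Z: tensor S A \<phi> "fst Z" by (rule Ob_tensor[OF 1(3)])
  have f: "f \<in> module_hom S (fst X) (fst Y)" "bij_betw f (carrier (fst X)) (carrier (fst Y))"
    and Wf: "\<And>m. m \<in> carrier (fst X) \<Longrightarrow> W Y (f m) = base_change_map S A \<phi> (fst X) (fst Y) f (W X m)"
    using 1 by (auto simp: Hom_iff module_iso_def)
  have g: "g \<in> module_hom S (fst Y) (fst Z)" "bij_betw g (carrier (fst Y)) (carrier (fst Z))"
    and Wg: "\<And>m. m \<in> carrier (fst Y) \<Longrightarrow> W Z (g m) = base_change_map S A \<phi> (fst Y) (fst Z) g (W Y m)"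
    using 1 by (auto simp: Hom_iff module_iso_def)
  have fc: "f m \<in> carrier (fst Y)" if "m \<in> carrier (fst X)" for m
    using that by (rule additive_closed[OF module_hom_additive[OF f(1)]])
  have "compose (carrier (fst X)) g f \<in> module_hom S (fst X) (fst Z)"
    using f g by (auto simp: module_hom_def compose_def Pi_iff X.smult_closed)
  moreover have "bij_betw (compose (carrier (fst X)) g f) (carrier (fst X)) (carrier (fst Z))"
    by (rule bij_betw_compose[OF f(2) g(2)])
  ultimately show ?case
    using 1 fc by (simp add: Hom_iff Comp_eq module_iso_def compose_eq Wg Wf
        X.base_change_map_compose[OF Y.lmod_axioms Z.lmod_axioms f(1) g(1)] W_closed)
next
  case (2 X Y Z V f g h)
  then have "f \<in> carrier (fst X) \<rightarrow> carrier (fst Y)" by (auto simp: Hom_iff module_iso_def module_hom_def)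
  then show ?case by (auto simp: Comp_eq compose_def fun_eq_iff Pi_iff)
next
  case (3 X)
  then show ?case by (intro id_in_Hom) auto
next
  case (4 X Y f)
  then show ?case by (auto simp: Hom_iff module_iso_def module_hom_def Comp_eq Ident_eq intro: Id_compose)
next
  case (5 X Y f)
  then show ?case by (auto simp: Hom_iff module_iso_def module_hom_def Comp_eq Ident_eq intro: compose_Id)
next
  case (6 X Y f)
  interpret X: tensor S A \<phi> "fst X" by (rule Ob_tensor[OF 6(1)])
  interpret Y: tensor S A \<phi> "fst Y" by (rule Ob_tensor[OF 6(2)])
  let ?M = "carrier (fst X)" and ?N = "carrier (fst Y)"
  have f: "f \<in> module_hom S (fst X) (fst Y)" "bij_betw f ?M ?N" "f \<in> extensional ?M"
    and Wf: "\<And>m. m \<in> ?M \<Longrightarrow> W Y (f m) = base_change_map S A \<phi> (fst X) (fst Y) f (W X m)"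
    using 6 by (auto simp: Hom_iff module_iso_def)
  note fa = module_hom_additive[OF f(1)]
  define g where "g = (\<lambda>y \<in> ?N. inv_into ?M f y)"
  have gc: "g y \<in> ?M" and fg: "f (g y) = y" if "y \<in> ?N" for y
    using that bij_betw_imp_surj_on[OF f(2)] by (auto simp: g_def inv_into_into f_inv_into_f)
  have gf: "g (f x) = x" if "x \<in> ?M" for x
    using that additive_closed[OF fa that] by (simp add: g_def inv_into_f_f[OF bij_betw_imp_inj_on[OF f(2)]])
  have inj: "x = x'" if "f x = f x'" "x \<in> ?M" "x' \<in> ?M" for x x'
    using arg_cong[OF that(1), of g] by (simp add: gf that(2,3))
  have gh: "g \<in> module_hom S (fst Y) (fst X)"
  proof (intro module_homI additiveI)
    fix x y assume "x \<in> ?N" "y \<in> ?N"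
    then show "g (x \<oplus>\<^bsub>fst Y\<^esub> y) = g x \<oplus>\<^bsub>fst X\<^esub> g y"
      by - (rule inj, simp_all add: fg gc additive_add[OF fa])
  next
    fix a x assume "a \<in> carrier S" "x \<in> ?N"
    then show "g (a \<odot>\<^bsub>fst Y\<^esub> x) = a \<odot>\<^bsub>fst X\<^esub> g x"
      by - (rule inj, simp_all add: fg gc module_hom_smult[OF f(1)] X.smult_closed Y.smult_closed)
  qed (rule gc)
  have gfid: "compose ?M g f = (\<lambda>x \<in> ?M. x)" and fgid: "compose ?N f g = (\<lambda>x \<in> ?N. x)"
    by (auto simp: compose_def fun_eq_iff fg gf)
  have Wg: "W X (g y) = base_change_map S A \<phi> (fst Y) (fst X) g (W Y y)" if y: "y \<in> ?N" for y
    using Wf[OF gc[OF y]] X.base_change_map_compose[OF Y.lmod_axioms X.lmod_axioms f(1) gh, of "W X (g y)"] y gc[OF y] 6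
    by (simp add: fg gfid W_closed X.base_change_map_id)
  have "bij_betw g ?N ?M"
    by (rule bij_betw_byWitness[where f' = f]) (use gc gf fg additive_closed[OF fa] in auto)
  then have "g \<in> Hom G Y X"
    using 6 gh Wg by (simp add: Hom_iff module_iso_def) (simp add: g_def)
  then show ?case
    by (intro bexI[of _ g]) (simp_all add: Comp_eq Ident_eq gfid fgid)
qed

end

text \<open>Functors that keep the module and its form act as the identity on morphisms, and the identity maps
  of the modules are the required natural transformations.\<close>

lemma equivalent_connection_groupoids:
  assumes G: "connection_groupoid S A \<phi> G W" and H: "connection_groupoid S A \<phi> H V"
    and \<Phi>: "\<And>X. X \<in> Ob G \<Longrightarrow> \<Phi> X \<in> Ob H \<and> fst (\<Phi> X) = fst X \<and> (\<forall>m \<in> carrier (fst X). V (\<Phi> X) m = W X m)"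
    and \<Psi>: "\<And>Y. Y \<in> Ob H \<Longrightarrow> \<Psi> Y \<in> Ob G \<and> fst (\<Psi> Y) = fst Y \<and> (\<forall>m \<in> carrier (fst Y). W (\<Psi> Y) m = V Y m)"
  shows "equivalent_groupoids G H"
proof -
  interpret G: connection_groupoid S A \<phi> G W by fact
  interpret H: connection_groupoid S A \<phi> H V by fact
  interpret Gg: groupoid G by (rule G.groupoid)
  interpret Hg: groupoid H by (rule H.groupoid)
  have iso: "h m \<in> carrier N" if "h \<in> module_iso S M N" "m \<in> carrier M" for h m and M N :: "('a, 'm) module"
    using that by (auto simp: module_iso_def module_hom_def)
  have HomG: "h \<in> Hom H (\<Phi> X) (\<Phi> Y) \<longleftrightarrow> h \<in> Hom G X Y" if "X \<in> Ob G" "Y \<in> Ob G" for X Y h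
  proof -
    have "V (\<Phi> Y) (h m) = W Y (h m)" if "h \<in> module_iso S (fst X) (fst Y)" "m \<in> carrier (fst X)" for m
      using \<Phi>[OF \<open>Y \<in> Ob G\<close>] iso[OF that] by blast
    then show ?thesis
      using that \<Phi>[OF that(1)] \<Phi>[OF that(2)] by (simp add: G.Hom_iff H.Hom_iff cong: conj_cong)
  qed
  have HomH: "h \<in> Hom G (\<Psi> X) (\<Psi> Y) \<longleftrightarrow> h \<in> Hom H X Y" if "X \<in> Ob H" "Y \<in> Ob H" for X Y h
  proof -
    have "W (\<Psi> Y) (h m) = V Y (h m)" if "h \<in> module_iso S (fst X) (fst Y)" "m \<in> carrier (fst X)" for m
      using \<Psi>[OF \<open>Y \<in> Ob H\<close>] iso[OF that] by blast
    then show ?thesis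
      using that \<Psi>[OF that(1)] \<Psi>[OF that(2)] by (simp add: G.Hom_iff H.Hom_iff cong: conj_cong)
  qed
  let ?F = "\<lparr>fob = \<Phi>, fmor = (\<lambda>x y f. f)\<rparr>" and ?F' = "\<lparr>fob = \<Psi>, fmor = (\<lambda>x y f. f)\<rparr>"
  have "gpd_functor G H ?F"
    by unfold_locales (simp_all add: \<Phi> HomG G.Ident_eq H.Ident_eq G.Comp_eq H.Comp_eq)
  moreover have "gpd_functor H G ?F'"
    by unfold_locales (simp_all add: \<Psi> HomH G.Ident_eq H.Ident_eq G.Comp_eq H.Comp_eq)
  moreover have "natural_trans G G id_fun (comp_fun ?F' ?F) (Ident G)"
  proof -
    have "Ident G X \<in> Hom G X (\<Psi> (\<Phi> X))" if X: "X \<in> Ob G" for X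
      by (rule G.id_in_Hom) (use X \<Phi> \<Psi> in simp_all)
    then show ?thesis
      unfolding natural_trans_def id_fun_def comp_fun_def
      by (simp add: Gg.Ident_left Gg.Ident_right)
  qed
  moreover have "natural_trans H H (comp_fun ?F ?F') id_fun (Ident H)"
  proof -
    have *: "Comp H (\<Phi> (\<Psi> X)) = Comp H X" if "X \<in> Ob H" for X
      using that \<Phi> \<Psi> by (simp add: H.Comp_eq)
    have "Ident H X \<in> Hom H (\<Phi> (\<Psi> X)) X" if X: "X \<in> Ob H" for X
    proof -
      have "Ident H (\<Phi> (\<Psi> X)) \<in> Hom H (\<Phi> (\<Psi> X)) X"
        by (rule H.id_in_Hom) (use X \<Phi> \<Psi> in simp_all)
      then show ?thesis using X \<Phi> \<Psi> by (simp add: H.Ident_eq)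
    qed
    then show ?thesis
      unfolding natural_trans_def id_fun_def comp_fun_def
      by (simp add: * Hg.Ident_left Hg.Ident_right)
  qed
  ultimately show ?thesis
    unfolding equivalent_groupoids_def using G.groupoid H.groupoid by blast
qed

locale dg_module_pair = M: dg_module R B M + N: dg_module R B N
  for R :: "('r, 'x) ring_scheme" and B :: "('r, 'b, 'y) dg_alg_scheme" and M N :: "('b, 'm) module" +
  fixes h assumes h: "h \<in> module_hom (deg0 B) M N"
begin

lemma h_closed: "m \<in> carrier M \<Longrightarrow> h m \<in> carrier N"
  using additive_closed[OF module_hom_additive[OF h]] .

definition hT where "hT = base_change_map (deg0 B) B (\<lambda>b. b) M N h"
definition hX where "hX i = base_change_map (deg0 B) (denorm B 1) (coface0 B i) M N h"

lemmas hT = M.F.base_change_map_props[OF N.M.lmod_axioms h, folded hT_def]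
lemmas hX0 = M.C.X0.base_change_map_props[OF N.M.lmod_axioms h, folded hX_def]
lemmas hX1 = M.C.X1.base_change_map_props[OF N.M.lmod_axioms h, folded hX_def]
lemmas hTa = module_hom_additive[OF hT(2)]
lemmas hX0a = module_hom_additive[OF hX0(2)]
lemmas hX1a = module_hom_additive[OF hX1(2)]

lemma hT_gr: "t \<in> form_gr B M p \<Longrightarrow> hT t \<in> form_gr B N p"
proof (induction rule: M.form_gr_induct)
  case (ten b m)
  then show ?case by (simp add: hT(3) M.gr_carrier N.form_gr_ten h_closed)
qed (simp_all add: additive_zero[OF hTa M.F.T_abelian N.F.T_abelian] additive_add[OF hTa]
    additive_minus[OF hTa M.F.T_abelian N.F.T_abelian] N.form_gr_zero N.form_gr_add N.form_gr_minus)

text \<open>By the Leibniz rule it suffices to compare the two sides on \<open>1 \<otimes> m\<close>.\<close>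

lemma cov_natural_iff:
  assumes \<omega>: "M.connection_form \<omega>" and \<omega>': "N.connection_form \<omega>'"
  shows "(\<forall>t \<in> carrier M.F.T. hT (M.cov \<omega> t) = N.cov \<omega>' (hT t)) \<longleftrightarrow>
    (\<forall>m \<in> carrier M. \<omega>' (h m) = hT (\<omega> m))" (is "?l \<longleftrightarrow> ?r")
proof
  assume ?l
  show ?r
  proof
    fix m assume m: "m \<in> carrier M"
    then have "hT (M.cov \<omega> (M.ft \<one>\<^bsub>B\<^esub> m)) = N.cov \<omega>' (hT (M.ft \<one>\<^bsub>B\<^esub> m))"
      using \<open>?l\<close> by (simp add: M.F.ten_closed)
    then show "\<omega>' (h m) = hT (\<omega> m)"
      using m by (simp add: M.cov_one[OF \<omega>] hT(3) h_closed N.cov_one[OF \<omega>'])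
  qed
next
  assume r: ?r
  show ?l
  proof
    fix t assume t: "t \<in> carrier M.F.T"
    show "hT (M.cov \<omega> t) = N.cov \<omega>' (hT t)"
    proof (rule M.F.additive_eqI[OF additive_comp[OF M.cov_additive[OF \<omega>] hTa]
          additive_comp[OF hTa N.cov_additive[OF \<omega>']] N.F.T_abelian _ t])
      fix b m assume "b \<in> carrier B" "m \<in> carrier M"
      then show "hT (M.cov \<omega> (M.ft b m)) = N.cov \<omega>' (hT (M.ft b m))"
        using r by (simp add: M.cov_ten[OF \<omega>] additive_add[OF hTa] M.F.ten_closed M.d_closed M.bar_closed
            M.F.T.smult_closed M.\<omega>_closed[OF \<omega>] hT(3) module_hom_smult[OF hT(2)] h_closed N.cov_ten[OF \<omega>'])
    qed
  qed
qed

lemma hX1_eps: "t \<in> carrier M.F.T \<Longrightarrow> hX 1 (M.eps 1 t) = N.eps 1 (hT t)"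
  by (rule M.F.additive_eqI[OF additive_comp[OF M.eps_additive hX1a] additive_comp[OF hTa N.eps_additive] N.C.X1.T_abelian])
    (simp_all add: M.eps_ten N.eps_ten hX1(3) hT(3) M.level1_hcomp_closed h_closed)

text \<open>By linearity it suffices to compare the two sides on \<open>1 \<otimes> m\<close>, where they are
  \<open>1 \<otimes> h m + \<epsilon> \<omega>'(h m)\<close> and \<open>1 \<otimes> h m + \<epsilon> (id \<otimes> h)(\<omega> m)\<close>.\<close>

lemma gauge_natural_iff:
  assumes \<omega>: "M.connection_form \<omega>" and \<omega>': "N.connection_form \<omega>'"
    and g: "g \<in> module_hom (denorm B 1) (M.C.X 0) (M.C.X 1)" and g': "g' \<in> module_hom (denorm B 1) (N.C.X 0) (N.C.X 1)"
    and g\<omega>: "\<And>m. m \<in> carrier M \<Longrightarrow> g (M.xt 0 \<one>\<^bsub>denorm B 1\<^esub> m) = M.xt 1 \<one>\<^bsub>denorm B 1\<^esub> m \<oplus>\<^bsub>M.C.X 1\<^esub> M.eps 1 (\<omega> m)"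
    and g\<omega>': "\<And>m. m \<in> carrier N \<Longrightarrow> g' (N.xt 0 \<one>\<^bsub>denorm B 1\<^esub> m) = N.xt 1 \<one>\<^bsub>denorm B 1\<^esub> m \<oplus>\<^bsub>N.C.X 1\<^esub> N.eps 1 (\<omega>' m)"
  shows "compose (carrier (M.C.X 0)) g' (hX 0) = compose (carrier (M.C.X 0)) (hX 1) g \<longleftrightarrow>
    (\<forall>m \<in> carrier M. \<omega>' (h m) = hT (\<omega> m))" (is "?l \<longleftrightarrow> ?r")
proof -
  note ga = module_hom_additive[OF g] and ga' = module_hom_additive[OF g']
  have EM: "M.eps 1 t \<in> carrier (M.C.X 1)" if "t \<in> carrier M.F.T" for t
    using that by (simp add: additive_closed[OF M.eps_additive])
  have EN: "N.eps 1 t \<in> carrier (N.C.X 1)" if "t \<in> carrier N.F.T" for t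
    using that by (simp add: additive_closed[OF N.eps_additive])
  have l: "g' (hX 0 (M.xt 0 \<one>\<^bsub>denorm B 1\<^esub> m)) = N.xt 1 \<one>\<^bsub>denorm B 1\<^esub> (h m) \<oplus>\<^bsub>N.C.X 1\<^esub> N.eps 1 (\<omega>' (h m))"
    and r: "hX 1 (g (M.xt 0 \<one>\<^bsub>denorm B 1\<^esub> m)) = N.xt 1 \<one>\<^bsub>denorm B 1\<^esub> (h m) \<oplus>\<^bsub>N.C.X 1\<^esub> N.eps 1 (hT (\<omega> m))"
    if m: "m \<in> carrier M" for m
    using m by (simp_all add: hX0(3) hX1(3) h_closed g\<omega> g\<omega>' additive_add[OF hX1a] M.C.X1.ten_closed EM
        M.\<omega>_closed[OF \<omega>] hX1_eps)
  show ?thesis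
  proof
    assume ?l
    show ?r
    proof
      fix m assume m: "m \<in> carrier M"
      have x: "M.xt 0 \<one>\<^bsub>denorm B 1\<^esub> m \<in> carrier (M.C.X 0)" using m by (simp add: M.C.X0.ten_closed)
      have "g' (hX 0 (M.xt 0 \<one>\<^bsub>denorm B 1\<^esub> m)) = hX 1 (g (M.xt 0 \<one>\<^bsub>denorm B 1\<^esub> m))"
        using fun_cong[OF \<open>?l\<close>, of "M.xt 0 \<one>\<^bsub>denorm B 1\<^esub> m"] by (simp add: compose_eq[OF x])
      then have "N.coeff (N.xt 1 \<one>\<^bsub>denorm B 1\<^esub> (h m) \<oplus>\<^bsub>N.C.X 1\<^esub> N.eps 1 (\<omega>' (h m))) =
          N.coeff (N.xt 1 \<one>\<^bsub>denorm B 1\<^esub> (h m) \<oplus>\<^bsub>N.C.X 1\<^esub> N.eps 1 (hT (\<omega> m)))"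
        using l[OF m] r[OF m] by simp
      moreover have "\<omega>' (h m) \<in> form_gr B N 1" "hT (\<omega> m) \<in> form_gr B N 1"
        using N.\<omega>_gr[OF \<omega>'] M.\<omega>_gr[OF \<omega>] m h_closed hT_gr by auto
      ultimately show "\<omega>' (h m) = hT (\<omega> m)"
        using m by (simp add: additive_add[OF N.coeff_additive] N.C.X1.ten_closed h_closed EN N.form_gr_closed N.coeff_one N.coeff_eps)
    qed
  next
    assume eq: ?r
    show ?l
    proof (rule extensionalityI)
      fix x assume x: "x \<in> carrier (M.C.X 0)"
      have "g' (hX 0 x) = hX 1 (g x)"
      proof (rule M.C.X0.linear_eqI[OF _ _ N.C.X1.T_abelian _ x])
        show "(\<lambda>x. g' (hX 0 x)) \<in> module_hom (denorm B 1) (M.C.X 0) (N.C.X 1)"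
          by (intro module_homI additive_comp[OF hX0a ga'])
            (simp add: module_hom_smult[OF g'] module_hom_smult[OF hX0(2)] additive_closed[OF hX0a])
        show "(\<lambda>x. hX 1 (g x)) \<in> module_hom (denorm B 1) (M.C.X 0) (N.C.X 1)"
          by (intro module_homI additive_comp[OF ga hX1a])
            (simp add: module_hom_smult[OF g] module_hom_smult[OF hX1(2)] additive_closed[OF ga])
      qed (simp add: l r eq)
      then show "compose (carrier (M.C.X 0)) g' (hX 0) x = compose (carrier (M.C.X 0)) (hX 1) g x"
        using x by (simp add: compose_eq)
    qed simp_all
  qed
qed

end

context dg begin

lemma dg_moduleI: "projective_of_rank (deg0 B) n M \<Longrightarrow> dg_module R B M"
  using dg_axioms by (simp add: dg_module_def dg_module_axioms_def projective_of_rank_def)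

lemma flat_bundles_connection_groupoid:
  "connection_groupoid (deg0 B) B (\<lambda>b. b) (flat_bundles n R B :: (('b, 'm) module \<times> _, 'm \<Rightarrow> 'm) gpd)
     (\<lambda>(M, \<D>). dg_module.flat_form B M \<D>)"
proof (rule connection_groupoid.intro)
  fix X :: "('b, 'm) module \<times> (('b \<times> 'm \<Rightarrow>\<^sub>0 int) set \<Rightarrow> ('b \<times> 'm \<Rightarrow>\<^sub>0 int) set)"
  show "Comp (flat_bundles n R B) X = compose (carrier (fst X))"
    "Ident (flat_bundles n R B) X = (\<lambda>x \<in> carrier (fst X). x)"
    by (auto simp: flat_bundles_def split: prod.splits)
  assume "X \<in> Ob (flat_bundles n R B)"
  then obtain M D where X: "X = (M, D)" and "projective_of_rank (deg0 B) n M" and D: "flat_connection R B M D"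
    by (auto simp: flat_bundles_def)
  then interpret M: dg_module R B M by (intro dg_moduleI)
  show "tensor (deg0 B) B (\<lambda>b. b) (fst X)" using X M.F.tensor_axioms by simp
  note \<omega> = M.flat_form[OF D]
  show "(case X of (M, D) \<Rightarrow> dg_module.flat_form B M D) m \<in> carrier (base_change (deg0 B) B (\<lambda>b. b) (fst X))"
    if "m \<in> carrier (fst X)" for m
    using that X by (simp add: M.\<omega>_closed[OF \<omega>])
  fix Y :: "('b, 'm) module \<times> (('b \<times> 'm \<Rightarrow>\<^sub>0 int) set \<Rightarrow> ('b \<times> 'm \<Rightarrow>\<^sub>0 int) set)" and h
  assume "Y \<in> Ob (flat_bundles n R B)"
  then obtain N D' where Y: "Y = (N, D')" and "projective_of_rank (deg0 B) n N" and D': "flat_connection R B N D'"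
    by (auto simp: flat_bundles_def)
  then interpret N: dg_module R B N by (intro dg_moduleI)
  show "h \<in> Hom (flat_bundles n R B) X Y \<longleftrightarrow> h \<in> module_iso (deg0 B) (fst X) (fst Y) \<and>
      (\<forall>m \<in> carrier (fst X). (case Y of (M, D) \<Rightarrow> dg_module.flat_form B M D) (h m) =
         base_change_map (deg0 B) B (\<lambda>b. b) (fst X) (fst Y) h ((case X of (M, D) \<Rightarrow> dg_module.flat_form B M D) m))"
  proof (cases "h \<in> module_iso (deg0 B) M N")
    case True
    then interpret dg_module_pair R B M N h
      by unfold_locales (simp add: module_iso_def)
    show ?thesis
      using True cov_natural_iff[OF M.flat_form[OF D] N.flat_form[OF D']]
      by (simp add: X Y flat_bundles_def M.cov_flat_form[OF D] N.cov_flat_form[OF D'] hT_def form_module_def)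
  qed (simp add: X Y flat_bundles_def)
qed

lemma Dstar_Ob:
  fixes M :: "('b, 'm) module"
  shows "(M, g) \<in> Ob (Dstar_BGL n B) \<longleftrightarrow> projective_of_rank (deg0 B) n M \<and>
     g \<in> module_iso (denorm B 1) (base_change (deg0 B) (denorm B 1) (coface0 B 0) M)
       (base_change (deg0 B) (denorm B 1) (coface0 B 1) M) \<and> dg_module.cocycle B M g"
proof (cases "projective_of_rank (deg0 B) n M")
  case True
  then interpret M: dg_module R B M by (rule dg_moduleI)
  show ?thesis
    using M.C.descent_cocycle_iff[of g n]
    by (auto simp: Dstar_BGL_def descent_groupoid_def BGL_def BGL_map_def module_iso_def)
qed (simp add: Dstar_BGL_def descent_groupoid_def BGL_def)

lemma Dstar_connection_groupoid:
  "connection_groupoid (deg0 B) B (\<lambda>b. b) (Dstar_BGL n B :: (('b, 'm) module \<times> _, 'm \<Rightarrow> 'm) gpd)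
     (\<lambda>(M, g). dg_module.gauge_form B M g)"
proof (rule connection_groupoid.intro)
  fix X :: "('b, 'm) module \<times> (((nat set \<Rightarrow> 'b) \<times> 'm \<Rightarrow>\<^sub>0 int) set \<Rightarrow> ((nat set \<Rightarrow> 'b) \<times> 'm \<Rightarrow>\<^sub>0 int) set)"
  show "Comp (Dstar_BGL n B) X = compose (carrier (fst X))"
    "Ident (Dstar_BGL n B) X = (\<lambda>x \<in> carrier (fst X). x)"
    by (auto simp: Dstar_BGL_def descent_groupoid_def BGL_def split: prod.splits)
  assume X': "X \<in> Ob (Dstar_BGL n B)"
  obtain M g where X: "X = (M, g)" by (cases X)
  with X' have M: "projective_of_rank (deg0 B) n M"
    and g: "g \<in> module_iso (denorm B 1) (base_change (deg0 B) (denorm B 1) (coface0 B 0) M)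
       (base_change (deg0 B) (denorm B 1) (coface0 B 1) M)" and c: "dg_module.cocycle B M g"
    by (auto simp: Dstar_Ob)
  interpret M: dg_module R B M by (rule dg_moduleI[OF M])
  note \<omega> = M.gauge_form_props[OF g c]
  show "tensor (deg0 B) B (\<lambda>b. b) (fst X)" using X M.F.tensor_axioms by simp
  show "(case X of (M, g) \<Rightarrow> dg_module.gauge_form B M g) m \<in> carrier (base_change (deg0 B) B (\<lambda>b. b) (fst X))"
    if "m \<in> carrier (fst X)" for m
    using that X by (simp add: M.\<omega>_closed[OF \<omega>(2)])
  fix Y :: "('b, 'm) module \<times> (((nat set \<Rightarrow> 'b) \<times> 'm \<Rightarrow>\<^sub>0 int) set \<Rightarrow> ((nat set \<Rightarrow> 'b) \<times> 'm \<Rightarrow>\<^sub>0 int) set)" and h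
  assume Y': "Y \<in> Ob (Dstar_BGL n B)"
  obtain N g' where Y: "Y = (N, g')" by (cases Y)
  with Y' have N: "projective_of_rank (deg0 B) n N"
    and g': "g' \<in> module_iso (denorm B 1) (base_change (deg0 B) (denorm B 1) (coface0 B 0) N)
       (base_change (deg0 B) (denorm B 1) (coface0 B 1) N)" and c': "dg_module.cocycle B N g'"
    by (auto simp: Dstar_Ob)
  interpret N: dg_module R B N by (rule dg_moduleI[OF N])
  note \<omega>' = N.gauge_form_props[OF g' c']
  show "h \<in> Hom (Dstar_BGL n B) X Y \<longleftrightarrow> h \<in> module_iso (deg0 B) (fst X) (fst Y) \<and>
      (\<forall>m \<in> carrier (fst X). (case Y of (M, g) \<Rightarrow> dg_module.gauge_form B M g) (h m) =
         base_change_map (deg0 B) B (\<lambda>b. b) (fst X) (fst Y) h ((case X of (M, g) \<Rightarrow> dg_module.gauge_form B M g) m))"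
  proof (cases "h \<in> module_iso (deg0 B) M N")
    case True
    then interpret dg_module_pair R B M N h
      by unfold_locales (simp add: module_iso_def)
    have gh: "g \<in> module_hom (denorm B 1) (M.C.X 0) (M.C.X 1)" "g' \<in> module_hom (denorm B 1) (N.C.X 0) (N.C.X 1)"
      using g g' by (auto simp: module_iso_def)
    show ?thesis
      using True gauge_natural_iff[OF \<omega>(2) \<omega>'(2) gh \<omega>(1) \<omega>'(1)]
      by (simp add: X Y Dstar_BGL_def descent_groupoid_def BGL_def BGL_map_def hT_def hX_def)
  qed (simp add: X Y Dstar_BGL_def descent_groupoid_def BGL_def)
qed

theorem Dstar_BGL_equivalent_flat_bundles:
  "equivalent_groupoids
     (Dstar_BGL n B :: (('b, 'm) module \<times> _, 'm \<Rightarrow> 'm) gpd)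
     (flat_bundles n R B :: (('b, 'm) module \<times> _, 'm \<Rightarrow> 'm) gpd)"
proof (rule equivalent_connection_groupoids[OF Dstar_connection_groupoid flat_bundles_connection_groupoid,
    where \<Phi> = "\<lambda>(M, g). (M, dg_module.cov B M (dg_module.gauge_form B M g))"
      and \<Psi> = "\<lambda>(M, \<D>). (M, dg_module.gauge B M (dg_module.flat_form B M \<D>))"])
  fix X :: "('b, 'm) module \<times> (((nat set \<Rightarrow> 'b) \<times> 'm \<Rightarrow>\<^sub>0 int) set \<Rightarrow> ((nat set \<Rightarrow> 'b) \<times> 'm \<Rightarrow>\<^sub>0 int) set)"
  assume X': "X \<in> Ob (Dstar_BGL n B)"
  obtain M g where X: "X = (M, g)" by (cases X)
  with X' have M: "projective_of_rank (deg0 B) n M"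
    and g: "g \<in> module_iso (denorm B 1) (base_change (deg0 B) (denorm B 1) (coface0 B 0) M)
       (base_change (deg0 B) (denorm B 1) (coface0 B 1) M)" and c: "dg_module.cocycle B M g"
    by (auto simp: Dstar_Ob)
  interpret M: dg_module R B M by (rule dg_moduleI[OF M])
  note \<omega> = M.gauge_form_props[OF g c]
  show "(case X of (M, g) \<Rightarrow> (M, dg_module.cov B M (dg_module.gauge_form B M g))) \<in> Ob (flat_bundles n R B) \<and>
     fst (case X of (M, g) \<Rightarrow> (M, dg_module.cov B M (dg_module.gauge_form B M g))) = fst X \<and>
     (\<forall>m \<in> carrier (fst X). (case (case X of (M, g) \<Rightarrow> (M, dg_module.cov B M (dg_module.gauge_form B M g))) of
         (M, \<D>) \<Rightarrow> dg_module.flat_form B M \<D>) m = (case X of (M, g) \<Rightarrow> dg_module.gauge_form B M g) m)"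
    using M M.cov_flat_connection[OF \<omega>(2,3)] by (simp add: X flat_bundles_def M.flat_form_def M.cov_one[OF \<omega>(2)])
next
  fix Y :: "('b, 'm) module \<times> (('b \<times> 'm \<Rightarrow>\<^sub>0 int) set \<Rightarrow> ('b \<times> 'm \<Rightarrow>\<^sub>0 int) set)"
  assume "Y \<in> Ob (flat_bundles n R B)"
  then obtain M D where Y: "Y = (M, D)" and M: "projective_of_rank (deg0 B) n M" and D: "flat_connection R B M D"
    by (auto simp: flat_bundles_def)
  interpret M: dg_module R B M by (rule dg_moduleI[OF M])
  note \<omega> = M.flat_form[OF D]
  have "M.cocycle (M.gauge (M.flat_form D))"
    using M.cocycle_iff_flat[OF M.gauge_hom[OF \<omega>] \<omega> M.gauge_one[OF \<omega>]] M.flat_form_flat[OF D] by blast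
  then show "(case Y of (M, \<D>) \<Rightarrow> (M, dg_module.gauge B M (dg_module.flat_form B M \<D>))) \<in> Ob (Dstar_BGL n B) \<and>
     fst (case Y of (M, \<D>) \<Rightarrow> (M, dg_module.gauge B M (dg_module.flat_form B M \<D>))) = fst Y \<and>
     (\<forall>m \<in> carrier (fst Y). (case (case Y of (M, \<D>) \<Rightarrow> (M, dg_module.gauge B M (dg_module.flat_form B M \<D>))) of
         (M, g) \<Rightarrow> dg_module.gauge_form B M g) m = (case Y of (M, \<D>) \<Rightarrow> dg_module.flat_form B M \<D>) m)"
    using M M.gauge_iso[OF \<omega>] by (simp add: Y Dstar_Ob M.gauge_form_def M.coeff_gauge[OF \<omega>])
qed

end

theorem mainTheorem4:
  fixes R :: "('r, 'x) ring_scheme" and B :: "('r, 'b, 'y) dg_alg_scheme" and n :: nat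
  assumes "comm_Q_algebra R"
    and "DG_CAlg R B"
    and "n \<ge> 1"
  shows "equivalent_groupoids
           (Dstar_BGL n B :: (('b, 'm) module \<times> _, 'm \<Rightarrow> 'm) gpd)
           (flat_bundles n R B :: (('b, 'm) module \<times> _, 'm \<Rightarrow> 'm) gpd)"
  using dg.Dstar_BGL_equivalent_flat_bundles[OF dg.intro[OF assms(2)]] .

end
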